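(* Let $\mathcal{I}$ be a generalised inverse category and let $\mathcal{E}$ be a category admitting all limits indexed by $\mathcal{I}^-(i)$ for $i \in \mathcal{I}$. Assume that each groupoid $\mathbb{G}_n(\mathcal{I})$ ($n \in \mathbb{N}$) is connected or $\mathcal{E}$ has an initial object. If $\mathcal{E}$ has all finite limits, a subobject classifier $\Omega_{\mathcal{E}}$ and a truth map $\mathrm{true}_{\mathcal{E}} : 1_{\mathcal{E}} \to \Omega_{\mathcal{E}}$, then $\mathcal{E}^{\mathcal{I}}$ has a subobject classifier $\Omega$ and a truth map $\mathrm{true} : 1 \to \Omega$. Moreover, at each $i \in \mathcal{I}$, $\Omega i$ is the equaliser in $\mathcal{E}$ $$\Omega i \hookrightarrow \Omega_{\mathcal{E}} \times M_i\Omega \rightrightarrows \Omega_{\mathcal{E}}$$ of $\pi_1$ and $\wedge \circ (\mathrm{id} \times \chi_{M_i(\mathrm{true})})$, where $\chi_{M_i(\mathrm{true})} : M_i\Omega \to \Omega_{\mathcal{E}}$ is the characteristic map of $M_i(\mathrm{true}) : 1 \cong M_i 1 \hookrightarrow M_i\Omega$ in $\mathcal{E}$ and $\wedge : \Omega_{\mathcal{E}} \times \Omega_{\mathcal{E}} \to \Omega_{\mathcal{E}}$ is the internal meet; and the composite of $\mathrm{true}_i : 1 \to \Omega i$ with $\Omega i \hookrightarrow \Omega_{\mathcal{E}} \times M_i\Omega$ has components $\mathrm{true}_{\mathcal{E}}$ and $M_i(\mathrm{true})$.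
   Context: A *generalised inverse category* is a category $\mathcal{I}$ with a function $\deg : \mathrm{ob}\,\mathcal{I} \to \mathbb{N}$ such that $\deg i > \deg j$ for every non-isomorphism $i \to j$ and $\deg i = \deg j$ for every isomorphism $i \cong j$. $\mathbb{G}_n(\mathcal{I})$ is the subgroupoid of $\mathcal{I}$ of objects of degree exactly $n$ and isomorphisms between them. $\mathcal{I}^-(i)$ is the full subcategory of the coslice $i/\mathcal{I}$ spanned by the strictly degree-decreasing maps out of $i$. For $X \in \mathcal{E}^{\mathcal{I}}$, the *matching object* of $X$ at $i$ is $M_i X := \lim\big(\mathcal{I}^-(i) \to \mathcal{I} \xrightarrow{X} \mathcal{E}\big)$, where $\mathcal{I}^-(i) \to \mathcal{I}$ is the codomain functor; it is functorial in $X$. The characteristic map of a mono is the unique map to the subobject classifier along which the pullback of the truth map is that mono; the internal meet is the characteristic map of $(\mathrm{true}_{\mathcal{E}}, \mathrm{true}_{\mathcal{E}})$. *)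

theory Defs
  imports "HOL-Library.FuncSet"
begin

section \<open>Categories, functors and natural transformations\<close>

text \<open>The fields of the record are unconstrained outside the carriers \<open>Ob\<close> and \<open>Arr\<close>.\<close>

record ('o, 'm) cat =
  Ob :: "'o set"
  Arr :: "'m set"
  Dom :: "'m \<Rightarrow> 'o"
  Cod :: "'m \<Rightarrow> 'o"
  Ident :: "'o \<Rightarrow> 'm"
  Comp :: "'m \<Rightarrow> 'm \<Rightarrow> 'm"  (infixl "\<cdot>\<index>" 70)

definition Hom :: "('o, 'm) cat \<Rightarrow> 'o \<Rightarrow> 'o \<Rightarrow> 'm set" where
  "Hom C x y = {f \<in> Arr C. Dom C f = x \<and> Cod C f = y}"

locale category =
  fixes C :: "('o, 'm) cat" (structure)
  assumes Dom_in_Ob: "f \<in> Arr C \<Longrightarrow> Dom C f \<in> Ob C"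
    and Cod_in_Ob: "f \<in> Arr C \<Longrightarrow> Cod C f \<in> Ob C"
    and Ident_in_Hom: "x \<in> Ob C \<Longrightarrow> Ident C x \<in> Hom C x x"
    and Comp_in_Hom: "f \<in> Hom C x y \<Longrightarrow> g \<in> Hom C y z \<Longrightarrow> g \<cdot> f \<in> Hom C x z"
    and Comp_Ident_right: "f \<in> Arr C \<Longrightarrow> f \<cdot> Ident C (Dom C f) = f"
    and Comp_Ident_left: "f \<in> Arr C \<Longrightarrow> Ident C (Cod C f) \<cdot> f = f"
    and Comp_assoc: "f \<in> Hom C w x \<Longrightarrow> g \<in> Hom C x y \<Longrightarrow> h \<in> Hom C y z \<Longrightarrow>
                     (h \<cdot> g) \<cdot> f = h \<cdot> (g \<cdot> f)"

definition is_iso :: "('o, 'm) cat \<Rightarrow> 'm \<Rightarrow> bool" where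
  "is_iso C f \<longleftrightarrow> f \<in> Arr C \<and>
     (\<exists>g \<in> Hom C (Cod C f) (Dom C f).
        g \<cdot>\<^bsub>C\<^esub> f = Ident C (Dom C f) \<and> f \<cdot>\<^bsub>C\<^esub> g = Ident C (Cod C f))"

definition is_mono :: "('o, 'm) cat \<Rightarrow> 'm \<Rightarrow> bool" where
  "is_mono C m \<longleftrightarrow> m \<in> Arr C \<and>
     (\<forall>x \<in> Ob C. \<forall>f \<in> Hom C x (Dom C m). \<forall>g \<in> Hom C x (Dom C m).
        m \<cdot>\<^bsub>C\<^esub> f = m \<cdot>\<^bsub>C\<^esub> g \<longrightarrow> f = g)"

record ('i, 'a, 'o, 'm) fnctr =
  FOb :: "'i \<Rightarrow> 'o"
  FArr :: "'a \<Rightarrow> 'm"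

definition is_functor ::
    "('i, 'a) cat \<Rightarrow> ('o, 'm) cat \<Rightarrow> ('i, 'a, 'o, 'm) fnctr \<Rightarrow> bool" where
  "is_functor J C F \<longleftrightarrow>
     (\<forall>x \<in> Ob J. FOb F x \<in> Ob C) \<and>
     (\<forall>f \<in> Arr J. FArr F f \<in> Hom C (FOb F (Dom J f)) (FOb F (Cod J f))) \<and>
     (\<forall>x \<in> Ob J. FArr F (Ident J x) = Ident C (FOb F x)) \<and>
     (\<forall>f \<in> Arr J. \<forall>g \<in> Arr J. Cod J f = Dom J g \<longrightarrow>
        FArr F (g \<cdot>\<^bsub>J\<^esub> f) = FArr F g \<cdot>\<^bsub>C\<^esub> FArr F f)"

definition fcomp ::
    "('i, 'a, 'o, 'm) fnctr \<Rightarrow> ('j, 'b, 'i, 'a) fnctr \<Rightarrow> ('j, 'b, 'o, 'm) fnctr" where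
  "fcomp G F = \<lparr>FOb = FOb G \<circ> FOb F, FArr = FArr G \<circ> FArr F\<rparr>"

record ('i, 'a, 'o, 'm) nattrans =
  NSrc :: "('i, 'a, 'o, 'm) fnctr"
  NTgt :: "('i, 'a, 'o, 'm) fnctr"
  NAt :: "'i \<Rightarrow> 'm"

definition is_nattrans ::
    "('i, 'a) cat \<Rightarrow> ('o, 'm) cat \<Rightarrow> ('i, 'a, 'o, 'm) nattrans \<Rightarrow> bool" where
  "is_nattrans J C t \<longleftrightarrow>
     is_functor J C (NSrc t) \<and> is_functor J C (NTgt t) \<and>
     (\<forall>x \<in> Ob J. NAt t x \<in> Hom C (FOb (NSrc t) x) (FOb (NTgt t) x)) \<and>
     (\<forall>f \<in> Arr J. NAt t (Cod J f) \<cdot>\<^bsub>C\<^esub> FArr (NSrc t) f = FArr (NTgt t) f \<cdot>\<^bsub>C\<^esub> NAt t (Dom J f))"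

text \<open>In the category of functors \<open>C\<^sup>J\<close> all functors and natural transformations are
  \<open>undefined\<close> off the carriers of \<open>J\<close>, so that equality in HOL is equality of functors and of
  natural transformations.\<close>

definition ext_functor ::
    "('i, 'a) cat \<Rightarrow> ('o, 'm) cat \<Rightarrow> ('i, 'a, 'o, 'm) fnctr \<Rightarrow> bool" where
  "ext_functor J C F \<longleftrightarrow>
     is_functor J C F \<and> FOb F \<in> extensional (Ob J) \<and> FArr F \<in> extensional (Arr J)"

definition functor_category ::
    "('i, 'a) cat \<Rightarrow> ('o, 'm) cat \<Rightarrow> (('i, 'a, 'o, 'm) fnctr, ('i, 'a, 'o, 'm) nattrans) cat" where
  "functor_category J C =
     \<lparr>Ob = {F. ext_functor J C F},
      Arr = {t. is_nattrans J C t \<and> ext_functor J C (NSrc t) \<and> ext_functor J C (NTgt t) \<and>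
                NAt t \<in> extensional (Ob J)},
      Dom = NSrc,
      Cod = NTgt,
      Ident = (\<lambda>F. \<lparr>NSrc = F, NTgt = F, NAt = (\<lambda>x\<in>Ob J. Ident C (FOb F x))\<rparr>),
      Comp = (\<lambda>t s. \<lparr>NSrc = NSrc s, NTgt = NTgt t, NAt = (\<lambda>x\<in>Ob J. NAt t x \<cdot>\<^bsub>C\<^esub> NAt s x)\<rparr>)\<rparr>"

section \<open>Limits\<close>

definition is_cone ::
    "('j, 'b) cat \<Rightarrow> ('o, 'm) cat \<Rightarrow> ('j, 'b, 'o, 'm) fnctr \<Rightarrow> 'o \<Rightarrow> ('j \<Rightarrow> 'm) \<Rightarrow> bool" where
  "is_cone J C D v l \<longleftrightarrow> v \<in> Ob C \<and> (\<forall>j \<in> Ob J. l j \<in> Hom C v (FOb D j)) \<and>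
     (\<forall>f \<in> Arr J. FArr D f \<cdot>\<^bsub>C\<^esub> l (Dom J f) = l (Cod J f))"

definition is_limit ::
    "('j, 'b) cat \<Rightarrow> ('o, 'm) cat \<Rightarrow> ('j, 'b, 'o, 'm) fnctr \<Rightarrow> 'o \<Rightarrow> ('j \<Rightarrow> 'm) \<Rightarrow> bool" where
  "is_limit J C D v l \<longleftrightarrow> is_cone J C D v l \<and>
     (\<forall>w k. is_cone J C D w k \<longrightarrow>
        (\<exists>!h. h \<in> Hom C w v \<and> (\<forall>j \<in> Ob J. l j \<cdot>\<^bsub>C\<^esub> h = k j)))"

definition has_limits_of_shape :: "('j, 'b) cat \<Rightarrow> ('o, 'm) cat \<Rightarrow> bool" where
  "has_limits_of_shape J C \<longleftrightarrow> (\<forall>D. is_functor J C D \<longrightarrow> (\<exists>v l. is_limit J C D v l))"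

text \<open>Every finite category is isomorphic to one whose objects and arrows are natural numbers.\<close>

definition has_finite_limits :: "('o, 'm) cat \<Rightarrow> bool" where
  "has_finite_limits C \<longleftrightarrow>
     (\<forall>J :: (nat, nat) cat. category J \<and> finite (Ob J) \<and> finite (Arr J) \<longrightarrow>
        has_limits_of_shape J C)"

definition limit_cone ::
    "('j, 'b) cat \<Rightarrow> ('o, 'm) cat \<Rightarrow> ('j, 'b, 'o, 'm) fnctr \<Rightarrow> 'o \<times> ('j \<Rightarrow> 'm)" where
  "limit_cone J C D = (SOME (v, l). is_limit J C D v l)"

definition is_terminal :: "('o, 'm) cat \<Rightarrow> 'o \<Rightarrow> bool" where
  "is_terminal C u \<longleftrightarrow> u \<in> Ob C \<and> (\<forall>x \<in> Ob C. \<exists>!f. f \<in> Hom C x u)"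

definition is_initial :: "('o, 'm) cat \<Rightarrow> 'o \<Rightarrow> bool" where
  "is_initial C z \<longleftrightarrow> z \<in> Ob C \<and> (\<forall>x \<in> Ob C. \<exists>!f. f \<in> Hom C z x)"

text \<open>Meaningful only if there is exactly one arrow from \<open>x\<close> to \<open>u\<close>, e.g. if \<open>u\<close> is terminal.\<close>

definition unique_arrow :: "('o, 'm) cat \<Rightarrow> 'o \<Rightarrow> 'o \<Rightarrow> 'm" where
  "unique_arrow C x u = (THE f. f \<in> Hom C x u)"

definition is_equaliser :: "('o, 'm) cat \<Rightarrow> 'm \<Rightarrow> 'm \<Rightarrow> 'm \<Rightarrow> bool" where
  "is_equaliser C e f g \<longleftrightarrow>
     f \<in> Arr C \<and> g \<in> Arr C \<and> Dom C f = Dom C g \<and> Cod C f = Cod C g \<and>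
     e \<in> Arr C \<and> Cod C e = Dom C f \<and> f \<cdot>\<^bsub>C\<^esub> e = g \<cdot>\<^bsub>C\<^esub> e \<and>
     (\<forall>x \<in> Ob C. \<forall>k \<in> Hom C x (Dom C f). f \<cdot>\<^bsub>C\<^esub> k = g \<cdot>\<^bsub>C\<^esub> k \<longrightarrow>
        (\<exists>!h. h \<in> Hom C x (Dom C e) \<and> e \<cdot>\<^bsub>C\<^esub> h = k))"

text \<open>\<open>is_pullback C p q f g\<close>: the square \<open>f \<cdot> p = g \<cdot> q\<close> is a pullback square.\<close>

definition is_pullback :: "('o, 'm) cat \<Rightarrow> 'm \<Rightarrow> 'm \<Rightarrow> 'm \<Rightarrow> 'm \<Rightarrow> bool" where
  "is_pullback C p q f g \<longleftrightarrow>
     f \<in> Arr C \<and> g \<in> Arr C \<and> Cod C f = Cod C g \<and>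
     p \<in> Arr C \<and> q \<in> Arr C \<and> Dom C p = Dom C q \<and> Cod C p = Dom C f \<and> Cod C q = Dom C g \<and>
     f \<cdot>\<^bsub>C\<^esub> p = g \<cdot>\<^bsub>C\<^esub> q \<and>
     (\<forall>x \<in> Ob C. \<forall>a \<in> Hom C x (Dom C f). \<forall>b \<in> Hom C x (Dom C g).
        f \<cdot>\<^bsub>C\<^esub> a = g \<cdot>\<^bsub>C\<^esub> b \<longrightarrow>
        (\<exists>!h. h \<in> Hom C x (Dom C p) \<and> p \<cdot>\<^bsub>C\<^esub> h = a \<and> q \<cdot>\<^bsub>C\<^esub> h = b))"

definition is_product :: "('o, 'm) cat \<Rightarrow> 'o \<Rightarrow> 'o \<Rightarrow> 'o \<Rightarrow> 'm \<Rightarrow> 'm \<Rightarrow> bool" where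
  "is_product C a b p p1 p2 \<longleftrightarrow>
     p \<in> Ob C \<and> p1 \<in> Hom C p a \<and> p2 \<in> Hom C p b \<and>
     (\<forall>x \<in> Ob C. \<forall>f \<in> Hom C x a. \<forall>g \<in> Hom C x b.
        \<exists>!h. h \<in> Hom C x p \<and> p1 \<cdot>\<^bsub>C\<^esub> h = f \<and> p2 \<cdot>\<^bsub>C\<^esub> h = g)"

text \<open>A chosen product cone for every pair of objects that has a product.\<close>

definition product_cone :: "('o, 'm) cat \<Rightarrow> 'o \<Rightarrow> 'o \<Rightarrow> 'o \<times> 'm \<times> 'm" where
  "product_cone C a b = (SOME (p, p1, p2). is_product C a b p p1 p2)"

definition prod_ob :: "('o, 'm) cat \<Rightarrow> 'o \<Rightarrow> 'o \<Rightarrow> 'o" where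
  "prod_ob C a b = fst (product_cone C a b)"

definition proj1 :: "('o, 'm) cat \<Rightarrow> 'o \<Rightarrow> 'o \<Rightarrow> 'm" where
  "proj1 C a b = fst (snd (product_cone C a b))"

definition proj2 :: "('o, 'm) cat \<Rightarrow> 'o \<Rightarrow> 'o \<Rightarrow> 'm" where
  "proj2 C a b = snd (snd (product_cone C a b))"

definition pairing :: "('o, 'm) cat \<Rightarrow> 'm \<Rightarrow> 'm \<Rightarrow> 'm" where
  "pairing C f g =
     (THE h. h \<in> Hom C (Dom C f) (prod_ob C (Cod C f) (Cod C g)) \<and>
             proj1 C (Cod C f) (Cod C g) \<cdot>\<^bsub>C\<^esub> h = f \<and> proj2 C (Cod C f) (Cod C g) \<cdot>\<^bsub>C\<^esub> h = g)"

definition prod_arr :: "('o, 'm) cat \<Rightarrow> 'm \<Rightarrow> 'm \<Rightarrow> 'm" where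
  "prod_arr C f g =
     pairing C (f \<cdot>\<^bsub>C\<^esub> proj1 C (Dom C f) (Dom C g)) (g \<cdot>\<^bsub>C\<^esub> proj2 C (Dom C f) (Dom C g))"

section \<open>Subobject classifiers\<close>

text \<open>The arrow \<open>q\<close> is the unique map from the domain of \<open>m\<close> to the terminal object \<open>Dom C t\<close>.\<close>

definition is_char_map :: "('o, 'm) cat \<Rightarrow> 'm \<Rightarrow> 'm \<Rightarrow> 'm \<Rightarrow> bool" where
  "is_char_map C t m c \<longleftrightarrow> c \<in> Hom C (Cod C m) (Cod C t) \<and> (\<exists>q. is_pullback C m q c t)"

definition is_subobject_classifier :: "('o, 'm) cat \<Rightarrow> 'o \<Rightarrow> 'o \<Rightarrow> 'm \<Rightarrow> bool" where
  "is_subobject_classifier C u Om t \<longleftrightarrow>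
     is_terminal C u \<and> t \<in> Hom C u Om \<and>
     (\<forall>m. is_mono C m \<longrightarrow> (\<exists>!c. is_char_map C t m c))"

definition char_map :: "('o, 'm) cat \<Rightarrow> 'm \<Rightarrow> 'm \<Rightarrow> 'm" where
  "char_map C t m = (THE c. is_char_map C t m c)"

definition internal_meet :: "('o, 'm) cat \<Rightarrow> 'm \<Rightarrow> 'm" where
  "internal_meet C t = char_map C t (pairing C t t)"

section \<open>Generalised inverse categories and matching objects\<close>

definition generalised_inverse_category :: "('i, 'a) cat \<Rightarrow> ('i \<Rightarrow> nat) \<Rightarrow> bool" where
  "generalised_inverse_category I deg \<longleftrightarrow> category I \<and>
     (\<forall>f \<in> Arr I. if is_iso I f then deg (Dom I f) = deg (Cod I f)
                  else deg (Dom I f) > deg (Cod I f))"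

definition degree_groupoid :: "('i, 'a) cat \<Rightarrow> ('i \<Rightarrow> nat) \<Rightarrow> nat \<Rightarrow> ('i, 'a) cat" where
  "degree_groupoid I deg n =
     I\<lparr>Ob := {x \<in> Ob I. deg x = n},
       Arr := {f \<in> Arr I. is_iso I f \<and> deg (Dom I f) = n \<and> deg (Cod I f) = n}\<rparr>"

text \<open>Connectedness of a groupoid, where a zigzag of arrows amounts to a single arrow.
  The empty groupoid is allowed.\<close>

definition connected_groupoid :: "('i, 'a) cat \<Rightarrow> bool" where
  "connected_groupoid G \<longleftrightarrow> (\<forall>x \<in> Ob G. \<forall>y \<in> Ob G. Hom G x y \<noteq> {})"

text \<open>An arrow \<open>(f, h, g)\<close> of the coslice is an arrow \<open>h\<close> from \<open>Cod C f\<close> to \<open>Cod C g\<close> with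
  \<open>h \<cdot> f = g\<close>.\<close>

definition coslice :: "('i, 'a) cat \<Rightarrow> 'i \<Rightarrow> ('a, 'a \<times> 'a \<times> 'a) cat" where
  "coslice C x =
     \<lparr>Ob = {f \<in> Arr C. Dom C f = x},
      Arr = {(f, h, g). f \<in> Arr C \<and> Dom C f = x \<and> g \<in> Arr C \<and> Dom C g = x \<and>
                        h \<in> Hom C (Cod C f) (Cod C g) \<and> h \<cdot>\<^bsub>C\<^esub> f = g},
      Dom = (\<lambda>(f, h, g). f),
      Cod = (\<lambda>(f, h, g). g),
      Ident = (\<lambda>f. (f, Ident C (Cod C f), f)),
      Comp = (\<lambda>(f', h', g') (f, h, g). (f, h' \<cdot>\<^bsub>C\<^esub> h, g'))\<rparr>"

definition full_subcategory :: "('i, 'a) cat \<Rightarrow> 'i set \<Rightarrow> ('i, 'a) cat" where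
  "full_subcategory C S =
     C\<lparr>Ob := Ob C \<inter> S, Arr := {f \<in> Arr C. Dom C f \<in> S \<and> Cod C f \<in> S}\<rparr>"

definition decreasing_coslice ::
    "('i, 'a) cat \<Rightarrow> ('i \<Rightarrow> nat) \<Rightarrow> 'i \<Rightarrow> ('a, 'a \<times> 'a \<times> 'a) cat" where
  "decreasing_coslice I deg i =
     full_subcategory (coslice I i) {f. deg (Dom I f) > deg (Cod I f)}"

definition codomain_functor :: "('i, 'a) cat \<Rightarrow> ('a, 'a \<times> 'a \<times> 'a, 'i, 'a) fnctr" where
  "codomain_functor I = \<lparr>FOb = Cod I, FArr = (\<lambda>(f, h, g). h)\<rparr>"

definition matching_cone ::
    "('i, 'a) cat \<Rightarrow> ('i \<Rightarrow> nat) \<Rightarrow> ('o, 'm) cat \<Rightarrow> 'i \<Rightarrow> ('i, 'a, 'o, 'm) fnctr \<Rightarrow>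
     'o \<times> ('a \<Rightarrow> 'm)" where
  "matching_cone I deg E i X =
     limit_cone (decreasing_coslice I deg i) E (fcomp X (codomain_functor I))"

definition matching_ob ::
    "('i, 'a) cat \<Rightarrow> ('i \<Rightarrow> nat) \<Rightarrow> ('o, 'm) cat \<Rightarrow> 'i \<Rightarrow> ('i, 'a, 'o, 'm) fnctr \<Rightarrow> 'o" where
  "matching_ob I deg E i X = fst (matching_cone I deg E i X)"

definition matching_proj ::
    "('i, 'a) cat \<Rightarrow> ('i \<Rightarrow> nat) \<Rightarrow> ('o, 'm) cat \<Rightarrow> 'i \<Rightarrow> ('i, 'a, 'o, 'm) fnctr \<Rightarrow> 'a \<Rightarrow> 'm" where
  "matching_proj I deg E i X = snd (matching_cone I deg E i X)"

definition matching_arr ::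
    "('i, 'a) cat \<Rightarrow> ('i \<Rightarrow> nat) \<Rightarrow> ('o, 'm) cat \<Rightarrow> 'i \<Rightarrow> ('i, 'a, 'o, 'm) nattrans \<Rightarrow> 'm" where
  "matching_arr I deg E i t =
     (THE h. h \<in> Hom E (matching_ob I deg E i (NSrc t)) (matching_ob I deg E i (NTgt t)) \<and>
        (\<forall>f \<in> Ob (decreasing_coslice I deg i).
           matching_proj I deg E i (NTgt t) f \<cdot>\<^bsub>E\<^esub> h =
           NAt t (Cod I f) \<cdot>\<^bsub>E\<^esub> matching_proj I deg E i (NSrc t) f))"

text \<open>For an arrow \<open>t\<close> whose source is terminal, the composite of \<open>M\<^sub>i t\<close> with the isomorphism
  from the terminal object \<open>u\<close> to the matching object of the source of \<open>t\<close>.\<close>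

definition matching_point ::
    "('i, 'a) cat \<Rightarrow> ('i \<Rightarrow> nat) \<Rightarrow> ('o, 'm) cat \<Rightarrow> 'o \<Rightarrow> 'i \<Rightarrow> ('i, 'a, 'o, 'm) nattrans \<Rightarrow> 'm" where
  "matching_point I deg E u i t =
     matching_arr I deg E i t \<cdot>\<^bsub>E\<^esub> unique_arrow E u (matching_ob I deg E i (NSrc t))"

end

theory Submission
  imports Defs
begin

text \<open>
  A subobject of \<open>X\<close> restricts along every arrow out of \<open>i\<close>, so a point of the classifier at \<open>i\<close>
  should be a family of truth values \<open>p\<^sub>f\<close>, one for each arrow \<open>f\<close> out of \<open>i\<close>, with \<open>p\<^sub>f \<le> p\<^sub>g\<^sub>f\<close> for
  all composable \<open>g\<close>; \<open>\<Omega> i\<close> is an object representing such families. If \<open>\<Omega>\<close> exists in all degrees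
  below that of \<open>i\<close>, then \<open>M\<^sub>i \<Omega>\<close> represents the families on the degree-decreasing arrows out of
  \<open>i\<close>. All other arrows out of \<open>i\<close> are isomorphisms, at which the family has its value \<open>p\<close> at the
  identity, and monotonicity says that \<open>p\<close> is below every component of the rest \<open>q\<close>, i.e.
  \<open>p \<le> \<chi> \<circ> q\<close> for the characteristic map \<open>\<chi>\<close> of \<open>M\<^sub>i(true)\<close>. So the equaliser represents the families
  out of \<open>i\<close>, and \<open>\<Omega>\<close> exists by induction on the degree. Its universal property is checked
  pointwise, since pullbacks and hence monos in the functor category are pointwise.
\<close>

section \<open>Finite limits\<close>

text \<open>A direct recursion on the degree would have to produce, along with each object
  \<open>omega_ob i\<close>, the arrows acting on it, including those of isomorphisms within one
  degree, and to keep the choices of equalisers compatible with that action. The universal property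
  removes this obstacle: reading arrows out of \<open>Cod I g\<close> as arrows out of
  \<open>Dom I g\<close> restricts families along \<open>g\<close>, so \<open>omega_arr g\<close> is
  forced, and functor laws and naturality become uniqueness statements. The induction is left with
  mere existence. Truth values are compared through generalised elements: \<open>k\<close> satisfies
  \<open>p\<close> if \<open>p \<cdot> k = truth y\<close>, and two truth values satisfied by the
  same \<open>k\<close> are equal because they classify the same mono. The arrow classifying a mono
  \<open>m\<close> into \<open>X\<close> is then known from its components: at \<open>f\<close> it
  is the characteristic map of \<open>m\<close> at \<open>Cod I f\<close>, composed with
  \<open>FArr X f\<close>.\<close>

lemma HomD:
  assumes "f \<in> Hom C x y"
  shows "f \<in> Arr C" "Dom C f = x" "Cod C f = y"
  using assms by (simp_all add: Hom_def)

context category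
begin

lemma Hom_Ob:
  assumes "f \<in> Hom C x y"
  shows "x \<in> Ob C" "y \<in> Ob C"
  using HomD[OF assms] Dom_in_Ob Cod_in_Ob by auto

lemma comp_id: "f \<in> Hom C x y \<Longrightarrow> f \<cdot> Ident C x = f"
  using Comp_Ident_right by (auto simp: Hom_def)

lemma id_comp: "f \<in> Hom C x y \<Longrightarrow> Ident C y \<cdot> f = f"
  using Comp_Ident_left by (auto simp: Hom_def)

lemma Ident_Arr:
  assumes "x \<in> Ob C"
  shows "Ident C x \<in> Arr C" "Dom C (Ident C x) = x" "Cod C (Ident C x) = x"
  using HomD[OF Ident_in_Hom[OF assms]] by auto

lemma Comp_Arr:
  assumes "f \<in> Arr C" "g \<in> Arr C" "Dom C g = Cod C f"
  shows "g \<cdot> f \<in> Arr C" "Dom C (g \<cdot> f) = Dom C f" "Cod C (g \<cdot> f) = Cod C g"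
  using HomD[OF Comp_in_Hom[of f "Dom C f" "Cod C f" g "Cod C g"]] assms
  by (auto simp: Hom_def)

lemma terminal_arrow:
  assumes "is_terminal C u" "x \<in> Ob C"
  shows "unique_arrow C x u \<in> Hom C x u"
  unfolding unique_arrow_def by (rule theI') (use assms in \<open>simp add: is_terminal_def\<close>)

lemma terminal_unique:
  assumes "is_terminal C u" "f \<in> Hom C x u" "g \<in> Hom C x u"
  shows "f = g"
proof -
  have "\<exists>!h. h \<in> Hom C x u"
    using assms(1) Hom_Ob(1)[OF assms(2)] by (simp add: is_terminal_def)
  then show ?thesis using assms(2,3) by blast
qed

lemma is_monoD:
  assumes "is_mono C m" "f \<in> Hom C x (Dom C m)" "g \<in> Hom C x (Dom C m)" "m \<cdot> f = m \<cdot> g"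
  shows "f = g"
  using assms Hom_Ob(1)[OF assms(2)] by (simp add: is_mono_def)

lemma pullback_universal:
  assumes "is_pullback C p q f g" "a \<in> Hom C x (Dom C f)" "b \<in> Hom C x (Dom C g)"
    "f \<cdot> a = g \<cdot> b"
  shows "\<exists>!h. h \<in> Hom C x (Dom C p) \<and> p \<cdot> h = a \<and> q \<cdot> h = b"
proof -
  have "\<forall>x \<in> Ob C. \<forall>a \<in> Hom C x (Dom C f). \<forall>b \<in> Hom C x (Dom C g).
      f \<cdot> a = g \<cdot> b \<longrightarrow> (\<exists>!h. h \<in> Hom C x (Dom C p) \<and> p \<cdot> h = a \<and> q \<cdot> h = b)"
    using assms(1) unfolding is_pullback_def by (elim conjE)
  then show ?thesis using assms(2-) Hom_Ob(1)[OF assms(2)] by simp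
qed

lemma equaliser_universal:
  assumes "is_equaliser C e f g" "k \<in> Hom C x (Dom C f)" "f \<cdot> k = g \<cdot> k"
  shows "\<exists>!h. h \<in> Hom C x (Dom C e) \<and> e \<cdot> h = k"
  using assms Hom_Ob(1)[OF assms(2)] by (simp add: is_equaliser_def)

text \<open>Composing the limit cone with \<open>h\<close> gives another cone, and both arrows
  mediate it. The shape \<open>J\<close> enters through its arrows having their ends among its
  objects, which later uses check directly for \<open>decreasing_coslice\<close>.\<close>

lemma limit_unique:
  assumes "is_limit J C D v l" "h \<in> Hom C w v" "k \<in> Hom C w v"
    "\<And>j. j \<in> Ob J \<Longrightarrow> l j \<cdot> h = l j \<cdot> k" "\<And>f. f \<in> Arr J \<Longrightarrow> Dom J f \<in> Ob J \<and> Cod J f \<in> Ob J"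
    "is_functor J C D"
  shows "h = k"
proof -
  have lim: "is_cone J C D v l" using assms(1) by (auto simp: is_limit_def)
  have "is_cone J C D w (\<lambda>j. l j \<cdot> h)"
    unfolding is_cone_def
  proof (intro conjI ballI)
    show "w \<in> Ob C" using Hom_Ob[OF assms(2)] by auto
  next
    fix j assume "j \<in> Ob J"
    then show "l j \<cdot> h \<in> Hom C w (FOb D j)"
      using lim assms(2) Comp_in_Hom by (auto simp: is_cone_def)
  next
    fix f assume f: "f \<in> Arr J"
    then have 1: "l (Dom J f) \<in> Hom C v (FOb D (Dom J f))"
      "FArr D f \<in> Hom C (FOb D (Dom J f)) (FOb D (Cod J f))" "FArr D f \<cdot> l (Dom J f) = l (Cod J f)"
      using lim assms(5,6) by (auto simp: is_cone_def is_functor_def)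
    then show "FArr D f \<cdot> (l (Dom J f) \<cdot> h) = l (Cod J f) \<cdot> h"
      using Comp_assoc[OF assms(2) 1(1,2)] by simp
  qed
  then have "\<exists>!h'. h' \<in> Hom C w v \<and> (\<forall>j \<in> Ob J. l j \<cdot> h' = l j \<cdot> h)"
    using assms(1) by (auto simp: is_limit_def)
  then show ?thesis using assms(2-4) by metis
qed

text \<open>Carries the equaliser property from an equaliser built by hand to an isomorphic object
  chosen beforehand, as happens for the value of \<Omega> at an object.\<close>

lemma equaliser_iso:
  assumes e: "is_equaliser C e f g" and h: "h \<in> Hom C w (Dom C e)" and k: "k \<in> Hom C (Dom C e) w"
    and hk: "h \<cdot> k = Ident C (Dom C e)" and kh: "k \<cdot> h = Ident C w"
  shows "is_equaliser C (e \<cdot> h) f g"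
proof -
  define a where "a = Dom C f"
  have f: "f \<in> Hom C a (Cod C f)" and g: "g \<in> Hom C a (Cod C f)" and eH: "e \<in> Hom C (Dom C e) a"
    and eq: "f \<cdot> e = g \<cdot> e"
    using e by (auto simp: is_equaliser_def Hom_def a_def)
  note eh = Comp_in_Hom[OF h eH]
  have "f \<cdot> (e \<cdot> h) = g \<cdot> (e \<cdot> h)"
    using Comp_assoc[OF h eH f] Comp_assoc[OF h eH g] eq by simp
  moreover have "\<exists>!d. d \<in> Hom C x w \<and> (e \<cdot> h) \<cdot> d = b"
    if b: "b \<in> Hom C x a" and fg: "f \<cdot> b = g \<cdot> b" for x b
  proof -
    have ex: "\<exists>!d. d \<in> Hom C x (Dom C e) \<and> e \<cdot> d = b"
      using equaliser_universal[OF e _ fg] b by (simp add: a_def)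
    then obtain c where c: "c \<in> Hom C x (Dom C e)" "e \<cdot> c = b" by blast
    show ?thesis
    proof (rule ex1I[of _ "k \<cdot> c"])
      have "h \<cdot> (k \<cdot> c) = c" using Comp_assoc[OF c(1) k h] hk id_comp[OF c(1)] by simp
      then show "k \<cdot> c \<in> Hom C x w \<and> (e \<cdot> h) \<cdot> (k \<cdot> c) = b"
        using Comp_in_Hom[OF c(1) k] Comp_assoc[OF Comp_in_Hom[OF c(1) k] h eH] c(2) by simp
    next
      fix d assume d: "d \<in> Hom C x w \<and> (e \<cdot> h) \<cdot> d = b"
      then have dH: "d \<in> Hom C x w" by simp
      have "e \<cdot> (h \<cdot> d) = b" using d Comp_assoc[OF dH h eH] by simp
      then have "h \<cdot> d = c" using ex c Comp_in_Hom[OF dH h] by blast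
      then show "d = k \<cdot> c" using Comp_assoc[OF dH h k] kh id_comp[OF dH] by simp
    qed
  qed
  ultimately show ?thesis
    using HomD[OF f] HomD[OF g] HomD[OF eh] unfolding is_equaliser_def by simp
qed

lemma limit_cone_is_limit:
  assumes "has_limits_of_shape J C" "is_functor J C D"
  shows "is_limit J C D (fst (limit_cone J C D)) (snd (limit_cone J C D))"
proof -
  have "\<exists>z. case z of (v, l) \<Rightarrow> is_limit J C D v l"
    using assms by (auto simp: has_limits_of_shape_def)
  then have "case limit_cone J C D of (v, l) \<Rightarrow> is_limit J C D v l"
    unfolding limit_cone_def by (rule someI_ex)
  then show ?thesis by (simp add: case_prod_unfold)
qed

end

section \<open>Pullbacks and equalisers as limits over small numbered shapes\<close>

text \<open>The objects 0, 1, 2 serve as their own identities; 3 and 4 are the arrows from 0 and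
  from 1 to 2, whence the \<open>f - 3\<close>. Every composable pair contains an identity, so
  \<open>Comp\<close> just returns the other arrow.\<close>

definition cospan_cat :: "(nat, nat) cat" where
  "cospan_cat = \<lparr>Ob = {..<3}, Arr = {..<5}, Dom = (\<lambda>f. if f < 3 then f else f - 3),
     Cod = (\<lambda>f. if f < 3 then f else 2), Ident = (\<lambda>x. x), Comp = (\<lambda>g f. if f < 3 then g else f)\<rparr>"

text \<open>Same encoding, with 2 and 3 as the two arrows from 0 to 1.\<close>

definition parallel_cat :: "(nat, nat) cat" where
  "parallel_cat = \<lparr>Ob = {..<2}, Arr = {..<4}, Dom = (\<lambda>f. if f < 2 then f else 0),
     Cod = (\<lambda>f. if f < 2 then f else 1), Ident = (\<lambda>x. x), Comp = (\<lambda>g f. if f < 2 then g else f)\<rparr>"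

lemma category_cospan_cat: "category cospan_cat"
  by unfold_locales (auto simp: cospan_cat_def Hom_def split: if_split_asm)

lemma category_parallel_cat: "category parallel_cat"
  by unfold_locales (auto simp: parallel_cat_def Hom_def split: if_split_asm)

lemma lessThan_nat_numeral:
  "{..<2} = {0, 1::nat}" "{..<3} = {0, 1, 2::nat}" "{..<4} = {0, 1, 2, 3::nat}" "{..<5} = {0, 1, 2, 3, 4::nat}"
  by auto

locale finitely_complete = category +
  assumes finite_limits: "has_finite_limits C"
begin

lemma ex_pullback:
  assumes f: "f \<in> Arr C" and g: "g \<in> Arr C" and fg: "Cod C f = Cod C g"
  shows "\<exists>p q. is_pullback C p q f g"
proof -
  define D where "D = \<lparr>FOb = (\<lambda>j::nat. if j = 0 then Dom C f else if j = 1 then Dom C g else Cod C f),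
    FArr = (\<lambda>j::nat. if j = 0 then Ident C (Dom C f) else if j = 1 then Ident C (Dom C g)
      else if j = 2 then Ident C (Cod C f) else if j = 3 then f else g)\<rparr>"
  note ob = Dom_in_Ob[OF f] Dom_in_Ob[OF g] Cod_in_Ob[OF f]
  note id = Ident_in_Hom[OF ob(1)] Ident_in_Hom[OF ob(2)] Ident_in_Hom[OF ob(3)]
  have fH: "f \<in> Hom C (Dom C f) (Cod C f)" and gH: "g \<in> Hom C (Dom C g) (Cod C f)"
    using f g fg by (auto simp: Hom_def)
  have D: "is_functor cospan_cat C D"
    unfolding is_functor_def D_def cospan_cat_def lessThan_nat_numeral
    using ob id fH gH id_comp[OF fH] id_comp[OF gH] comp_id[OF fH] comp_id[OF gH]
      comp_id[OF id(1)] comp_id[OF id(2)] comp_id[OF id(3)] by simp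
  have "finite (Ob cospan_cat)" "finite (Arr cospan_cat)" by (auto simp: cospan_cat_def lessThan_nat_numeral)
  then obtain v l where L: "is_limit cospan_cat C D v l"
    using finite_limits category_cospan_cat D
    unfolding has_finite_limits_def has_limits_of_shape_def by blast
  have l: "v \<in> Ob C" "l 0 \<in> Hom C v (Dom C f)" "l 1 \<in> Hom C v (Dom C g)" "f \<cdot> l 0 = l 2" "g \<cdot> l 1 = l 2"
    using L by (auto simp: is_limit_def is_cone_def cospan_cat_def lessThan_nat_numeral D_def)
  have "is_pullback C (l 0) (l 1) f g"
    unfolding is_pullback_def
  proof (intro conjI ballI impI)
    fix x a b
    assume x: "x \<in> Ob C" and a: "a \<in> Hom C x (Dom C f)" and b: "b \<in> Hom C x (Dom C g)"
      and ab: "f \<cdot> a = g \<cdot> b"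
    define k where "k = (\<lambda>j::nat. if j = 0 then a else if j = 1 then b else f \<cdot> a)"
    have fa: "f \<cdot> a \<in> Hom C x (Cod C f)" using Comp_in_Hom[OF a fH] .
    have "is_cone cospan_cat C D x k"
      unfolding is_cone_def
      using x a b fa id_comp[OF a] id_comp[OF b] id_comp[OF fa] ab
      by (auto simp: k_def D_def cospan_cat_def lessThan_nat_numeral)
    then have "\<exists>!h. h \<in> Hom C x v \<and> (\<forall>j \<in> Ob cospan_cat. l j \<cdot> h = k j)"
      using L by (auto simp: is_limit_def)
    moreover have "h \<in> Hom C x v \<and> (\<forall>j \<in> Ob cospan_cat. l j \<cdot> h = k j) \<longleftrightarrow>
        h \<in> Hom C x (Dom C (l 0)) \<and> l 0 \<cdot> h = a \<and> l 1 \<cdot> h = b" for h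
      using HomD[OF l(2)] Comp_assoc[OF _ l(2) fH, of h x] l(4)
      by (auto simp: cospan_cat_def lessThan_nat_numeral k_def)
    ultimately show "\<exists>!h. h \<in> Hom C x (Dom C (l 0)) \<and> l 0 \<cdot> h = a \<and> l 1 \<cdot> h = b"
      by simp
  qed (use f g fg l in \<open>auto simp: Hom_def\<close>)
  then show ?thesis by blast
qed

lemma ex_equaliser:
  assumes f: "f \<in> Hom C a b" and g: "g \<in> Hom C a b"
  shows "\<exists>e. is_equaliser C e f g"
proof -
  define D where "D = \<lparr>FOb = (\<lambda>j::nat. if j = 0 then a else b),
    FArr = (\<lambda>j::nat. if j = 0 then Ident C a else if j = 1 then Ident C b
      else if j = 2 then f else g)\<rparr>"
  note ob = Hom_Ob[OF f]
  note id = Ident_in_Hom[OF ob(1)] Ident_in_Hom[OF ob(2)]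
  have D: "is_functor parallel_cat C D"
    unfolding is_functor_def D_def parallel_cat_def lessThan_nat_numeral
    using ob id f g id_comp[OF f] id_comp[OF g] comp_id[OF f] comp_id[OF g]
      comp_id[OF id(1)] comp_id[OF id(2)] by simp
  have "finite (Ob parallel_cat)" "finite (Arr parallel_cat)" by (auto simp: parallel_cat_def lessThan_nat_numeral)
  then obtain v l where L: "is_limit parallel_cat C D v l"
    using finite_limits category_parallel_cat D
    unfolding has_finite_limits_def has_limits_of_shape_def by blast
  have l: "v \<in> Ob C" "l 0 \<in> Hom C v a" "f \<cdot> l 0 = l 1" "g \<cdot> l 0 = l 1"
    using L by (auto simp: is_limit_def is_cone_def parallel_cat_def lessThan_nat_numeral D_def)
  have "is_equaliser C (l 0) f g"
    unfolding is_equaliser_def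
  proof (intro conjI ballI impI)
    fix x k
    assume x: "x \<in> Ob C" and "k \<in> Hom C x (Dom C f)" and fg: "f \<cdot> k = g \<cdot> k"
    then have k: "k \<in> Hom C x a" using HomD[OF f] by simp
    define c where "c = (\<lambda>j::nat. if j = 0 then k else f \<cdot> k)"
    have fk: "f \<cdot> k \<in> Hom C x b" using Comp_in_Hom[OF k f] .
    have "is_cone parallel_cat C D x c"
      unfolding is_cone_def
      using x k fk id_comp[OF k] id_comp[OF fk] fg
      by (auto simp: c_def D_def parallel_cat_def lessThan_nat_numeral)
    then have "\<exists>!h. h \<in> Hom C x v \<and> (\<forall>j \<in> Ob parallel_cat. l j \<cdot> h = c j)"
      using L by (auto simp: is_limit_def)
    moreover have "h \<in> Hom C x v \<and> (\<forall>j \<in> Ob parallel_cat. l j \<cdot> h = c j) \<longleftrightarrow>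
        h \<in> Hom C x (Dom C (l 0)) \<and> l 0 \<cdot> h = k" for h
      using HomD[OF l(2)] Comp_assoc[OF _ l(2) f, of h x] l(3)
      by (auto simp: parallel_cat_def lessThan_nat_numeral c_def)
    ultimately show "\<exists>!h. h \<in> Hom C x (Dom C (l 0)) \<and> l 0 \<cdot> h = k"
      by simp
  qed (use f g l in \<open>auto simp: Hom_def\<close>)
  then show ?thesis by blast
qed

end

section \<open>Limits in functor categories\<close>

lemma functor_category_sel:
  "Ob (functor_category J C) = {F. ext_functor J C F}"
  "Arr (functor_category J C) = {t. is_nattrans J C t \<and> ext_functor J C (NSrc t) \<and>
     ext_functor J C (NTgt t) \<and> NAt t \<in> extensional (Ob J)}"
  "Dom (functor_category J C) = NSrc"
  "Cod (functor_category J C) = NTgt"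
  by (simp_all add: functor_category_def)

lemma functor_category_comp:
  "NSrc (t \<cdot>\<^bsub>functor_category J C\<^esub> s) = NSrc s"
  "NTgt (t \<cdot>\<^bsub>functor_category J C\<^esub> s) = NTgt t"
  "x \<in> Ob J \<Longrightarrow> NAt (t \<cdot>\<^bsub>functor_category J C\<^esub> s) x = NAt t x \<cdot>\<^bsub>C\<^esub> NAt s x"
  by (simp_all add: functor_category_def)

lemma nattrans_eqI:
  fixes s t :: "('i, 'a, 'o, 'm) nattrans"
  assumes "s \<in> Arr (functor_category J C)" "t \<in> Arr (functor_category J C)"
    "NSrc s = NSrc t" "NTgt s = NTgt t" "\<And>x. x \<in> Ob J \<Longrightarrow> NAt s x = NAt t x"
  shows "s = t"
proof -
  have "NAt s = NAt t"
    using assms by (intro extensionalityI[of _ "Ob J"]) (auto simp: functor_category_sel)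
  then show ?thesis using assms by simp
qed

lemma functorD:
  assumes "is_functor J C F"
  shows "x \<in> Ob J \<Longrightarrow> FOb F x \<in> Ob C"
    "f \<in> Arr J \<Longrightarrow> FArr F f \<in> Hom C (FOb F (Dom J f)) (FOb F (Cod J f))"
    "x \<in> Ob J \<Longrightarrow> FArr F (Ident J x) = Ident C (FOb F x)"
    "f \<in> Arr J \<Longrightarrow> g \<in> Arr J \<Longrightarrow> Cod J f = Dom J g \<Longrightarrow> FArr F (g \<cdot>\<^bsub>J\<^esub> f) = FArr F g \<cdot>\<^bsub>C\<^esub> FArr F f"
  using assms by (auto simp: is_functor_def)

lemma functor_hom_iff:
  "t \<in> Hom (functor_category J C) F G \<longleftrightarrow> is_nattrans J C t \<and> NSrc t = F \<and> NTgt t = G \<and>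
     ext_functor J C F \<and> ext_functor J C G \<and> NAt t \<in> extensional (Ob J)"
  by (auto simp: Hom_def functor_category_sel)

lemma functor_homD:
  assumes "t \<in> Hom (functor_category J C) F G"
  shows "x \<in> Ob J \<Longrightarrow> NAt t x \<in> Hom C (FOb F x) (FOb G x)"
    and "f \<in> Arr J \<Longrightarrow> NAt t (Cod J f) \<cdot>\<^bsub>C\<^esub> FArr F f = FArr G f \<cdot>\<^bsub>C\<^esub> NAt t (Dom J f)"
    and "is_functor J C F" and "is_functor J C G"
  using assms by (auto simp: functor_hom_iff is_nattrans_def)

lemma functor_homI:
  assumes "ext_functor J C F" "ext_functor J C G"
    and "\<And>x. x \<in> Ob J \<Longrightarrow> a x \<in> Hom C (FOb F x) (FOb G x)"
    and "\<And>f. f \<in> Arr J \<Longrightarrow> Dom J f \<in> Ob J \<and> Cod J f \<in> Ob J"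
    and "\<And>f. f \<in> Arr J \<Longrightarrow> a (Cod J f) \<cdot>\<^bsub>C\<^esub> FArr F f = FArr G f \<cdot>\<^bsub>C\<^esub> a (Dom J f)"
  shows "\<lparr>NSrc = F, NTgt = G, NAt = (\<lambda>x\<in>Ob J. a x)\<rparr> \<in> Hom (functor_category J C) F G"
  using assms by (simp add: functor_hom_iff is_nattrans_def ext_functor_def)

lemma functor_arr_hom:
  "t \<in> Arr (functor_category J C) \<Longrightarrow> t \<in> Hom (functor_category J C) (NSrc t) (NTgt t)"
  by (auto simp: functor_hom_iff functor_category_sel)

lemma functor_hom_eqI:
  assumes "s \<in> Hom (functor_category J C) F G" "t \<in> Hom (functor_category J C) F G"
    "\<And>x. x \<in> Ob J \<Longrightarrow> NAt s x = NAt t x"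
  shows "s = t"
  using assms by (intro nattrans_eqI[of s J C t]) (auto simp: Hom_def functor_category_sel)

lemma functor_comp_hom:
  assumes J: "category J" and C: "category C"
    and s: "s \<in> Hom (functor_category J C) F G" and t: "t \<in> Hom (functor_category J C) G H"
  shows "t \<cdot>\<^bsub>functor_category J C\<^esub> s \<in> Hom (functor_category J C) F H"
proof -
  interpret J: category J by fact
  interpret C: category C by fact
  note sD = functor_homD[OF s] and tD = functor_homD[OF t]
  have eq: "t \<cdot>\<^bsub>functor_category J C\<^esub> s =
      \<lparr>NSrc = F, NTgt = H, NAt = (\<lambda>x\<in>Ob J. NAt t x \<cdot>\<^bsub>C\<^esub> NAt s x)\<rparr>"
    using s t by (simp add: functor_category_def Hom_def)
  show ?thesis unfolding eq
  proof (rule functor_homI)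
    fix f assume f: "f \<in> Arr J"
    note ob = J.Dom_in_Ob[OF f] J.Cod_in_Ob[OF f]
    have Ff: "FArr F f \<in> Hom C (FOb F (Dom J f)) (FOb F (Cod J f))"
      and Gf: "FArr G f \<in> Hom C (FOb G (Dom J f)) (FOb G (Cod J f))"
      and Hf: "FArr H f \<in> Hom C (FOb H (Dom J f)) (FOb H (Cod J f))"
      using functorD(2)[OF sD(3) f] functorD(2)[OF sD(4) f] functorD(2)[OF tD(4) f] .
    have "(NAt t (Cod J f) \<cdot>\<^bsub>C\<^esub> NAt s (Cod J f)) \<cdot>\<^bsub>C\<^esub> FArr F f =
        NAt t (Cod J f) \<cdot>\<^bsub>C\<^esub> (FArr G f \<cdot>\<^bsub>C\<^esub> NAt s (Dom J f))"
      using C.Comp_assoc[OF Ff sD(1)[OF ob(2)] tD(1)[OF ob(2)]] sD(2)[OF f] by simp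
    also have "\<dots> = (FArr H f \<cdot>\<^bsub>C\<^esub> NAt t (Dom J f)) \<cdot>\<^bsub>C\<^esub> NAt s (Dom J f)"
      using C.Comp_assoc[OF sD(1)[OF ob(1)] Gf tD(1)[OF ob(2)]] tD(2)[OF f] by simp
    also have "\<dots> = FArr H f \<cdot>\<^bsub>C\<^esub> (NAt t (Dom J f) \<cdot>\<^bsub>C\<^esub> NAt s (Dom J f))"
      using C.Comp_assoc[OF sD(1)[OF ob(1)] tD(1)[OF ob(1)] Hf] .
    finally show "(NAt t (Cod J f) \<cdot>\<^bsub>C\<^esub> NAt s (Cod J f)) \<cdot>\<^bsub>C\<^esub> FArr F f =
        FArr H f \<cdot>\<^bsub>C\<^esub> (NAt t (Dom J f) \<cdot>\<^bsub>C\<^esub> NAt s (Dom J f))" .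
  qed (use s t J.Dom_in_Ob J.Cod_in_Ob C.Comp_in_Hom[OF sD(1) tD(1)] in \<open>auto simp: functor_hom_iff\<close>)
qed

lemma functor_ident_hom:
  assumes J: "category J" and C: "category C" and F: "ext_functor J C F"
  shows "Ident (functor_category J C) F \<in> Hom (functor_category J C) F F"
proof -
  interpret J: category J by fact
  interpret C: category C by fact
  have eq: "Ident (functor_category J C) F =
      \<lparr>NSrc = F, NTgt = F, NAt = (\<lambda>x\<in>Ob J. Ident C (FOb F x))\<rparr>"
    by (simp add: functor_category_def)
  have "is_functor J C F" using F by (simp add: ext_functor_def)
  note FD = functorD[OF this]
  show ?thesis unfolding eq
    by (rule functor_homI)
      (use F FD(1) C.Ident_in_Hom J.Dom_in_Ob J.Cod_in_Ob C.comp_id[OF FD(2)] C.id_comp[OF FD(2)]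
        in auto)
qed

lemma category_functor_category:
  assumes J: "category J" and C: "category C"
  shows "category (functor_category J C)"
proof -
  interpret J: category J by fact
  interpret C: category C by fact
  let ?F = "functor_category J C"
  note comp = functor_comp_hom[OF J C] and ident = functor_ident_hom[OF J C]
  have id_at: "NAt (Ident ?F F) x = Ident C (FOb F x)" if "x \<in> Ob J" for F x
    using that by (simp add: functor_category_def)
  show ?thesis
  proof
    fix t assume "t \<in> Arr ?F"
    then have t: "t \<in> Hom ?F (Dom ?F t) (Cod ?F t)" by (simp add: Hom_def)
    then have ob: "ext_functor J C (Dom ?F t)" "ext_functor J C (Cod ?F t)"
      by (auto simp: functor_hom_iff)
    then show "Dom ?F t \<in> Ob ?F" "Cod ?F t \<in> Ob ?F" by (auto simp: functor_category_sel)
    show "t \<cdot>\<^bsub>?F\<^esub> Ident ?F (Dom ?F t) = t"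
      by (rule functor_hom_eqI[OF comp[OF ident[OF ob(1)] t] t])
        (use functor_homD(1)[OF t] C.comp_id in \<open>auto simp: functor_category_comp id_at\<close>)
    show "Ident ?F (Cod ?F t) \<cdot>\<^bsub>?F\<^esub> t = t"
      by (rule functor_hom_eqI[OF comp[OF t ident[OF ob(2)]] t])
        (use functor_homD(1)[OF t] C.id_comp in \<open>auto simp: functor_category_comp id_at\<close>)
  next
    fix F assume "F \<in> Ob ?F"
    then show "Ident ?F F \<in> Hom ?F F F" using ident by (simp add: functor_category_sel)
  next
    fix r s t W X Y Z
    assume r: "r \<in> Hom ?F W X" and s: "s \<in> Hom ?F X Y" and t: "t \<in> Hom ?F Y Z"
    show "(t \<cdot>\<^bsub>?F\<^esub> s) \<cdot>\<^bsub>?F\<^esub> r = t \<cdot>\<^bsub>?F\<^esub> (s \<cdot>\<^bsub>?F\<^esub> r)"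
      by (rule functor_hom_eqI[OF comp[OF r comp[OF s t]] comp[OF comp[OF r s] t]])
        (simp add: functor_category_comp
          C.Comp_assoc[OF functor_homD(1)[OF r] functor_homD(1)[OF s] functor_homD(1)[OF t]])
  qed (use comp in blast)
qed

section \<open>Pullback squares and monos in a single category\<close>

context category
begin

lemma pullbackD:
  assumes "is_pullback C p q f g"
  shows "p \<in> Hom C (Dom C p) (Dom C f)" "q \<in> Hom C (Dom C p) (Dom C g)" "f \<cdot> p = g \<cdot> q"
    "f \<in> Hom C (Dom C f) (Cod C f)" "g \<in> Hom C (Dom C g) (Cod C f)"
  using assms by (auto simp: is_pullback_def Hom_def)

lemma pullback_unique:
  assumes pb: "is_pullback C p q f g" and h: "h \<in> Hom C x (Dom C p)" and k: "k \<in> Hom C x (Dom C p)"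
    and "p \<cdot> h = p \<cdot> k" "q \<cdot> h = q \<cdot> k"
  shows "h = k"
proof -
  note D = pullbackD[OF pb]
  have "f \<cdot> (p \<cdot> h) = g \<cdot> (q \<cdot> h)"
    using Comp_assoc[OF h D(1,4)] Comp_assoc[OF h D(2,5)] D(3) by simp
  from pullback_universal[OF pb Comp_in_Hom[OF h D(1)] Comp_in_Hom[OF h D(2)] this]
  show ?thesis using h k assms(4,5) by metis
qed

text \<open>The uniqueness clause of the given pullback forces \<open>k \<cdot> h\<close> to be the
  identity, so only the other inverse law appears among the hypotheses.\<close>

lemma pullback_iso:
  assumes pb: "is_pullback C p q f g"
    and p': "p' \<in> Hom C w (Dom C f)" and q': "q' \<in> Hom C w (Dom C g)"
    and h: "h \<in> Hom C (Dom C p) w" and k: "k \<in> Hom C w (Dom C p)"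
    and eqs: "p' \<cdot> h = p" "q' \<cdot> h = q" "p \<cdot> k = p'" "q \<cdot> k = q'" "h \<cdot> k = Ident C w"
  shows "is_pullback C p' q' f g"
proof -
  note D = pullbackD[OF pb]
  have fg: "f \<cdot> p' = g \<cdot> q'"
    using Comp_assoc[OF k D(1,4)] Comp_assoc[OF k D(2,5)] D(3) eqs by simp
  have "\<exists>!d. d \<in> Hom C x w \<and> p' \<cdot> d = a \<and> q' \<cdot> d = b"
    if a: "a \<in> Hom C x (Dom C f)" and b: "b \<in> Hom C x (Dom C g)" and ab: "f \<cdot> a = g \<cdot> b" for x a b
  proof -
    obtain c where c: "c \<in> Hom C x (Dom C p)" "p \<cdot> c = a" "q \<cdot> c = b"
      using pullback_universal[OF pb a b ab] by blast
    show ?thesis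
    proof (rule ex1I[of _ "h \<cdot> c"])
      show "h \<cdot> c \<in> Hom C x w \<and> p' \<cdot> (h \<cdot> c) = a \<and> q' \<cdot> (h \<cdot> c) = b"
        using Comp_in_Hom[OF c(1) h] Comp_assoc[OF c(1) h p'] Comp_assoc[OF c(1) h q'] eqs c by simp
    next
      fix d assume d: "d \<in> Hom C x w \<and> p' \<cdot> d = a \<and> q' \<cdot> d = b"
      then have dH: "d \<in> Hom C x w" by simp
      have "k \<cdot> d = c"
        using Comp_assoc[OF dH k D(1)] Comp_assoc[OF dH k D(2)] eqs d c
        by (intro pullback_unique[OF pb Comp_in_Hom[OF dH k] c(1)]) auto
      then show "d = h \<cdot> c"
        using Comp_assoc[OF dH k h] eqs id_comp[OF dH] by simp
    qed
  qed
  then show ?thesis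
    using D HomD[OF p'] HomD[OF q'] fg HomD[OF D(4)] HomD[OF D(5)] unfolding is_pullback_def by simp
qed

text \<open>A pullback depends on its cospan only through the relation that the cospan imposes on
  pairs of arrows. The legs may thus be exchanged, even for legs with another common
  codomain.\<close>

lemma pullback_cong:
  assumes pb: "is_pullback C p q f g"
    and f: "f \<in> Hom C x a" "f' \<in> Hom C x b" and g: "g \<in> Hom C y a" "g' \<in> Hom C y b"
    and iff: "\<And>z h k. h \<in> Hom C z x \<Longrightarrow> k \<in> Hom C z y \<Longrightarrow> f \<cdot> h = g \<cdot> k \<longleftrightarrow> f' \<cdot> h = g' \<cdot> k"
  shows "is_pullback C p q f' g'"
proof -
  note dom = HomD(2)[OF f(1)] HomD(2)[OF g(1)]
  have p: "p \<in> Hom C (Dom C p) x" and q: "q \<in> Hom C (Dom C p) y"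
    using pullbackD(1,2)[OF pb] dom by auto
  have "f' \<cdot> p = g' \<cdot> q" using iff[OF p q] pullbackD(3)[OF pb] by simp
  moreover have "\<exists>!d. d \<in> Hom C z (Dom C p) \<and> p \<cdot> d = h \<and> q \<cdot> d = k"
    if "h \<in> Hom C z x" "k \<in> Hom C z y" "f' \<cdot> h = g' \<cdot> k" for z h k
    by (rule pullback_universal[OF pb]) (use that iff[OF that(1,2)] dom in simp_all)
  ultimately show ?thesis
    using HomD[OF f(2)] HomD[OF g(2)] HomD[OF p] HomD[OF q] unfolding is_pullback_def by simp
qed

text \<open>Encodes monos by their trivial kernel pair, so that pointwise statements about pullbacks
  pass to monos.\<close>

lemma mono_iff_pullback:
  assumes m: "m \<in> Hom C x y"
  shows "is_mono C m \<longleftrightarrow> is_pullback C (Ident C x) (Ident C x) m m"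
proof
  note x = Hom_Ob(1)[OF m] and mD = HomD[OF m]
  note id = Ident_in_Hom[OF x]
  show "is_pullback C (Ident C x) (Ident C x) m m" if "is_mono C m"
  proof -
    have "\<exists>!h. h \<in> Hom C w x \<and> Ident C x \<cdot> h = a \<and> Ident C x \<cdot> h = b"
      if "a \<in> Hom C w x" "b \<in> Hom C w x" "m \<cdot> a = m \<cdot> b" for w a b
    proof -
      have "a = b" using that is_monoD[OF \<open>is_mono C m\<close>] mD by simp
      then show ?thesis using that id_comp by (intro ex1I[of _ a]) auto
    qed
    then show ?thesis
      using mD HomD[OF id] unfolding is_pullback_def by simp
  qed
  show "is_mono C m" if pb: "is_pullback C (Ident C x) (Ident C x) m m"
    unfolding is_mono_def
  proof (intro conjI ballI impI)
    fix w a b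
    assume "a \<in> Hom C w (Dom C m)" "b \<in> Hom C w (Dom C m)" "m \<cdot> a = m \<cdot> b"
    from pullback_universal[OF pb this] obtain h where
      h: "h \<in> Hom C w x" "Ident C x \<cdot> h = a" "Ident C x \<cdot> h = b"
      using HomD[OF id] by auto
    then show "a = b" by simp
  qed (use mD in simp)
qed

end

section \<open>Pullbacks and monos of functors are pointwise\<close>

text \<open>The mediating components exist pointwise; they are natural because the legs of a
  pullback are jointly monic, so the two sides of the naturality square can be compared after
  \<open>p\<close> and after \<open>q\<close>.\<close>

lemma functor_pullbackI:
  assumes J: "category J" and C: "category C"
    and p: "p \<in> Hom (functor_category J C) W X" and q: "q \<in> Hom (functor_category J C) W Y"
    and f: "f \<in> Hom (functor_category J C) X Z" and g: "g \<in> Hom (functor_category J C) Y Z"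
    and pb: "\<And>i. i \<in> Ob J \<Longrightarrow> is_pullback C (NAt p i) (NAt q i) (NAt f i) (NAt g i)"
  shows "is_pullback (functor_category J C) p q f g"
proof -
  interpret J: category J by fact
  interpret C: category C by fact
  let ?F = "functor_category J C"
  note pD = functor_homD[OF p] and qD = functor_homD[OF q]
    and fD = functor_homD[OF f] and gD = functor_homD[OF g]
  note comp = functor_comp_hom[OF J C]
  have "f \<cdot>\<^bsub>?F\<^esub> p = g \<cdot>\<^bsub>?F\<^esub> q"
    using C.pullbackD(3)[OF pb]
    by (intro functor_hom_eqI[OF comp[OF p f] comp[OF q g]]) (simp add: functor_category_comp)
  moreover have "\<exists>!h. h \<in> Hom ?F V W \<and> p \<cdot>\<^bsub>?F\<^esub> h = a \<and> q \<cdot>\<^bsub>?F\<^esub> h = b"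
    if a: "a \<in> Hom ?F V X" and b: "b \<in> Hom ?F V Y" and ab: "f \<cdot>\<^bsub>?F\<^esub> a = g \<cdot>\<^bsub>?F\<^esub> b" for V a b
  proof -
    note aD = functor_homD[OF a] and bD = functor_homD[OF b]
    have dom: "Dom C (NAt p i) = FOb W i" "Dom C (NAt f i) = FOb X i" "Dom C (NAt g i) = FOb Y i"
      if "i \<in> Ob J" for i
      using HomD[OF pD(1)[OF that]] HomD[OF fD(1)[OF that]] HomD[OF gD(1)[OF that]] by auto
    have ex: "\<exists>!h. h \<in> Hom C (FOb V i) (FOb W i) \<and> NAt p i \<cdot>\<^bsub>C\<^esub> h = NAt a i \<and> NAt q i \<cdot>\<^bsub>C\<^esub> h = NAt b i"
      if i: "i \<in> Ob J" for i
    proof -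
      have "NAt f i \<cdot>\<^bsub>C\<^esub> NAt a i = NAt g i \<cdot>\<^bsub>C\<^esub> NAt b i"
        using arg_cong[OF ab, of "\<lambda>t. NAt t i"] i by (simp add: functor_category_comp)
      then show ?thesis
        using C.pullback_universal[OF pb[OF i], of "NAt a i" "FOb V i" "NAt b i"] aD(1)[OF i] bD(1)[OF i]
        by (simp add: dom[OF i])
    qed
    then have "\<forall>i \<in> Ob J. \<exists>h. h \<in> Hom C (FOb V i) (FOb W i) \<and> NAt p i \<cdot>\<^bsub>C\<^esub> h = NAt a i \<and> NAt q i \<cdot>\<^bsub>C\<^esub> h = NAt b i"
      by blast
    then obtain h where h: "\<And>i. i \<in> Ob J \<Longrightarrow> h i \<in> Hom C (FOb V i) (FOb W i)"
        "\<And>i. i \<in> Ob J \<Longrightarrow> NAt p i \<cdot>\<^bsub>C\<^esub> h i = NAt a i" "\<And>i. i \<in> Ob J \<Longrightarrow> NAt q i \<cdot>\<^bsub>C\<^esub> h i = NAt b i"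
      by (metis (no_types, lifting))
    define hh where "hh = \<lparr>NSrc = V, NTgt = W, NAt = (\<lambda>i\<in>Ob J. h i)\<rparr>"
    have hh: "hh \<in> Hom ?F V W"
      unfolding hh_def
    proof (rule functor_homI)
      fix u assume u: "u \<in> Arr J"
      note ob = J.Dom_in_Ob[OF u] J.Cod_in_Ob[OF u]
      note Vu = functorD(2)[OF aD(3) u] and Wu = functorD(2)[OF pD(3) u]
        and Xu = functorD(2)[OF pD(4) u] and Yu = functorD(2)[OF qD(4) u]
      have 1: "h (Cod J u) \<cdot>\<^bsub>C\<^esub> FArr V u \<in> Hom C (FOb V (Dom J u)) (FOb W (Cod J u))"
        "FArr W u \<cdot>\<^bsub>C\<^esub> h (Dom J u) \<in> Hom C (FOb V (Dom J u)) (FOb W (Cod J u))"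
        using C.Comp_in_Hom[OF Vu h(1)[OF ob(2)]] C.Comp_in_Hom[OF h(1)[OF ob(1)] Wu] .
      \<comment> \<open>One computation for both legs: \<open>r\<close> stands for \<open>p\<close>
        or \<open>q\<close>, and \<open>c\<close> for \<open>a\<close> or \<open>b\<close>.\<close>
      have 2: "NAt r (Cod J u) \<cdot>\<^bsub>C\<^esub> (h (Cod J u) \<cdot>\<^bsub>C\<^esub> FArr V u) =
          NAt r (Cod J u) \<cdot>\<^bsub>C\<^esub> (FArr W u \<cdot>\<^bsub>C\<^esub> h (Dom J u))"
        if r: "r \<in> Hom ?F W R" and c: "c \<in> Hom ?F V R" and rh: "\<And>i. i \<in> Ob J \<Longrightarrow> NAt r i \<cdot>\<^bsub>C\<^esub> h i = NAt c i"
        for r c R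
      proof -
        note rD = functor_homD[OF r] and cD = functor_homD[OF c]
        note Ru = functorD(2)[OF rD(4) u]
        have "NAt r (Cod J u) \<cdot>\<^bsub>C\<^esub> (h (Cod J u) \<cdot>\<^bsub>C\<^esub> FArr V u) = NAt c (Cod J u) \<cdot>\<^bsub>C\<^esub> FArr V u"
          using C.Comp_assoc[OF Vu h(1)[OF ob(2)] rD(1)[OF ob(2)]] rh[OF ob(2)] by simp
        also have "\<dots> = FArr R u \<cdot>\<^bsub>C\<^esub> (NAt r (Dom J u) \<cdot>\<^bsub>C\<^esub> h (Dom J u))"
          using cD(2)[OF u] rh[OF ob(1)] by simp
        also have "\<dots> = NAt r (Cod J u) \<cdot>\<^bsub>C\<^esub> (FArr W u \<cdot>\<^bsub>C\<^esub> h (Dom J u))"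
          using C.Comp_assoc[OF h(1)[OF ob(1)] rD(1)[OF ob(1)] Ru]
            C.Comp_assoc[OF h(1)[OF ob(1)] Wu rD(1)[OF ob(2)]] rD(2)[OF u] by simp
        finally show ?thesis .
      qed
      show "h (Cod J u) \<cdot>\<^bsub>C\<^esub> FArr V u = FArr W u \<cdot>\<^bsub>C\<^esub> h (Dom J u)"
        by (rule C.pullback_unique[OF pb[OF ob(2)]])
          (use 1 2[OF p a h(2)] 2[OF q b h(3)] dom(1)[OF ob(2)] in auto)
    qed (use a p h(1) J.Dom_in_Ob J.Cod_in_Ob in \<open>auto simp: functor_hom_iff\<close>)
    show ?thesis
    proof (rule ex1I[of _ hh])
      have at: "NAt hh i = h i" if "i \<in> Ob J" for i using that by (simp add: hh_def)
      show "hh \<in> Hom ?F V W \<and> p \<cdot>\<^bsub>?F\<^esub> hh = a \<and> q \<cdot>\<^bsub>?F\<^esub> hh = b"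
        using hh functor_hom_eqI[OF comp[OF hh p] a] functor_hom_eqI[OF comp[OF hh q] b]
        by (simp add: functor_category_comp at h)
    next
      fix k assume k: "k \<in> Hom ?F V W \<and> p \<cdot>\<^bsub>?F\<^esub> k = a \<and> q \<cdot>\<^bsub>?F\<^esub> k = b"
      then have kH: "k \<in> Hom ?F V W" by simp
      show "k = hh"
      proof (rule functor_hom_eqI[OF kH hh])
        fix i assume i: "i \<in> Ob J"
        have "NAt p i \<cdot>\<^bsub>C\<^esub> NAt k i = NAt a i" "NAt q i \<cdot>\<^bsub>C\<^esub> NAt k i = NAt b i"
          using k functor_category_comp(3)[OF i] by metis+
        then show "NAt k i = NAt hh i"
          using i h[OF i] functor_homD(1)[OF kH i] ex[OF i] by (simp add: hh_def) blast
      qed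
    qed
  qed
  ultimately show ?thesis
    using HomD[OF p] HomD[OF q] HomD[OF f] HomD[OF g] unfolding is_pullback_def by simp
qed

text \<open>If \<open>C\<close> has pullbacks then the pointwise pullbacks form a functor, to which any pullback in
  the functor category is isomorphic.\<close>

lemma (in finitely_complete) pullback_pointwise:
  assumes J: "category J" and PB: "is_pullback (functor_category J C) P Q F G" and i0: "i0 \<in> Ob J"
  shows "is_pullback C (NAt P i0) (NAt Q i0) (NAt F i0) (NAt G i0)"
proof -
  interpret J: category J by fact
  let ?F = "functor_category J C"
  have C: "category C" by unfold_locales
  interpret FC: category ?F using category_functor_category[OF J C] .
  note comp = functor_comp_hom[OF J C]
  define W X Y Z where "W = NSrc P" and "X = NSrc F" and "Y = NSrc G" and "Z = NTgt F"
  have P: "P \<in> Hom ?F W X" and Q: "Q \<in> Hom ?F W Y" and F: "F \<in> Hom ?F X Z" and G: "G \<in> Hom ?F Y Z"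
    using FC.pullbackD[OF PB] by (auto simp: functor_category_sel W_def X_def Y_def Z_def)
  note PD = functor_homD[OF P] and QD = functor_homD[OF Q]
    and FD = functor_homD[OF F] and GD = functor_homD[OF G]
  have "\<forall>i \<in> Ob J. \<exists>p q. is_pullback C p q (NAt F i) (NAt G i)"
    using ex_pullback HomD FD(1) GD(1) by metis
  then obtain p q where pb: "\<And>i. i \<in> Ob J \<Longrightarrow> is_pullback C (p i) (q i) (NAt F i) (NAt G i)"
    by metis
  define b where "b = (\<lambda>i. Dom C (p i))"
  have p: "p i \<in> Hom C (b i) (FOb X i)" and q: "q i \<in> Hom C (b i) (FOb Y i)" if "i \<in> Ob J" for i
    using pullbackD[OF pb[OF that]] HomD[OF FD(1)[OF that]] HomD[OF GD(1)[OF that]]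
    by (auto simp: b_def)
  have universal: "\<exists>h. h \<in> Hom C x (b i) \<and> p i \<cdot> h = c \<and> q i \<cdot> h = d"
    if "i \<in> Ob J" "c \<in> Hom C x (FOb X i)" "d \<in> Hom C x (FOb Y i)" "NAt F i \<cdot> c = NAt G i \<cdot> d" for i x c d
    using pullback_universal[OF pb[OF that(1)], of c x d] that HomD[OF FD(1)[OF that(1)]]
      HomD[OF GD(1)[OF that(1)]] by (auto simp: b_def)
  have joint: "h = k" if "i \<in> Ob J" "h \<in> Hom C x (b i)" "k \<in> Hom C x (b i)"
    "p i \<cdot> h = p i \<cdot> k" "q i \<cdot> h = q i \<cdot> k" for i h k x
    using pullback_unique[OF pb[OF that(1)]] that by (simp add: b_def)
  \<comment> \<open>The action of the pointwise pullbacks on \<open>u\<close> is an induced map;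
    naturality of \<open>F\<close> and \<open>G\<close> supplies the commuting square that induces
    it.\<close>
  have "\<forall>u \<in> Arr J. \<exists>r. r \<in> Hom C (b (Dom J u)) (b (Cod J u)) \<and>
      p (Cod J u) \<cdot> r = FArr X u \<cdot> p (Dom J u) \<and> q (Cod J u) \<cdot> r = FArr Y u \<cdot> q (Dom J u)"
  proof
    fix u assume u: "u \<in> Arr J"
    note ob = J.Dom_in_Ob[OF u] J.Cod_in_Ob[OF u]
    note Xu = functorD(2)[OF FD(3) u] and Yu = functorD(2)[OF GD(3) u] and Zu = functorD(2)[OF FD(4) u]
    have "NAt F (Cod J u) \<cdot> (FArr X u \<cdot> p (Dom J u)) = (FArr Z u \<cdot> NAt F (Dom J u)) \<cdot> p (Dom J u)"
      using Comp_assoc[OF p[OF ob(1)] Xu FD(1)[OF ob(2)]] FD(2)[OF u] by simp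
    also have "\<dots> = (FArr Z u \<cdot> NAt G (Dom J u)) \<cdot> q (Dom J u)"
      using Comp_assoc[OF p[OF ob(1)] FD(1)[OF ob(1)] Zu] Comp_assoc[OF q[OF ob(1)] GD(1)[OF ob(1)] Zu]
        pullbackD(3)[OF pb[OF ob(1)]] by simp
    also have "\<dots> = NAt G (Cod J u) \<cdot> (FArr Y u \<cdot> q (Dom J u))"
      using Comp_assoc[OF q[OF ob(1)] Yu GD(1)[OF ob(2)]] GD(2)[OF u] by simp
    finally show "\<exists>r. r \<in> Hom C (b (Dom J u)) (b (Cod J u)) \<and>
      p (Cod J u) \<cdot> r = FArr X u \<cdot> p (Dom J u) \<and> q (Cod J u) \<cdot> r = FArr Y u \<cdot> q (Dom J u)"
      using universal[OF ob(2) Comp_in_Hom[OF p[OF ob(1)] Xu] Comp_in_Hom[OF q[OF ob(1)] Yu]] by blast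
  qed
  then obtain r where r: "\<And>u. u \<in> Arr J \<Longrightarrow> r u \<in> Hom C (b (Dom J u)) (b (Cod J u))"
      "\<And>u. u \<in> Arr J \<Longrightarrow> p (Cod J u) \<cdot> r u = FArr X u \<cdot> p (Dom J u)"
      "\<And>u. u \<in> Arr J \<Longrightarrow> q (Cod J u) \<cdot> r u = FArr Y u \<cdot> q (Dom J u)"
    by (metis (no_types, lifting))
  have b_Ob: "b i \<in> Ob C" if "i \<in> Ob J" for i using Hom_Ob[OF p[OF that]] by simp
  define B where "B = \<lparr>FOb = (\<lambda>i\<in>Ob J. b i), FArr = (\<lambda>u\<in>Arr J. r u)\<rparr>"
  have r_id: "r (Ident J i) = Ident C (b i)" if i: "i \<in> Ob J" for i
  proof -
    note id = J.Ident_Arr[OF i]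
    note XI = functorD(3)[OF FD(3) i] and YI = functorD(3)[OF GD(3) i]
    show ?thesis
      by (rule joint[OF i, of _ "b i"])
        (use r[OF id(1)] Ident_in_Hom[OF b_Ob[OF i]] id comp_id[OF p[OF i]] comp_id[OF q[OF i]]
          id_comp[OF p[OF i]] id_comp[OF q[OF i]] XI YI in auto)
  qed
  have r_comp: "r (v \<cdot>\<^bsub>J\<^esub> u) = r v \<cdot> r u" if u: "u \<in> Arr J" and v: "v \<in> Arr J" and uv: "Cod J u = Dom J v" for u v
  proof -
    note vu = J.Comp_Arr[OF u v uv[symmetric]]
    note ob = J.Dom_in_Ob[OF u] J.Cod_in_Ob[OF u] J.Cod_in_Ob[OF v]
    have ru: "r u \<in> Hom C (b (Dom J u)) (b (Dom J v))" using r(1)[OF u] uv by simp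
    \<comment> \<open>Stated for an arbitrary functor \<open>R\<close> with legs \<open>s\<close>,
      to serve both \<open>X\<close> with \<open>p\<close> and \<open>Y\<close> with
      \<open>q\<close>.\<close>
    have legs: "s (Cod J v) \<cdot> (r v \<cdot> r u) = FArr R (v \<cdot>\<^bsub>J\<^esub> u) \<cdot> s (Dom J u)"
      if R: "is_functor J C R" and s: "\<And>i. i \<in> Ob J \<Longrightarrow> s i \<in> Hom C (b i) (FOb R i)"
        and sr: "\<And>u. u \<in> Arr J \<Longrightarrow> s (Cod J u) \<cdot> r u = FArr R u \<cdot> s (Dom J u)" for R s
    proof -
      have Ru: "FArr R u \<in> Hom C (FOb R (Dom J u)) (FOb R (Dom J v))"
        using functorD(2)[OF R u] uv by simp
      have sv: "s (Dom J v) \<in> Hom C (b (Dom J v)) (FOb R (Dom J v))" using s ob uv by simp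
      note Rv = functorD(2)[OF R v]
      have "s (Cod J v) \<cdot> (r v \<cdot> r u) = (FArr R v \<cdot> s (Dom J v)) \<cdot> r u"
        using Comp_assoc[OF ru r(1)[OF v] s[OF ob(3)]] sr[OF v] by simp
      also have "\<dots> = FArr R v \<cdot> (FArr R u \<cdot> s (Dom J u))"
        using Comp_assoc[OF ru sv Rv] sr[OF u] uv by simp
      also have "\<dots> = FArr R (v \<cdot>\<^bsub>J\<^esub> u) \<cdot> s (Dom J u)"
        using Comp_assoc[OF s[OF ob(1)] Ru Rv] functorD(4)[OF R u v uv] by simp
      finally show ?thesis .
    qed
    show ?thesis
      by (rule joint[OF ob(3)])
        (use r[OF vu(1)] vu Comp_in_Hom[OF ru r(1)[OF v]] legs[OF FD(3) p r(2)] legs[OF GD(3) q r(3)]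
          in auto)
  qed
  have B: "ext_functor J C B"
    unfolding ext_functor_def is_functor_def B_def
    using b_Ob r(1) r_id r_comp J.Dom_in_Ob J.Cod_in_Ob J.Ident_Arr J.Comp_Arr by auto
  define p' where "p' = \<lparr>NSrc = B, NTgt = X, NAt = (\<lambda>i\<in>Ob J. p i)\<rparr>"
  define q' where "q' = \<lparr>NSrc = B, NTgt = Y, NAt = (\<lambda>i\<in>Ob J. q i)\<rparr>"
  have ext: "ext_functor J C X" "ext_functor J C Y" using F G by (auto simp: functor_hom_iff)
  have p': "p' \<in> Hom ?F B X"
    unfolding p'_def by (rule functor_homI[OF B ext(1)])
      (use p r(2) J.Dom_in_Ob J.Cod_in_Ob in \<open>auto simp: B_def\<close>)
  have q': "q' \<in> Hom ?F B Y"
    unfolding q'_def by (rule functor_homI[OF B ext(2)])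
      (use q r(3) J.Dom_in_Ob J.Cod_in_Ob in \<open>auto simp: B_def\<close>)
  \<comment> \<open>Both squares are now pullbacks of the same cospan, hence isomorphic; evaluating
    the isomorphism at \<open>i0\<close> transfers the property to \<open>P\<close> and
    \<open>Q\<close>.\<close>
  have pb': "is_pullback ?F p' q' F G"
    by (rule functor_pullbackI[OF J C p' q' F G]) (use pb in \<open>simp add: p'_def q'_def\<close>)
  have dom: "Dom ?F P = W" "Dom ?F p' = B" "Dom ?F F = X" "Dom ?F G = Y"
    using HomD(2)[OF P] HomD(2)[OF p'] HomD(2)[OF F] HomD(2)[OF G] .
  obtain h where h: "h \<in> Hom ?F B W" "P \<cdot>\<^bsub>?F\<^esub> h = p'" "Q \<cdot>\<^bsub>?F\<^esub> h = q'"
    using FC.pullback_universal[OF PB, of p' B q'] p' q' FC.pullbackD(3)[OF pb'] dom by auto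
  obtain k where k: "k \<in> Hom ?F W B" "p' \<cdot>\<^bsub>?F\<^esub> k = P" "q' \<cdot>\<^bsub>?F\<^esub> k = Q"
    using FC.pullback_universal[OF pb', of P W Q] P Q FC.pullbackD(3)[OF PB] dom by auto
  have W: "W \<in> Ob ?F" using FC.Hom_Ob[OF P] by simp
  have hk: "h \<cdot>\<^bsub>?F\<^esub> k = Ident ?F W"
  proof (rule FC.pullback_unique[OF PB])
    show "h \<cdot>\<^bsub>?F\<^esub> k \<in> Hom ?F W (Dom ?F P)" "Ident ?F W \<in> Hom ?F W (Dom ?F P)"
      using FC.Comp_in_Hom[OF k(1) h(1)] FC.Ident_in_Hom[OF W] dom by auto
    show "P \<cdot>\<^bsub>?F\<^esub> (h \<cdot>\<^bsub>?F\<^esub> k) = P \<cdot>\<^bsub>?F\<^esub> Ident ?F W" "Q \<cdot>\<^bsub>?F\<^esub> (h \<cdot>\<^bsub>?F\<^esub> k) = Q \<cdot>\<^bsub>?F\<^esub> Ident ?F W"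
      using FC.Comp_assoc[OF k(1) h(1) P] FC.Comp_assoc[OF k(1) h(1) Q] h k FC.comp_id[OF P]
        FC.comp_id[OF Q] by auto
  qed
  note comp_at = functor_category_comp(3)[OF i0, of C]
  have at: "NAt p' i0 = p i0" "NAt q' i0 = q i0" "FOb B i0 = b i0" using i0 by (auto simp: p'_def q'_def B_def)
  show ?thesis
  proof (rule pullback_iso[OF pb[OF i0], of "NAt P i0" "FOb W i0" "NAt Q i0" "NAt h i0" "NAt k i0"])
    show "NAt P i0 \<in> Hom C (FOb W i0) (Dom C (NAt F i0))" "NAt Q i0 \<in> Hom C (FOb W i0) (Dom C (NAt G i0))"
      using PD(1)[OF i0] QD(1)[OF i0] HomD(2)[OF FD(1)[OF i0]] HomD(2)[OF GD(1)[OF i0]] by auto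
    show "NAt h i0 \<in> Hom C (Dom C (p i0)) (FOb W i0)" "NAt k i0 \<in> Hom C (FOb W i0) (Dom C (p i0))"
      using functor_homD(1)[OF h(1) i0] functor_homD(1)[OF k(1) i0] at by (auto simp: b_def)
    show "NAt P i0 \<cdot> NAt h i0 = p i0" "NAt Q i0 \<cdot> NAt h i0 = q i0"
      using arg_cong[OF h(2), of "\<lambda>t. NAt t i0"] arg_cong[OF h(3), of "\<lambda>t. NAt t i0"]
      by (auto simp: comp_at at)
    show "p i0 \<cdot> NAt k i0 = NAt P i0" "q i0 \<cdot> NAt k i0 = NAt Q i0"
      using arg_cong[OF k(2), of "\<lambda>t. NAt t i0"] arg_cong[OF k(3), of "\<lambda>t. NAt t i0"]
      by (auto simp: comp_at at)
    show "NAt h i0 \<cdot> NAt k i0 = Ident C (FOb W i0)"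
      using arg_cong[OF hk, of "\<lambda>t. NAt t i0"] i0 by (simp add: comp_at) (simp add: functor_category_def)
  qed
qed

text \<open>The kernel pair of a mono consists of identities, whose components are identities;
  pullbacks being pointwise, each component of \<open>m\<close> has a trivial kernel pair
  too.\<close>

lemma (in finitely_complete) mono_pointwise:
  assumes J: "category J" and m: "is_mono (functor_category J C) m" and i: "i \<in> Ob J"
  shows "is_mono C (NAt m i)"
proof -
  let ?F = "functor_category J C"
  have C: "category C" by unfold_locales
  interpret FC: category ?F using category_functor_category[OF J C] .
  have mH: "m \<in> Hom ?F (NSrc m) (NTgt m)"
    using m by (intro functor_arr_hom) (simp add: is_mono_def)
  have "is_pullback ?F (Ident ?F (NSrc m)) (Ident ?F (NSrc m)) m m"
    using FC.mono_iff_pullback[OF mH] m by simp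
  from pullback_pointwise[OF J this i]
  have "is_pullback C (Ident C (FOb (NSrc m) i)) (Ident C (FOb (NSrc m) i)) (NAt m i) (NAt m i)"
    using i by (simp add: functor_category_def)
  then show ?thesis using mono_iff_pullback[OF functor_homD(1)[OF mH i]] by simp
qed

section \<open>Truth values as generalised elements\<close>

locale classified = finitely_complete +
  fixes u Om :: 'a and t :: 'b
  assumes classifier: "is_subobject_classifier C u Om t"
begin

lemma terminal: "is_terminal C u" and true_hom: "t \<in> Hom C u Om"
  using classifier by (auto simp: is_subobject_classifier_def)

abbreviation bang :: "'a \<Rightarrow> 'b" where
  "bang x \<equiv> unique_arrow C x u"

lemma bang_hom: "x \<in> Ob C \<Longrightarrow> bang x \<in> Hom C x u"
  using terminal_arrow[OF terminal] .

lemma bang_eq: "f \<in> Hom C x u \<Longrightarrow> f = bang x"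
  using terminal_unique[OF terminal _ bang_hom] Hom_Ob by blast

text \<open>The top truth value at stage \<open>x\<close>. The equation
  \<open>c \<cdot> k = truth y\<close> is used throughout as membership of the generalised element
  \<open>k\<close> in the subobject classified by \<open>c\<close>.\<close>

definition truth :: "'a \<Rightarrow> 'b" where
  "truth x = t \<cdot> bang x"

lemma truth_hom: "x \<in> Ob C \<Longrightarrow> truth x \<in> Hom C x Om"
  unfolding truth_def using Comp_in_Hom[OF bang_hom true_hom] .

lemma true_comp: "k \<in> Hom C y u \<Longrightarrow> t \<cdot> k = truth y"
  unfolding truth_def by (drule bang_eq) (rule arg_cong)

lemma truth_terminal: "truth u = t"
  using true_comp[OF Ident_in_Hom] comp_id[OF true_hom] Hom_Ob[OF true_hom] by simp

text \<open>The leg into the terminal object is forced and \<open>m\<close> is mono, so being a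
  pullback of \<open>t\<close> amounts to saying which generalised elements of \<open>x\<close>
  factor through \<open>m\<close>.\<close>

lemma pullback_trueI:
  assumes m: "m \<in> Hom C w x" "is_mono C m" and c: "c \<in> Hom C x Om"
    and *: "\<And>y k. k \<in> Hom C y x \<Longrightarrow> c \<cdot> k = truth y \<longleftrightarrow> (\<exists>h \<in> Hom C y w. m \<cdot> h = k)"
  shows "is_pullback C m (bang w) c t"
proof -
  note w = Hom_Ob(1)[OF m(1)]
  have "m \<cdot> Ident C w = m" "Ident C w \<in> Hom C w w" using comp_id[OF m(1)] Ident_in_Hom[OF w] by auto
  then have cm: "c \<cdot> m = t \<cdot> bang w" using *[OF m(1)] by (auto simp: truth_def)
  have "\<exists>!h. h \<in> Hom C y w \<and> m \<cdot> h = a \<and> bang w \<cdot> h = b"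
    if y: "y \<in> Ob C" and a: "a \<in> Hom C y x" and b: "b \<in> Hom C y u" and ab: "c \<cdot> a = t \<cdot> b" for y a b
  proof -
    obtain h where h: "h \<in> Hom C y w" "m \<cdot> h = a"
      using *[OF a] ab true_comp[OF b] by auto
    have "bang w \<cdot> h = b"
      using bang_eq[OF Comp_in_Hom[OF h(1) bang_hom[OF w]]] bang_eq[OF b] by simp
    then show ?thesis using h is_monoD[OF m(2)] HomD[OF m(1)] by (intro ex1I[of _ h]) auto
  qed
  then show ?thesis
    using HomD[OF m(1)] HomD[OF c] HomD[OF true_hom] HomD[OF bang_hom[OF w]] cm
    unfolding is_pullback_def by simp
qed

lemma pullback_true_iff:
  assumes pb: "is_pullback C m q c t" and c: "c \<in> Hom C x Om" and k: "k \<in> Hom C y x"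
  shows "c \<cdot> k = truth y \<longleftrightarrow> (\<exists>h \<in> Hom C y (Dom C m). m \<cdot> h = k)"
proof
  note y = Hom_Ob(1)[OF k]
  note D = pullbackD[OF pb]
  have mH: "m \<in> Hom C (Dom C m) x" and qH: "q \<in> Hom C (Dom C m) u"
    using D HomD[OF c] HomD[OF true_hom] by auto
  show "\<exists>h \<in> Hom C y (Dom C m). m \<cdot> h = k" if "c \<cdot> k = truth y"
    using pullback_universal[OF pb, of k y "bang y"] k bang_hom[OF y] that HomD[OF c] HomD[OF true_hom]
    by (auto simp: truth_def)
  show "c \<cdot> k = truth y" if "\<exists>h \<in> Hom C y (Dom C m). m \<cdot> h = k"
  proof -
    from that obtain h where h: "h \<in> Hom C y (Dom C m)" "m \<cdot> h = k" by blast
    have "c \<cdot> k = t \<cdot> (q \<cdot> h)"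
      using Comp_assoc[OF h(1) mH c] Comp_assoc[OF h(1) qH true_hom] D(3) h(2) by simp
    then show ?thesis using true_comp[OF Comp_in_Hom[OF h(1) qH]] by simp
  qed
qed

lemma pullback_true_mono:
  assumes pb: "is_pullback C m q c t"
  shows "is_mono C m"
  unfolding is_mono_def
proof (intro conjI ballI impI)
  note D = pullbackD[OF pb]
  have qH: "q \<in> Hom C (Dom C m) u" using D HomD[OF true_hom] by auto
  fix x f g assume fg: "f \<in> Hom C x (Dom C m)" "g \<in> Hom C x (Dom C m)" "m \<cdot> f = m \<cdot> g"
  have "q \<cdot> f = q \<cdot> g"
    using terminal_unique[OF terminal Comp_in_Hom[OF fg(1) qH] Comp_in_Hom[OF fg(2) qH]] .
  then show "f = g" using pullback_unique[OF pb] fg by blast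
qed (use HomD[OF pullbackD(1)[OF pb]] in simp)

lemma char_map_unique:
  assumes m: "m \<in> Hom C w x" "is_mono C m" and c: "c \<in> Hom C x Om" "c' \<in> Hom C x Om"
    and "\<And>y k. k \<in> Hom C y x \<Longrightarrow> c \<cdot> k = truth y \<longleftrightarrow> (\<exists>h \<in> Hom C y w. m \<cdot> h = k)"
    and "\<And>y k. k \<in> Hom C y x \<Longrightarrow> c' \<cdot> k = truth y \<longleftrightarrow> (\<exists>h \<in> Hom C y w. m \<cdot> h = k)"
  shows "c = c'"
proof -
  have "is_char_map C t m c" "is_char_map C t m c'"
    using pullback_trueI[OF m c(1)] pullback_trueI[OF m c(2)] assms HomD[OF m(1)] HomD[OF true_hom]
    unfolding is_char_map_def by auto
  moreover have "\<exists>!d. is_char_map C t m d"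
    using classifier m(2) by (simp add: is_subobject_classifier_def)
  ultimately show ?thesis by blast
qed

text \<open>Pull \<open>t\<close> back along \<open>p\<close> to a mono \<open>m\<close>. Since
  \<open>q\<close> is true at the same generalised elements, it is a characteristic map of
  \<open>m\<close> as well, and these are unique.\<close>

lemma truth_ext:
  assumes p: "p \<in> Hom C x Om" and q: "q \<in> Hom C x Om"
    and pq: "\<And>y k. k \<in> Hom C y x \<Longrightarrow> p \<cdot> k = truth y \<longleftrightarrow> q \<cdot> k = truth y"
  shows "p = q"
proof -
  obtain m r where pb: "is_pullback C m r p t"
    using ex_pullback[of p t] HomD[OF p] HomD[OF true_hom] by auto
  have mH: "m \<in> Hom C (Dom C m) x" using pullbackD(1)[OF pb] HomD[OF p] by simp
  show ?thesis
    by (rule char_map_unique[OF mH pullback_true_mono[OF pb] p q])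
      (use pullback_true_iff[OF pb p] pq in auto)
qed

lemma char_map:
  assumes m: "m \<in> Hom C w x" "is_mono C m"
  shows char_map_hom: "char_map C t m \<in> Hom C x Om"
    and char_map_true: "\<And>k y. k \<in> Hom C y x \<Longrightarrow>
      char_map C t m \<cdot> k = truth y \<longleftrightarrow> (\<exists>h \<in> Hom C y w. m \<cdot> h = k)"
proof -
  have "\<exists>!d. is_char_map C t m d"
    using classifier m(2) by (simp add: is_subobject_classifier_def)
  then have c: "is_char_map C t m (char_map C t m)"
    unfolding char_map_def by (rule theI')
  then show "char_map C t m \<in> Hom C x Om"
    using HomD[OF m(1)] HomD[OF true_hom] by (simp add: is_char_map_def)
  then show "char_map C t m \<cdot> k = truth y \<longleftrightarrow> (\<exists>h \<in> Hom C y w. m \<cdot> h = k)"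
    if "k \<in> Hom C y x" for k y
    using c pullback_true_iff that HomD[OF m(1)] unfolding is_char_map_def by blast
qed

lemma point_mono:
  assumes s: "s \<in> Hom C u x"
  shows "is_mono C s"
  unfolding is_mono_def using HomD[OF s] terminal_unique[OF terminal] by auto

text \<open>Arrows into the terminal object are unique, so the only element at stage
  \<open>y\<close> that factors through \<open>s\<close> is the constant one.\<close>

lemma point_char_map_true:
  assumes s: "s \<in> Hom C u x" and k: "k \<in> Hom C y x"
  shows "char_map C t s \<cdot> k = truth y \<longleftrightarrow> k = s \<cdot> bang y"
proof -
  have "h = bang y" if "h \<in> Hom C y u" for h using bang_eq that .
  then show ?thesis
    using char_map_true[OF s point_mono[OF s] k] bang_hom[OF Hom_Ob(1)[OF k]] by metis
qed

text \<open>Inclusion of the classified subobjects, compared through their generalised elements.\<close>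

definition leq :: "'a \<Rightarrow> 'b \<Rightarrow> 'b \<Rightarrow> bool" where
  "leq x p q \<longleftrightarrow> (\<forall>y. \<forall>k \<in> Hom C y x. p \<cdot> k = truth y \<longrightarrow> q \<cdot> k = truth y)"

lemma leqD: "leq x p q \<Longrightarrow> k \<in> Hom C y x \<Longrightarrow> p \<cdot> k = truth y \<Longrightarrow> q \<cdot> k = truth y"
  by (auto simp: leq_def)

lemma leq_antisym:
  "p \<in> Hom C x Om \<Longrightarrow> q \<in> Hom C x Om \<Longrightarrow> leq x p q \<Longrightarrow> leq x q p \<Longrightarrow> p = q"
  by (rule truth_ext) (auto simp: leq_def)

lemma leq_comp:
  assumes "p \<in> Hom C x Om" "q \<in> Hom C x Om" "leq x p q" "h \<in> Hom C y x"
  shows "leq y (p \<cdot> h) (q \<cdot> h)"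
  unfolding leq_def
proof (intro allI ballI impI)
  fix z k assume k: "k \<in> Hom C z y" and "(p \<cdot> h) \<cdot> k = truth z"
  then have "p \<cdot> (h \<cdot> k) = truth z" using Comp_assoc[OF k assms(4,1)] by simp
  from leqD[OF assms(3) Comp_in_Hom[OF k assms(4)] this]
  show "(q \<cdot> h) \<cdot> k = truth z" using Comp_assoc[OF k assms(4,2)] by simp
qed

section \<open>Binary products and the internal meet\<close>

lemma product:
  assumes "a \<in> Ob C" "b \<in> Ob C"
  shows "is_product C a b (prod_ob C a b) (proj1 C a b) (proj2 C a b)"
proof -
  note a = bang_hom[OF assms(1)] and b = bang_hom[OF assms(2)]
  obtain p q where pb: "is_pullback C p q (bang a) (bang b)"
    using ex_pullback[of "bang a" "bang b"] HomD[OF a] HomD[OF b] by auto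
  have "bang a \<cdot> f = bang b \<cdot> g" if "f \<in> Hom C x a" "g \<in> Hom C x b" for x f g
    using terminal_unique[OF terminal Comp_in_Hom[OF that(1) a] Comp_in_Hom[OF that(2) b]] .
  then have "is_product C a b (Dom C p) p q"
    using pullbackD[OF pb] pullback_universal[OF pb] HomD[OF a] HomD[OF b] Hom_Ob
    unfolding is_product_def by auto
  then have "\<exists>z. case z of (p, p1, p2) \<Rightarrow> is_product C a b p p1 p2" by auto
  then have "case product_cone C a b of (p, p1, p2) \<Rightarrow> is_product C a b p p1 p2"
    unfolding product_cone_def by (rule someI_ex)
  then show ?thesis
    by (cases "product_cone C a b") (simp add: prod_ob_def proj1_def proj2_def)
qed

lemma proj_hom:
  assumes "a \<in> Ob C" "b \<in> Ob C"
  shows "proj1 C a b \<in> Hom C (prod_ob C a b) a" "proj2 C a b \<in> Hom C (prod_ob C a b) b"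
  using product[OF assms] by (auto simp: is_product_def)

lemma pairing:
  assumes f: "f \<in> Hom C x a" and g: "g \<in> Hom C x b"
  shows "pairing C f g \<in> Hom C x (prod_ob C a b)"
    "proj1 C a b \<cdot> pairing C f g = f" "proj2 C a b \<cdot> pairing C f g = g"
proof -
  have "\<exists>!h. h \<in> Hom C x (prod_ob C a b) \<and> proj1 C a b \<cdot> h = f \<and> proj2 C a b \<cdot> h = g"
    using product[OF Hom_Ob(2)[OF f] Hom_Ob(2)[OF g]] f g Hom_Ob(1)[OF f]
    unfolding is_product_def by blast
  from theI'[OF this]
  have "pairing C f g \<in> Hom C x (prod_ob C a b) \<and> proj1 C a b \<cdot> pairing C f g = f \<and>
      proj2 C a b \<cdot> pairing C f g = g"
    unfolding pairing_def HomD(2)[OF f] HomD(3)[OF f] HomD(3)[OF g] .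
  then show "pairing C f g \<in> Hom C x (prod_ob C a b)"
    "proj1 C a b \<cdot> pairing C f g = f" "proj2 C a b \<cdot> pairing C f g = g"
    by blast+
qed

lemma product_ext:
  assumes "a \<in> Ob C" "b \<in> Ob C" "h \<in> Hom C x (prod_ob C a b)" "k \<in> Hom C x (prod_ob C a b)"
    "proj1 C a b \<cdot> h = proj1 C a b \<cdot> k" "proj2 C a b \<cdot> h = proj2 C a b \<cdot> k"
  shows "h = k"
proof -
  note pr = proj_hom[OF assms(1,2)]
  have "\<exists>!g. g \<in> Hom C x (prod_ob C a b) \<and> proj1 C a b \<cdot> g = proj1 C a b \<cdot> k \<and>
      proj2 C a b \<cdot> g = proj2 C a b \<cdot> k"
    using product[OF assms(1,2)] Comp_in_Hom[OF assms(4) pr(1)] Comp_in_Hom[OF assms(4) pr(2)]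
      Hom_Ob(1)[OF assms(4)] unfolding is_product_def by blast
  then show ?thesis using assms(3-) by blast
qed

lemma Om_Ob: "Om \<in> Ob C" and u_Ob: "u \<in> Ob C"
  using Hom_Ob[OF true_hom] by auto

lemma meet_hom: "internal_meet C t \<in> Hom C (prod_ob C Om Om) Om"
  unfolding internal_meet_def
  using char_map_hom[OF pairing(1) point_mono[OF pairing(1)], OF true_hom true_hom true_hom true_hom] .

text \<open>The meet is the characteristic map of a point, the pair of \<open>t\<close> with itself,
  so it is true exactly at the constant pair; the projections detect this.\<close>

lemma meet_true:
  assumes k: "k \<in> Hom C y (prod_ob C Om Om)"
  shows "internal_meet C t \<cdot> k = truth y \<longleftrightarrow>
    proj1 C Om Om \<cdot> k = truth y \<and> proj2 C Om Om \<cdot> k = truth y"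
proof -
  note tt = pairing[OF true_hom true_hom] and pr = proj_hom[OF Om_Ob Om_Ob]
  note b = bang_hom[OF Hom_Ob(1)[OF k]]
  have "internal_meet C t \<cdot> k = truth y \<longleftrightarrow> k = pairing C t t \<cdot> bang y"
    unfolding internal_meet_def using point_char_map_true[OF tt(1) k] .
  moreover have "proj1 C Om Om \<cdot> (pairing C t t \<cdot> bang y) = truth y"
    "proj2 C Om Om \<cdot> (pairing C t t \<cdot> bang y) = truth y"
    using Comp_assoc[OF b tt(1) pr(1)] Comp_assoc[OF b tt(1) pr(2)] tt(2,3) true_comp[OF b] by auto
  ultimately show ?thesis
    using product_ext[OF Om_Ob Om_Ob k Comp_in_Hom[OF b tt(1)]] by auto
qed

lemma meet_prod_arr_hom:
  assumes c: "c \<in> Hom C M Om"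
  shows "internal_meet C t \<cdot> prod_arr C (Ident C Om) c \<in> Hom C (prod_ob C Om M) Om"
    and "prod_arr C (Ident C Om) c \<in> Hom C (prod_ob C Om M) (prod_ob C Om Om)"
    and "proj1 C Om Om \<cdot> prod_arr C (Ident C Om) c = proj1 C Om M"
    and "proj2 C Om Om \<cdot> prod_arr C (Ident C Om) c = c \<cdot> proj2 C Om M"
proof -
  note M = Hom_Ob(1)[OF c] and pr = proj_hom[OF Om_Ob Hom_Ob(1)[OF c]]
  have eq: "prod_arr C (Ident C Om) c = pairing C (proj1 C Om M) (c \<cdot> proj2 C Om M)"
    using id_comp[OF pr(1)] HomD[OF c] Ident_Arr[OF Om_Ob] by (simp add: prod_arr_def)
  show 1: "prod_arr C (Ident C Om) c \<in> Hom C (prod_ob C Om M) (prod_ob C Om Om)"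
    "proj1 C Om Om \<cdot> prod_arr C (Ident C Om) c = proj1 C Om M"
    "proj2 C Om Om \<cdot> prod_arr C (Ident C Om) c = c \<cdot> proj2 C Om M"
    unfolding eq using pairing[OF pr(1) Comp_in_Hom[OF pr(2) c]] .
  show "internal_meet C t \<cdot> prod_arr C (Ident C Om) c \<in> Hom C (prod_ob C Om M) Om"
    using Comp_in_Hom[OF 1(1) meet_hom] .
qed

text \<open>For truth values, \<open>p = p \<and> q\<close> says \<open>p \<le> q\<close>.\<close>

lemma meet_equation_iff:
  assumes c: "c \<in> Hom C M Om" and k: "k \<in> Hom C y (prod_ob C Om M)"
  shows "proj1 C Om M \<cdot> k = (internal_meet C t \<cdot> prod_arr C (Ident C Om) c) \<cdot> k \<longleftrightarrow>
    leq y (proj1 C Om M \<cdot> k) (c \<cdot> (proj2 C Om M \<cdot> k))"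
proof -
  note pr = proj_hom[OF Om_Ob Hom_Ob(1)[OF c]] and prO = proj_hom[OF Om_Ob Om_Ob]
  note pa = meet_prod_arr_hom[OF c]
  note 1 = Comp_in_Hom[OF k pr(1)] and 2 = Comp_in_Hom[OF k pr(2)] and 3 = Comp_in_Hom[OF k pa(1)]
  have "((internal_meet C t \<cdot> prod_arr C (Ident C Om) c) \<cdot> k) \<cdot> j = truth z \<longleftrightarrow>
     (proj1 C Om M \<cdot> k) \<cdot> j = truth z \<and> (c \<cdot> (proj2 C Om M \<cdot> k)) \<cdot> j = truth z"
    if j: "j \<in> Hom C z y" for j z
  proof -
    note kj = Comp_in_Hom[OF j k]
    have "((internal_meet C t \<cdot> prod_arr C (Ident C Om) c) \<cdot> k) \<cdot> j =
        internal_meet C t \<cdot> (prod_arr C (Ident C Om) c \<cdot> (k \<cdot> j))"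
      using Comp_assoc[OF j k pa(1)] Comp_assoc[OF kj pa(2) meet_hom] by simp
    moreover have "proj1 C Om Om \<cdot> (prod_arr C (Ident C Om) c \<cdot> (k \<cdot> j)) = (proj1 C Om M \<cdot> k) \<cdot> j"
      using Comp_assoc[OF kj pa(2) prO(1)] Comp_assoc[OF j k pr(1)] pa(3) by simp
    moreover have "proj2 C Om Om \<cdot> (prod_arr C (Ident C Om) c \<cdot> (k \<cdot> j)) = (c \<cdot> (proj2 C Om M \<cdot> k)) \<cdot> j"
      using Comp_assoc[OF kj pa(2) prO(2)] Comp_assoc[OF kj pr(2) c] Comp_assoc[OF j k pr(2)]
        Comp_assoc[OF j 2 c] pa(4) by simp
    ultimately show ?thesis using meet_true[OF Comp_in_Hom[OF kj pa(2)]] by simp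
  qed
  \<comment> \<open>By \<open>truth_ext\<close> the equation is an equivalence of memberships, and
    \<open>A \<longleftrightarrow> A \<and> B\<close> is just
    \<open>A \<longrightarrow> B\<close>.\<close>
  then show ?thesis
    using truth_ext[OF 1 3] unfolding leq_def by metis
qed

end

section \<open>Objects representing monotone families of truth values\<close>

locale classified_inverse = classified C u Om t + I: category I
  for C :: "('o, 'm) cat" (structure) and u Om t and I :: "('i, 'a) cat" +
  fixes deg :: "'i \<Rightarrow> nat"
  assumes inverse: "generalised_inverse_category I deg"
    and matching_limits: "i \<in> Ob I \<Longrightarrow> has_limits_of_shape (decreasing_coslice I deg i) C"
begin

abbreviation out :: "'i \<Rightarrow> 'a set" where
  "out i \<equiv> {f \<in> Arr I. Dom I f = i}"

text \<open>Over sets this is a set of arrows out of \<open>i\<close> closed under postcomposition,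
  i.e. an element of the usual classifier of covariant set-valued functors. Here membership of an
  arrow is a truth value at stage \<open>x\<close>.\<close>

definition cosieve_family :: "'i \<Rightarrow> 'o \<Rightarrow> ('a \<Rightarrow> 'm) \<Rightarrow> bool" where
  "cosieve_family i x p \<longleftrightarrow> (\<forall>f \<in> out i. p f \<in> Hom C x Om) \<and>
     (\<forall>f \<in> out i. \<forall>g \<in> out (Cod I f). leq x (p f) (p (g \<cdot>\<^bsub>I\<^esub> f)))"

text \<open>\<open>v\<close> is the universal family: the pair represents the presheaf that sends
  \<open>x\<close> to the families at stage \<open>x\<close>, with the action of
  \<open>cosieve_family_comp\<close>.\<close>

definition represents :: "'i \<Rightarrow> 'o \<Rightarrow> ('a \<Rightarrow> 'm) \<Rightarrow> bool" where
  "represents i w v \<longleftrightarrow> w \<in> Ob C \<and> cosieve_family i w v \<and>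
     (\<forall>x p. x \<in> Ob C \<and> cosieve_family i x p \<longrightarrow>
       (\<exists>!h. h \<in> Hom C x w \<and> (\<forall>f \<in> out i. v f \<cdot> h = p f)))"

lemma out_comp: "f \<in> out i \<Longrightarrow> g \<in> out (Cod I f) \<Longrightarrow> g \<cdot>\<^bsub>I\<^esub> f \<in> out i \<and> Cod I (g \<cdot>\<^bsub>I\<^esub> f) = Cod I g"
  using I.Comp_Arr by simp

lemma out_assoc:
  "f \<in> Arr I \<Longrightarrow> g \<in> out (Cod I f) \<Longrightarrow> h \<in> out (Cod I g) \<Longrightarrow> (h \<cdot>\<^bsub>I\<^esub> g) \<cdot>\<^bsub>I\<^esub> f = h \<cdot>\<^bsub>I\<^esub> (g \<cdot>\<^bsub>I\<^esub> f)"
  by (rule I.Comp_assoc) (auto simp: Hom_def)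

lemma out_ident: "i \<in> Ob I \<Longrightarrow> Ident I i \<in> out i \<and> Cod I (Ident I i) = i"
  using I.Ident_Arr by simp

lemma cosieve_familyD:
  assumes "cosieve_family i x p"
  shows "f \<in> out i \<Longrightarrow> p f \<in> Hom C x Om"
    "f \<in> out i \<Longrightarrow> g \<in> out (Cod I f) \<Longrightarrow> leq x (p f) (p (g \<cdot>\<^bsub>I\<^esub> f))"
  using assms unfolding cosieve_family_def by blast+

lemma cosieve_family_comp:
  assumes p: "cosieve_family i x p" and h: "h \<in> Hom C y x"
  shows "cosieve_family i y (\<lambda>f. p f \<cdot> h)"
proof -
  note D = cosieve_familyD[OF p]
  have "leq y (p f \<cdot> h) (p (g \<cdot>\<^bsub>I\<^esub> f) \<cdot> h)" if "f \<in> out i" "g \<in> out (Cod I f)" for f g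
    using leq_comp[OF D(1)[OF that(1)] D(1)[OF conjunct1[OF out_comp[OF that]]] D(2)[OF that] h] .
  then show ?thesis using Comp_in_Hom[OF h D(1)] unfolding cosieve_family_def by blast
qed

text \<open>Restriction along \<open>g\<close>, the source of the functoriality of \<Omega>.\<close>

lemma cosieve_family_precomp:
  assumes g: "g \<in> Arr I" and p: "cosieve_family (Dom I g) x p"
  shows "cosieve_family (Cod I g) x (\<lambda>f. p (f \<cdot>\<^bsub>I\<^esub> g))"
proof -
  note D = cosieve_familyD[OF p]
  have gf: "f \<cdot>\<^bsub>I\<^esub> g \<in> out (Dom I g)" "Cod I (f \<cdot>\<^bsub>I\<^esub> g) = Cod I f" if "f \<in> out (Cod I g)" for f
    using out_comp[of g] g that by auto
  have "leq x (p (f \<cdot>\<^bsub>I\<^esub> g)) (p ((h \<cdot>\<^bsub>I\<^esub> f) \<cdot>\<^bsub>I\<^esub> g))" if "f \<in> out (Cod I g)" "h \<in> out (Cod I f)" for f h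
    using D(2)[OF gf(1)[OF that(1)], of h] that gf(2)[OF that(1)] out_assoc[OF g that] by simp
  then show ?thesis using gf(1) D(1) unfolding cosieve_family_def by blast
qed

lemma cosieve_family_truth: "x \<in> Ob C \<Longrightarrow> cosieve_family i x (\<lambda>_. truth x)"
  using truth_hom by (auto simp: cosieve_family_def leq_def)

lemma representsD:
  assumes "represents i w v"
  shows "w \<in> Ob C" "cosieve_family i w v"
  using assms by (auto simp: represents_def)

lemma represents_lift:
  assumes "represents i w v" "x \<in> Ob C" "cosieve_family i x p"
  shows "\<exists>!h. h \<in> Hom C x w \<and> (\<forall>f \<in> out i. v f \<cdot> h = p f)"
  using assms unfolding represents_def by blast

lemma represents_unique:
  assumes r: "represents i w v" and h: "h \<in> Hom C x w" and k: "k \<in> Hom C x w"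
    and hk: "\<And>f. f \<in> out i \<Longrightarrow> v f \<cdot> h = v f \<cdot> k"
  shows "h = k"
  using represents_lift[OF r Hom_Ob(1)[OF h] cosieve_family_comp[OF representsD(2)[OF r] k]]
    h k hk by blast

definition rep :: "'i \<Rightarrow> bool" where
  "rep i \<longleftrightarrow> (\<exists>w v. represents i w v)"

text \<open>The next four definitions are junk at objects without \<open>rep\<close>. Choosing them once, before the
  induction on the degree that establishes \<open>rep\<close> everywhere, makes the matching diagram in the
  induction step the one that occurs in the theorem.\<close>

definition omega_ob :: "'i \<Rightarrow> 'o" where
  "omega_ob i = fst (SOME z. represents i (fst z) (snd z))"

definition ev :: "'i \<Rightarrow> 'a \<Rightarrow> 'm" where
  "ev i = snd (SOME z. represents i (fst z) (snd z))"

definition omega_arr :: "'a \<Rightarrow> 'm" where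
  "omega_arr g = (THE h. h \<in> Hom C (omega_ob (Dom I g)) (omega_ob (Cod I g)) \<and>
     (\<forall>f \<in> out (Cod I g). ev (Cod I g) f \<cdot> h = ev (Dom I g) (f \<cdot>\<^bsub>I\<^esub> g)))"

definition omega_true :: "'i \<Rightarrow> 'm" where
  "omega_true i = (THE h. h \<in> Hom C u (omega_ob i) \<and> (\<forall>f \<in> out i. ev i f \<cdot> h = t))"

lemma rep_represents: "rep i \<Longrightarrow> represents i (omega_ob i) (ev i)"
proof -
  assume "rep i"
  then have "\<exists>z. represents i (fst z) (snd z)" by (auto simp: rep_def)
  then show ?thesis unfolding omega_ob_def ev_def by (rule someI_ex)
qed

lemma ev_hom: "rep i \<Longrightarrow> f \<in> out i \<Longrightarrow> ev i f \<in> Hom C (omega_ob i) Om"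
  using cosieve_familyD(1)[OF representsD(2)[OF rep_represents]] .

lemma omega_arr:
  assumes g: "g \<in> Arr I" and r: "rep (Dom I g)" "rep (Cod I g)"
  shows "omega_arr g \<in> Hom C (omega_ob (Dom I g)) (omega_ob (Cod I g))"
    and "f \<in> out (Cod I g) \<Longrightarrow> ev (Cod I g) f \<cdot> omega_arr g = ev (Dom I g) (f \<cdot>\<^bsub>I\<^esub> g)"
proof -
  have "omega_arr g \<in> Hom C (omega_ob (Dom I g)) (omega_ob (Cod I g)) \<and>
     (\<forall>f \<in> out (Cod I g). ev (Cod I g) f \<cdot> omega_arr g = ev (Dom I g) (f \<cdot>\<^bsub>I\<^esub> g))"
    unfolding omega_arr_def
    by (rule theI', rule represents_lift[OF rep_represents[OF r(2)]])
      (use representsD[OF rep_represents[OF r(1)]] cosieve_family_precomp[OF g] in auto)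
  then show "omega_arr g \<in> Hom C (omega_ob (Dom I g)) (omega_ob (Cod I g))"
    "f \<in> out (Cod I g) \<Longrightarrow> ev (Cod I g) f \<cdot> omega_arr g = ev (Dom I g) (f \<cdot>\<^bsub>I\<^esub> g)"
    by blast+
qed

lemma omega_true:
  assumes r: "rep i"
  shows "omega_true i \<in> Hom C u (omega_ob i)"
    and "f \<in> out i \<Longrightarrow> ev i f \<cdot> omega_true i = t"
proof -
  have "cosieve_family i u (\<lambda>_. t)" using cosieve_family_truth[OF u_Ob] truth_terminal by simp
  from theI'[OF represents_lift[OF rep_represents[OF r] u_Ob this]]
  have "omega_true i \<in> Hom C u (omega_ob i) \<and> (\<forall>f \<in> out i. ev i f \<cdot> omega_true i = t)"
    unfolding omega_true_def .
  then show "omega_true i \<in> Hom C u (omega_ob i)" "f \<in> out i \<Longrightarrow> ev i f \<cdot> omega_true i = t"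
    by blast+
qed

lemma ev_omega_true_comp:
  assumes r: "rep i" and f: "f \<in> out i" and b: "b \<in> Hom C y u"
  shows "ev i f \<cdot> (omega_true i \<cdot> b) = truth y"
  using Comp_assoc[OF b omega_true(1)[OF r] ev_hom[OF r f]] omega_true(2)[OF r f] true_comp[OF b]
  by simp

text \<open>Evaluations reduce to those at identities once the element is moved along
  \<open>g\<close>. This is how a family on the decreasing arrows is recovered from a cone of
  elements of \<Omega>.\<close>

lemma ev_ident_comp:
  assumes g: "g \<in> Arr I" and r: "rep (Dom I g)" "rep (Cod I g)"
  shows "ev (Dom I g) g = ev (Cod I g) (Ident I (Cod I g)) \<cdot> omega_arr g"
  using omega_arr(2)[OF g r] out_ident[OF I.Cod_in_Ob[OF g]] I.Comp_Ident_left[OF g] by simp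

text \<open>Every arrow out of \<open>i\<close> factors through the identity, so monotonicity
  spreads truth at the identity to the whole family, and the family of constant truths belongs to
  \<open>omega_true i\<close>.\<close>

lemma ev_ident_true_iff:
  assumes i: "i \<in> Ob I" and r: "rep i" and k: "k \<in> Hom C y (omega_ob i)"
  shows "ev i (Ident I i) \<cdot> k = truth y \<longleftrightarrow> k = omega_true i \<cdot> bang y"
proof
  note b = bang_hom[OF Hom_Ob(1)[OF k]]
  show "ev i (Ident I i) \<cdot> k = truth y" if "k = omega_true i \<cdot> bang y"
    using ev_omega_true_comp[OF r _ b] out_ident[OF i] that by blast
  show "k = omega_true i \<cdot> bang y" if tr: "ev i (Ident I i) \<cdot> k = truth y"
  proof (rule represents_unique[OF rep_represents[OF r] k Comp_in_Hom[OF b omega_true(1)[OF r]]])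
    fix f assume f: "f \<in> out i"
    have "leq (omega_ob i) (ev i (Ident I i)) (ev i (f \<cdot>\<^bsub>I\<^esub> Ident I i))"
      using cosieve_familyD(2)[OF representsD(2)[OF rep_represents[OF r]]] out_ident[OF i] f by simp
    from leqD[OF this k tr] have "ev i f \<cdot> k = truth y" using f I.Comp_Ident_right by auto
    then show "ev i f \<cdot> k = ev i f \<cdot> (omega_true i \<cdot> bang y)"
      using ev_omega_true_comp[OF r f b] by simp
  qed
qed

section \<open>Degree-decreasing arrows and the matching diagram\<close>

lemma deg_cases:
  assumes f: "f \<in> Arr I"
  shows "deg (Cod I f) < deg (Dom I f) \<or> is_iso I f \<and> deg (Cod I f) = deg (Dom I f)"
  using inverse f by (auto simp: generalised_inverse_category_def split: if_splits)

abbreviation lower :: "'i \<Rightarrow> 'a set" where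
  "lower i \<equiv> {f \<in> out i. deg (Cod I f) < deg i}"

text \<open>Arrows never raise the degree, so the decreasing ones form a cosieve.\<close>

lemma lower_comp:
  assumes f: "f \<in> lower i" and g: "g \<in> out (Cod I f)"
  shows "g \<cdot>\<^bsub>I\<^esub> f \<in> lower i"
  using deg_cases[of g] out_comp[of f i g] f g by auto

lemma Ob_decreasing_coslice: "Ob (decreasing_coslice I deg i) = lower i"
  by (auto simp: decreasing_coslice_def full_subcategory_def coslice_def)

lemma Arr_decreasing_coslice:
  "Arr (decreasing_coslice I deg i) =
     {(f, h, g). f \<in> lower i \<and> g \<in> lower i \<and> h \<in> Hom I (Cod I f) (Cod I g) \<and> h \<cdot>\<^bsub>I\<^esub> f = g}"
  by (auto simp: decreasing_coslice_def full_subcategory_def coslice_def)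

lemma decreasing_coslice_sel:
  "Dom (decreasing_coslice I deg i) = (\<lambda>(f, h, g). f)"
  "Cod (decreasing_coslice I deg i) = (\<lambda>(f, h, g). g)"
  "Ident (decreasing_coslice I deg i) = (\<lambda>f. (f, Ident I (Cod I f), f))"
  "Comp (decreasing_coslice I deg i) = (\<lambda>(f', h', g') (f, h, g). (f, h' \<cdot>\<^bsub>I\<^esub> h, g'))"
  by (simp_all add: decreasing_coslice_def full_subcategory_def coslice_def)

definition Omega :: "('i, 'a, 'o, 'm) fnctr" where
  "Omega = \<lparr>FOb = (\<lambda>i\<in>Ob I. omega_ob i), FArr = (\<lambda>f\<in>Arr I. omega_arr f)\<rparr>"

text \<open>Here and in the following laws \<open>rep\<close> is a hypothesis at the objects
  involved, since the induction uses the laws in lower degrees before \<open>rep\<close> is known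
  everywhere. They hold because arrows into a representing object are determined by the family they
  induce.\<close>

lemma omega_arr_ident:
  assumes i: "i \<in> Ob I" and r: "rep i"
  shows "omega_arr (Ident I i) = Ident C (omega_ob i)"
proof (rule represents_unique[OF rep_represents[OF r]])
  note id = I.Ident_Arr[OF i] and R = rep_represents[OF r]
  show "omega_arr (Ident I i) \<in> Hom C (omega_ob i) (omega_ob i)"
    using omega_arr(1)[OF id(1)] id r by simp
  show "Ident C (omega_ob i) \<in> Hom C (omega_ob i) (omega_ob i)"
    using Ident_in_Hom[OF representsD(1)[OF R]] .
  fix f assume f: "f \<in> out i"
  then show "ev i f \<cdot> omega_arr (Ident I i) = ev i f \<cdot> Ident C (omega_ob i)"
    using omega_arr(2)[OF id(1), of f] id r comp_id[OF ev_hom[OF r f]] I.Comp_Ident_right[of f] by simp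
qed

lemma omega_arr_comp:
  assumes g: "g \<in> Arr I" and h: "h \<in> Arr I" and gh: "Cod I g = Dom I h"
    and r: "rep (Dom I g)" "rep (Cod I g)" "rep (Cod I h)"
  shows "omega_arr (h \<cdot>\<^bsub>I\<^esub> g) = omega_arr h \<cdot> omega_arr g"
proof (rule represents_unique[OF rep_represents[OF r(3)]])
  note hg = I.Comp_Arr[OF g h gh[symmetric]]
  have og: "omega_arr g \<in> Hom C (omega_ob (Dom I g)) (omega_ob (Dom I h))"
    using omega_arr(1)[OF g r(1,2)] gh by simp
  have oh: "omega_arr h \<in> Hom C (omega_ob (Dom I h)) (omega_ob (Cod I h))"
    using omega_arr(1)[OF h] r gh by simp
  show "omega_arr (h \<cdot>\<^bsub>I\<^esub> g) \<in> Hom C (omega_ob (Dom I g)) (omega_ob (Cod I h))"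
    using omega_arr(1)[OF hg(1)] hg r by simp
  show "omega_arr h \<cdot> omega_arr g \<in> Hom C (omega_ob (Dom I g)) (omega_ob (Cod I h))"
    using Comp_in_Hom[OF og oh] .
  fix f assume f: "f \<in> out (Cod I h)"
  have hr: "rep (Dom I h)" using r gh by simp
  have "ev (Cod I h) f \<cdot> (omega_arr h \<cdot> omega_arr g) = ev (Dom I h) (f \<cdot>\<^bsub>I\<^esub> h) \<cdot> omega_arr g"
    using Comp_assoc[OF og oh ev_hom[OF r(3) f]] omega_arr(2)[OF h hr r(3) f] by simp
  also have "\<dots> = ev (Dom I g) ((f \<cdot>\<^bsub>I\<^esub> h) \<cdot>\<^bsub>I\<^esub> g)"
    using omega_arr(2)[OF g r(1,2), of "f \<cdot>\<^bsub>I\<^esub> h"] out_comp[of h "Dom I h" f] h f gh by simp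
  also have "\<dots> = ev (Dom I g) (f \<cdot>\<^bsub>I\<^esub> (h \<cdot>\<^bsub>I\<^esub> g))"
    using out_assoc[OF g, of h f] h f gh by simp
  also have "\<dots> = ev (Cod I h) f \<cdot> omega_arr (h \<cdot>\<^bsub>I\<^esub> g)"
    using omega_arr(2)[OF hg(1), of f] hg r f by simp
  finally show "ev (Cod I h) f \<cdot> omega_arr (h \<cdot>\<^bsub>I\<^esub> g) = ev (Cod I h) f \<cdot> (omega_arr h \<cdot> omega_arr g)"
    by simp
qed

lemma fcomp_codomain_functor:
  "f \<in> lower i \<Longrightarrow> FOb (fcomp Omega (codomain_functor I)) f = omega_ob (Cod I f)"
  "h \<in> Arr I \<Longrightarrow> FArr (fcomp Omega (codomain_functor I)) (f, h, g) = omega_arr h"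
  using I.Cod_in_Ob by (auto simp: fcomp_def codomain_functor_def Omega_def)

text \<open>The diagram meets only objects of degree below \<open>deg i\<close>, so \<Omega> acts
  functorially on it even while its values in higher degrees are still unspecified.\<close>

lemma matching_diagram_functor:
  assumes low: "\<And>j. j \<in> Ob I \<Longrightarrow> deg j < deg i \<Longrightarrow> rep j"
  shows "is_functor (decreasing_coslice I deg i) C (fcomp Omega (codomain_functor I))"
proof -
  have r: "rep (Cod I f)" if "f \<in> lower i" for f using low[of "Cod I f"] that I.Cod_in_Ob by simp
  show ?thesis
    unfolding is_functor_def Ob_decreasing_coslice Arr_decreasing_coslice decreasing_coslice_sel
    apply (intro conjI ballI impI)
    subgoal for f using fcomp_codomain_functor(1)[of f i] representsD(1)[OF rep_represents[OF r[of f]]] by simp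
    subgoal for z using omega_arr(1)[of "fst (snd z)"] r[of "fst z"] r[of "snd (snd z)"]
      fcomp_codomain_functor by (auto simp: Hom_def)
    subgoal for f using fcomp_codomain_functor(1)[of f i] omega_arr_ident[of "Cod I f"] r[of f]
      fcomp_codomain_functor(2)[of "Ident I (Cod I f)" f f] I.Cod_in_Ob[of f] I.Ident_Arr[of "Cod I f"] by simp
    subgoal for y z
      using omega_arr_comp[of "fst (snd y)" "fst (snd z)"] r[of "fst y"] r[of "fst z"] r[of "snd (snd z)"]
        fcomp_codomain_functor(2) I.Comp_Arr[of "fst (snd y)" "fst (snd z)"]
      by (auto simp: Hom_def)
    done
qed

lemma omega_arr_true:
  assumes h: "h \<in> Arr I" and r: "rep (Dom I h)" "rep (Cod I h)"
  shows "omega_arr h \<cdot> omega_true (Dom I h) = omega_true (Cod I h)"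
proof (rule represents_unique[OF rep_represents[OF r(2)]])
  note oh = omega_arr(1)[OF h r] and tr = omega_true(1)[OF r(1)]
  show "omega_arr h \<cdot> omega_true (Dom I h) \<in> Hom C u (omega_ob (Cod I h))"
    "omega_true (Cod I h) \<in> Hom C u (omega_ob (Cod I h))"
    using Comp_in_Hom[OF tr oh] omega_true(1)[OF r(2)] .
  fix f assume f: "f \<in> out (Cod I h)"
  show "ev (Cod I h) f \<cdot> (omega_arr h \<cdot> omega_true (Dom I h)) = ev (Cod I h) f \<cdot> omega_true (Cod I h)"
    using Comp_assoc[OF tr oh ev_hom[OF r(2) f]] omega_arr(2)[OF h r f] omega_true(2)[OF r(2) f]
      omega_true(2)[OF r(1), of "f \<cdot>\<^bsub>I\<^esub> h"] out_comp[of h "Dom I h" f] h f by simp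
qed

section \<open>Representing objects as equalisers over matching objects\<close>

text \<open>The limit, its point \<open>s\<close> and the equaliser are arbitrary: the induction
  uses any limit, and the final description uses the chosen matching object. Arrows into the
  equaliser are pairs of a truth value \<open>a\<close> and an arrow \<open>b\<close> into
  \<open>M\<close> with \<open>a\<close> below the characteristic map of \<open>s\<close> at
  \<open>b\<close>; the proof matches such pairs with families.\<close>

lemma equaliser_represents:
  assumes i: "i \<in> Ob I" and low: "\<And>j. j \<in> Ob I \<Longrightarrow> deg j < deg i \<Longrightarrow> rep j"
    and L: "is_limit (decreasing_coslice I deg i) C (fcomp Omega (codomain_functor I)) M l"
    and s: "s \<in> Hom C u M" "\<And>f. f \<in> lower i \<Longrightarrow> l f \<cdot> s = omega_true (Cod I f)"
    and e: "is_equaliser C e (proj1 C Om M)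
      (internal_meet C t \<cdot> prod_arr C (Ident C Om) (char_map C t s))"
  shows "represents i (Dom C e) (\<lambda>f. if f \<in> lower i
    then ev (Cod I f) (Ident I (Cod I f)) \<cdot> (l f \<cdot> (proj2 C Om M \<cdot> e)) else proj1 C Om M \<cdot> e)"
proof -
  define c where "c = char_map C t s"
  have c: "c \<in> Hom C M Om" unfolding c_def using char_map_hom[OF s(1) point_mono[OF s(1)]] .
  have c_true: "c \<cdot> k = truth y \<longleftrightarrow> k = s \<cdot> bang y" if "k \<in> Hom C y M" for k y
    unfolding c_def using point_char_map_true[OF s(1) that] .
  note M = Hom_Ob(1)[OF c]
  note pr = proj_hom[OF Om_Ob M]
  have r: "rep (Cod I f)" if "f \<in> lower i" for f using low[of "Cod I f"] that I.Cod_in_Ob by simp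
  have cone: "is_cone (decreasing_coslice I deg i) C (fcomp Omega (codomain_functor I)) M l"
    using L by (simp add: is_limit_def)
  have l: "l f \<in> Hom C M (omega_ob (Cod I f))" if "f \<in> lower i" for f
    using cone that fcomp_codomain_functor(1)[OF that]
    unfolding is_cone_def Ob_decreasing_coslice by auto
  have l_nat: "omega_arr g \<cdot> l f = l (g \<cdot>\<^bsub>I\<^esub> f)" if f: "f \<in> lower i" and g: "g \<in> out (Cod I f)" for f g
  proof -
    have "(f, g, g \<cdot>\<^bsub>I\<^esub> f) \<in> Arr (decreasing_coslice I deg i)"
      unfolding Arr_decreasing_coslice using f g lower_comp[OF f g] out_comp[of f i g]
      by (auto simp: Hom_def)
    then have "FArr (fcomp Omega (codomain_functor I)) (f, g, g \<cdot>\<^bsub>I\<^esub> f) \<cdot> l f = l (g \<cdot>\<^bsub>I\<^esub> f)"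
      using cone unfolding is_cone_def by (auto simp: decreasing_coslice_sel)
    then show ?thesis using g fcomp_codomain_functor(2) by simp
  qed
  \<comment> \<open>The family coded by a pair: \<open>b\<close> supplies an element of \<Omega> at
    the codomain of each decreasing arrow, evaluated at the identity there, and \<open>a\<close> is
    the value at all isomorphisms out of \<open>i\<close>.\<close>
  define fam where "fam = (\<lambda>a b f. if f \<in> lower i
    then ev (Cod I f) (Ident I (Cod I f)) \<cdot> (l f \<cdot> b) else a)"
  have id_out: "Ident I (Cod I f) \<in> out (Cod I f)" if "f \<in> out i" for f
    using out_ident[of "Cod I f"] I.Cod_in_Ob[of f] that by simp
  have lb: "l f \<cdot> b \<in> Hom C x (omega_ob (Cod I f))" if "b \<in> Hom C x M" "f \<in> lower i" for b f x
    using Comp_in_Hom[OF that(1) l[OF that(2)]] .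
  \<comment> \<open>The family represented by \<open>l f \<cdot> b\<close> is the part of
    \<open>fam\<close> beyond \<open>f\<close>. The value \<open>a\<close> is arbitrary because
    composites with a decreasing \<open>f\<close> are decreasing.\<close>
  have ev_l: "ev (Cod I f) g \<cdot> (l f \<cdot> b) = fam a b (g \<cdot>\<^bsub>I\<^esub> f)"
    if b: "b \<in> Hom C x M" and f: "f \<in> lower i" and g: "g \<in> out (Cod I f)" for a b x f g
  proof -
    have fA: "f \<in> out i" and gA: "g \<in> Arr I" and gD: "Dom I g = Cod I f" using f g by auto
    note gf = lower_comp[OF f g] and gfC = out_comp[OF fA g]
    have rg: "rep (Dom I g)" "rep (Cod I g)" using r[OF f] r[OF gf] gfC gD by auto
    have og: "omega_arr g \<in> Hom C (omega_ob (Cod I f)) (omega_ob (Cod I g))"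
      using omega_arr(1)[OF gA rg] gD by simp
    have ei: "ev (Cod I g) (Ident I (Cod I g)) \<in> Hom C (omega_ob (Cod I g)) Om"
      using ev_hom[OF rg(2)] out_ident[OF I.Cod_in_Ob[OF gA]] by simp
    have "ev (Cod I f) g \<cdot> (l f \<cdot> b) = ev (Cod I g) (Ident I (Cod I g)) \<cdot> (omega_arr g \<cdot> (l f \<cdot> b))"
      using ev_ident_comp[OF gA rg] gD Comp_assoc[OF lb[OF b f] og ei] by simp
    also have "omega_arr g \<cdot> (l f \<cdot> b) = l (g \<cdot>\<^bsub>I\<^esub> f) \<cdot> b"
      using Comp_assoc[OF b l[OF f] og] l_nat[OF f g] by simp
    finally show ?thesis using gf gfC by (simp add: fam_def)
  qed
  have fam_low: "fam a b f = ev (Cod I f) (Ident I (Cod I f)) \<cdot> (l f \<cdot> b)" if "f \<in> lower i" for a b f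
    using that by (simp only: fam_def if_True)
  have fam_top: "fam a b f = a" if "f \<notin> lower i" for a b f
    using that by (simp only: fam_def if_False)
  have fam_family: "cosieve_family i x (fam a b)"
    if a: "a \<in> Hom C x Om" and b: "b \<in> Hom C x M" and ab: "leq x a (c \<cdot> b)" for x a b
    unfolding cosieve_family_def
  proof (intro conjI ballI)
    fix f assume f: "f \<in> out i"
    show "fam a b f \<in> Hom C x Om"
    proof (cases "f \<in> lower i")
      case True
      show ?thesis
        unfolding fam_low[OF True] using Comp_in_Hom[OF lb[OF b True] ev_hom[OF r[OF True] id_out[OF f]]] .
    next
      case False
      show ?thesis unfolding fam_top[OF False] by (rule a)
    qed
    fix g assume g: "g \<in> out (Cod I f)"
    note gf = out_comp[OF f g]
    show "leq x (fam a b f) (fam a b (g \<cdot>\<^bsub>I\<^esub> f))"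
    proof (cases "f \<in> lower i")
      case True
      note R = rep_represents[OF r[OF True]]
      have "leq (omega_ob (Cod I f)) (ev (Cod I f) (Ident I (Cod I f))) (ev (Cod I f) g)"
        using cosieve_familyD(2)[OF representsD(2)[OF R] id_out[OF f], of g] g out_ident[of "Cod I f"]
          I.Cod_in_Ob[of f] f I.Comp_Ident_right[of g] by simp
      from leq_comp[OF ev_hom[OF r[OF True] id_out[OF f]] ev_hom[OF r[OF True] g] this lb[OF b True]]
      show ?thesis using ev_l[OF b True g] fam_low[OF True] by simp
    next
      case False
      show ?thesis
      proof (cases "g \<cdot>\<^bsub>I\<^esub> f \<in> lower i")
        case gl: True
        note gfo = conjunct1[OF gf]
        \<comment> \<open>Passage from an isomorphism to a decreasing arrow: truth of
          \<open>a\<close> at \<open>k\<close> makes \<open>c \<cdot> b\<close> true there, so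
          \<open>b \<cdot> k\<close> is constant at the point \<open>s\<close>, all of whose
          evaluations are true.\<close>
        have "fam a b (g \<cdot>\<^bsub>I\<^esub> f) \<cdot> k = truth y" if k: "k \<in> Hom C y x" and ak: "a \<cdot> k = truth y" for y k
        proof -
          have y: "bang y \<in> Hom C y u" using bang_hom[OF Hom_Ob(1)[OF k]] .
          have "c \<cdot> (b \<cdot> k) = truth y" using leqD[OF ab k ak] Comp_assoc[OF k b c] by simp
          then have "b \<cdot> k = s \<cdot> bang y" using c_true[OF Comp_in_Hom[OF k b]] by simp
          then have "(l (g \<cdot>\<^bsub>I\<^esub> f) \<cdot> b) \<cdot> k = omega_true (Cod I (g \<cdot>\<^bsub>I\<^esub> f)) \<cdot> bang y"
            using Comp_assoc[OF k b l[OF gl]] Comp_assoc[OF y s(1) l[OF gl]] s(2)[OF gl] by simp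
          then show ?thesis
            using fam_low[OF gl] Comp_assoc[OF k lb[OF b gl] ev_hom[OF r[OF gl] id_out[OF gfo]]]
              ev_omega_true_comp[OF r[OF gl] id_out[OF gfo] y] by simp
        qed
        then show ?thesis using fam_top[OF False] by (simp add: leq_def)
      next
        case gl: False
        then show ?thesis using fam_top[OF False] fam_top[OF gl] by (simp add: leq_def)
      qed
    qed
  qed
  have id_i: "Ident I i \<in> out i" "Ident I i \<notin> lower i" using out_ident[OF i] by auto
  have fam_onto: "\<exists>a b. a \<in> Hom C x Om \<and> b \<in> Hom C x M \<and> leq x a (c \<cdot> b) \<and>
      (\<forall>f \<in> out i. fam a b f = p f)" if x: "x \<in> Ob C" and p: "cosieve_family i x p" for x p
  proof -
    note pD = cosieve_familyD[OF p]
    \<comment> \<open>The restriction of \<open>p\<close> along each decreasing \<open>f\<close> is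
      represented in lower degree by some \<open>q f\<close>; these form a cone and so assemble to
      \<open>b\<close>.\<close>
    have "\<forall>f \<in> lower i. \<exists>h. h \<in> Hom C x (omega_ob (Cod I f)) \<and>
        (\<forall>g \<in> out (Cod I f). ev (Cod I f) g \<cdot> h = p (g \<cdot>\<^bsub>I\<^esub> f))"
    proof
      fix f assume f: "f \<in> lower i"
      then have "cosieve_family (Cod I f) x (\<lambda>g. p (g \<cdot>\<^bsub>I\<^esub> f))"
        using cosieve_family_precomp[of f x p] p by simp
      from ex1_implies_ex[OF represents_lift[OF rep_represents[OF r[OF f]] x this]]
      show "\<exists>h. h \<in> Hom C x (omega_ob (Cod I f)) \<and>
        (\<forall>g \<in> out (Cod I f). ev (Cod I f) g \<cdot> h = p (g \<cdot>\<^bsub>I\<^esub> f))" .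
    qed
    from bchoice[OF this] obtain q where q_all: "\<forall>f \<in> lower i. q f \<in> Hom C x (omega_ob (Cod I f)) \<and>
        (\<forall>g \<in> out (Cod I f). ev (Cod I f) g \<cdot> q f = p (g \<cdot>\<^bsub>I\<^esub> f))" ..
    have q: "\<And>f. f \<in> lower i \<Longrightarrow> q f \<in> Hom C x (omega_ob (Cod I f))"
        "\<And>f g. f \<in> lower i \<Longrightarrow> g \<in> out (Cod I f) \<Longrightarrow> ev (Cod I f) g \<cdot> q f = p (g \<cdot>\<^bsub>I\<^esub> f)"
      using q_all by blast+
    \<comment> \<open>Both sides represent the restriction of \<open>p\<close> along
      \<open>h\<close> after \<open>f\<close>.\<close>
    have q_nat: "omega_arr h \<cdot> q f = q (h \<cdot>\<^bsub>I\<^esub> f)" if f: "f \<in> lower i" and h: "h \<in> out (Cod I f)" for f h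
    proof -
      note hf = lower_comp[OF f h]
      have hC: "Cod I (h \<cdot>\<^bsub>I\<^esub> f) = Cod I h" and hA: "h \<in> Arr I" and hD: "Dom I h = Cod I f"
        and fA: "f \<in> Arr I" using out_comp[of f i h] f h by auto
      have rh: "rep (Dom I h)" "rep (Cod I h)" using r[OF f] r[OF hf] hC hD by auto
      have oh: "omega_arr h \<in> Hom C (omega_ob (Cod I f)) (omega_ob (Cod I h))"
        using omega_arr(1)[OF hA rh] hD by simp
      show ?thesis
      proof (rule represents_unique[OF rep_represents[OF rh(2)] Comp_in_Hom[OF q(1)[OF f] oh]])
        show "q (h \<cdot>\<^bsub>I\<^esub> f) \<in> Hom C x (omega_ob (Cod I h))" using q(1)[OF hf] hC by simp
        fix g assume g: "g \<in> out (Cod I h)"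
        have "ev (Cod I h) g \<cdot> (omega_arr h \<cdot> q f) = ev (Cod I f) (g \<cdot>\<^bsub>I\<^esub> h) \<cdot> q f"
          using Comp_assoc[OF q(1)[OF f] oh ev_hom[OF rh(2) g]] omega_arr(2)[OF hA rh g] hD by simp
        also have "\<dots> = p ((g \<cdot>\<^bsub>I\<^esub> h) \<cdot>\<^bsub>I\<^esub> f)"
          using q(2)[OF f] out_comp[OF h g] by simp
        also have "\<dots> = ev (Cod I h) g \<cdot> q (h \<cdot>\<^bsub>I\<^esub> f)"
          using q(2)[OF hf, of g] hC g out_assoc[OF fA h g] by simp
        finally show "ev (Cod I h) g \<cdot> (omega_arr h \<cdot> q f) = ev (Cod I h) g \<cdot> q (h \<cdot>\<^bsub>I\<^esub> f)" .
      qed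
    qed
    have "is_cone (decreasing_coslice I deg i) C (fcomp Omega (codomain_functor I)) x q"
      unfolding is_cone_def
    proof (intro conjI ballI)
      fix f assume "f \<in> Ob (decreasing_coslice I deg i)"
      then have f: "f \<in> lower i" unfolding Ob_decreasing_coslice .
      show "q f \<in> Hom C x (FOb (fcomp Omega (codomain_functor I)) f)"
        using q(1)[OF f] fcomp_codomain_functor(1)[OF f] by simp
    next
      fix z assume "z \<in> Arr (decreasing_coslice I deg i)"
      then obtain f h where z: "z = (f, h, h \<cdot>\<^bsub>I\<^esub> f)" "f \<in> lower i" "h \<in> Hom I (Cod I f) (Cod I (h \<cdot>\<^bsub>I\<^esub> f))"
        unfolding Arr_decreasing_coslice by blast
      have h: "h \<in> out (Cod I f)" using HomD[OF z(3)] by simp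
      show "FArr (fcomp Omega (codomain_functor I)) z \<cdot> q (Dom (decreasing_coslice I deg i) z) =
          q (Cod (decreasing_coslice I deg i) z)"
        using q_nat[OF z(2) h] fcomp_codomain_functor(2)[of h] h
        by (simp add: z(1) decreasing_coslice_sel)
    qed (rule x)
    then obtain b where b: "b \<in> Hom C x M" "\<And>f. f \<in> lower i \<Longrightarrow> l f \<cdot> b = q f"
      using L unfolding is_limit_def Ob_decreasing_coslice by blast
    have a: "p (Ident I i) \<in> Hom C x Om" using pD(1)[OF id_i(1)] .
    \<comment> \<open>Where \<open>p\<close> is true at the identity it is true at every arrow. Each
      \<open>q f\<close> is then constantly true, and the limit makes \<open>b\<close> constant at
      \<open>s\<close>.\<close>
    have "leq x (p (Ident I i)) (c \<cdot> b)"
      unfolding leq_def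
    proof (intro allI ballI impI)
      fix y k assume k: "k \<in> Hom C y x" and pk: "p (Ident I i) \<cdot> k = truth y"
      have y: "bang y \<in> Hom C y u" using bang_hom[OF Hom_Ob(1)[OF k]] .
      have p_true: "p f \<cdot> k = truth y" if f: "f \<in> out i" for f
        using leqD[OF pD(2)[OF id_i(1), of f] k pk] f out_ident[OF i] I.Comp_Ident_right[of f] by simp
      have "b \<cdot> k = s \<cdot> bang y"
      proof (rule limit_unique[OF L Comp_in_Hom[OF k b(1)] Comp_in_Hom[OF y s(1)]])
        show "Dom (decreasing_coslice I deg i) z \<in> Ob (decreasing_coslice I deg i) \<and>
            Cod (decreasing_coslice I deg i) z \<in> Ob (decreasing_coslice I deg i)"
          if "z \<in> Arr (decreasing_coslice I deg i)" for z
          using that unfolding Arr_decreasing_coslice Ob_decreasing_coslice decreasing_coslice_sel by auto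
        show "is_functor (decreasing_coslice I deg i) C (fcomp Omega (codomain_functor I))"
          by (rule matching_diagram_functor) (rule low)
        fix f assume "f \<in> Ob (decreasing_coslice I deg i)"
        then have f: "f \<in> lower i" unfolding Ob_decreasing_coslice .
        then have fo: "f \<in> out i" by simp
        have cod: "Cod I f \<in> Ob I" using I.Cod_in_Ob fo by simp
        have "ev (Cod I f) (Ident I (Cod I f)) \<cdot> q f = p f"
          using q(2)[OF f id_out[OF fo]] I.Comp_Ident_left[of f] fo by simp
        then have "ev (Cod I f) (Ident I (Cod I f)) \<cdot> (q f \<cdot> k) = truth y"
          using Comp_assoc[OF k q(1)[OF f] ev_hom[OF r[OF f] id_out[OF fo]]] p_true[OF fo] by simp
        then have "q f \<cdot> k = omega_true (Cod I f) \<cdot> bang y"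
          using ev_ident_true_iff[OF cod r[OF f] Comp_in_Hom[OF k q(1)[OF f]]] by simp
        then show "l f \<cdot> (b \<cdot> k) = l f \<cdot> (s \<cdot> bang y)"
          using Comp_assoc[OF k b(1) l[OF f]] Comp_assoc[OF y s(1) l[OF f]] b(2)[OF f] s(2)[OF f] by simp
      qed
      then show "(c \<cdot> b) \<cdot> k = truth y"
        using c_true[OF Comp_in_Hom[OF k b(1)]] Comp_assoc[OF k b(1) c] by simp
    qed
    moreover have "fam (p (Ident I i)) b f = p f" if f: "f \<in> out i" for f
    proof (cases "f \<in> lower i")
      case True
      then show ?thesis
        using fam_low[OF True] b(2)[OF True] q(2)[OF True id_out[OF f]] I.Comp_Ident_left[of f] f by simp
    next
      case False
      then have "is_iso I f" using deg_cases[of f] f by auto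
      \<comment> \<open>An inverse of \<open>f\<close> leads back to the identity, so monotonicity
        applies in both directions and antisymmetry gives equality.\<close>
      then obtain g where g: "g \<in> out (Cod I f)" "g \<cdot>\<^bsub>I\<^esub> f = Ident I i"
        using f unfolding is_iso_def Hom_def by auto
      have "p (Ident I i) = p f"
        by (rule leq_antisym[OF a pD(1)[OF f]])
          (use pD(2)[OF id_i(1), of f] pD(2)[OF f g(1)] g out_ident[OF i] f I.Comp_Ident_right[of f] in auto)
      then show ?thesis using fam_top[OF False] by simp
    qed
    ultimately show ?thesis using a b(1) by blast
  qed
  \<comment> \<open>The value at the identity recovers \<open>a\<close>; the values at all
    composites with a decreasing \<open>f\<close> recover \<open>l f \<cdot> b\<close>, and these
    legs recover \<open>b\<close>.\<close>
  have fam_inj: "a = a' \<and> b = b'"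
    if b: "b \<in> Hom C x M" "b' \<in> Hom C x M" and eq: "\<And>f. f \<in> out i \<Longrightarrow> fam a b f = fam a' b' f"
    for x a b a' b'
  proof
    show "a = a'" using eq[OF id_i(1)] fam_top[OF id_i(2)] by simp
    show "b = b'"
    proof (rule limit_unique[OF L b])
      show "Dom (decreasing_coslice I deg i) z \<in> Ob (decreasing_coslice I deg i) \<and>
          Cod (decreasing_coslice I deg i) z \<in> Ob (decreasing_coslice I deg i)"
        if "z \<in> Arr (decreasing_coslice I deg i)" for z
        using that unfolding Arr_decreasing_coslice Ob_decreasing_coslice decreasing_coslice_sel by auto
      show "is_functor (decreasing_coslice I deg i) C (fcomp Omega (codomain_functor I))"
        by (rule matching_diagram_functor) (rule low)
      fix f assume "f \<in> Ob (decreasing_coslice I deg i)"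
      then have f: "f \<in> lower i" unfolding Ob_decreasing_coslice .
      show "l f \<cdot> b = l f \<cdot> b'"
      proof (rule represents_unique[OF rep_represents[OF r[OF f]] lb[OF b(1) f] lb[OF b(2) f]])
        fix g assume g: "g \<in> out (Cod I f)"
        have "g \<cdot>\<^bsub>I\<^esub> f \<in> out i" using lower_comp[OF f g] by simp
        from eq[OF this] show "ev (Cod I f) g \<cdot> (l f \<cdot> b) = ev (Cod I f) g \<cdot> (l f \<cdot> b')"
          using ev_l[OF b(1) f g, of a] ev_l[OF b(2) f g, of a'] by simp
      qed
    qed
  qed
  note pa = meet_prod_arr_hom[OF c]
  have e': "is_equaliser C e (proj1 C Om M) (internal_meet C t \<cdot> prod_arr C (Ident C Om) c)"
    using e by (simp add: c_def)
  then have eH: "e \<in> Hom C (Dom C e) (prod_ob C Om M)"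
    and e_eq: "proj1 C Om M \<cdot> e = (internal_meet C t \<cdot> prod_arr C (Ident C Om) c) \<cdot> e"
    using HomD[OF pr(1)] unfolding is_equaliser_def Hom_def by auto
  note ea = Comp_in_Hom[OF eH pr(1)] and eb = Comp_in_Hom[OF eH pr(2)]
  have e_leq: "leq (Dom C e) (proj1 C Om M \<cdot> e) (c \<cdot> (proj2 C Om M \<cdot> e))"
    using e_eq meet_equation_iff[OF c eH] by simp
  define v where "v = fam (proj1 C Om M \<cdot> e) (proj2 C Om M \<cdot> e)"
  have v: "cosieve_family i (Dom C e) v" unfolding v_def using fam_family[OF ea eb e_leq] .
  have v_comp: "v f \<cdot> h = fam (proj1 C Om M \<cdot> (e \<cdot> h)) (proj2 C Om M \<cdot> (e \<cdot> h)) f"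
    if h: "h \<in> Hom C x (Dom C e)" and f: "f \<in> out i" for x h f
  proof (cases "f \<in> lower i")
    case True
    show ?thesis
      unfolding v_def fam_low[OF True]
      using Comp_assoc[OF h lb[OF eb True] ev_hom[OF r[OF True] id_out[OF f]]]
        Comp_assoc[OF h eb l[OF True]] Comp_assoc[OF h eH pr(2)] by simp
  next
    case False
    show ?thesis unfolding v_def fam_top[OF False] using Comp_assoc[OF h eH pr(1)] .
  qed
  have "represents i (Dom C e) v"
    unfolding represents_def
  proof (intro conjI allI impI)
    show "Dom C e \<in> Ob C" using Hom_Ob[OF eH] by simp
    show "cosieve_family i (Dom C e) v" by (rule v)
    fix x p assume xp: "x \<in> Ob C \<and> cosieve_family i x p"
    then obtain a b where a: "a \<in> Hom C x Om" and b: "b \<in> Hom C x M" and ab: "leq x a (c \<cdot> b)"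
      and fam_p: "\<And>f. f \<in> out i \<Longrightarrow> fam a b f = p f" using fam_onto[of x p] by blast
    note ab_pair = pairing[OF a b]
    have "proj1 C Om M \<cdot> pairing C a b =
        (internal_meet C t \<cdot> prod_arr C (Ident C Om) c) \<cdot> pairing C a b"
      using meet_equation_iff[OF c ab_pair(1)] ab ab_pair by simp
    from equaliser_universal[OF e' _ this, of x]
    have ex: "\<exists>!h. h \<in> Hom C x (Dom C e) \<and> e \<cdot> h = pairing C a b"
      using ab_pair(1) HomD[OF pr(1)] by simp
    \<comment> \<open>Inducing the family \<open>p\<close> and lifting the pair \<open>a\<close>,
      \<open>b\<close> are the same condition on \<open>h\<close>, so the equaliser property
      supplies existence and uniqueness at once.\<close>
    have iff: "(\<forall>f \<in> out i. v f \<cdot> h = p f) \<longleftrightarrow> e \<cdot> h = pairing C a b"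
      if h: "h \<in> Hom C x (Dom C e)" for h
    proof
      note eh = Comp_in_Hom[OF h eH]
      show "\<forall>f \<in> out i. v f \<cdot> h = p f" if "e \<cdot> h = pairing C a b"
        using v_comp[OF h] fam_p ab_pair that by simp
      show "e \<cdot> h = pairing C a b" if vp: "\<forall>f \<in> out i. v f \<cdot> h = p f"
      proof -
        have "fam (proj1 C Om M \<cdot> (e \<cdot> h)) (proj2 C Om M \<cdot> (e \<cdot> h)) f = fam a b f"
          if f: "f \<in> out i" for f
          using v_comp[OF h f] vp[rule_format, OF f] fam_p[OF f] by simp
        from fam_inj[OF Comp_in_Hom[OF eh pr(2)] b this]
        show ?thesis
          using product_ext[OF Om_Ob M eh ab_pair(1)] ab_pair(2,3) by simp
      qed
    qed
    show "\<exists>!h. h \<in> Hom C x (Dom C e) \<and> (\<forall>f \<in> out i. v f \<cdot> h = p f)"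
    proof -
      have "h \<in> Hom C x (Dom C e) \<and> (\<forall>f \<in> out i. v f \<cdot> h = p f) \<longleftrightarrow>
          h \<in> Hom C x (Dom C e) \<and> e \<cdot> h = pairing C a b" for h
        using iff[of h] by blast
      with ex show ?thesis by presburger
    qed
  qed
  then show ?thesis unfolding v_def fam_def .
qed

lemma matching_limit:
  assumes "i \<in> Ob I" "is_functor (decreasing_coslice I deg i) C (fcomp X (codomain_functor I))"
  shows "is_limit (decreasing_coslice I deg i) C (fcomp X (codomain_functor I))
    (matching_ob I deg C i X) (matching_proj I deg C i X)"
  unfolding matching_ob_def matching_proj_def matching_cone_def
  using limit_cone_is_limit[OF matching_limits[OF assms(1)] assms(2)] .

text \<open>The arrows \<open>b f\<close> into \<open>u\<close> are left open to cover two apexes: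
  \<open>u\<close> itself with identities, for the induction, and the matching object of the
  terminal functor with its projections.\<close>

lemma omega_cone:
  assumes w: "w \<in> Ob C" and b: "\<And>f. f \<in> lower i \<Longrightarrow> b f \<in> Hom C w u"
    and low: "\<And>j. j \<in> Ob I \<Longrightarrow> deg j < deg i \<Longrightarrow> rep j"
  shows "is_cone (decreasing_coslice I deg i) C (fcomp Omega (codomain_functor I)) w
    (\<lambda>f. omega_true (Cod I f) \<cdot> b f)"
  unfolding is_cone_def
proof (intro conjI ballI)
  have r: "rep (Cod I f)" if "f \<in> lower i" for f using low[of "Cod I f"] that I.Cod_in_Ob by simp
  {
    fix f assume "f \<in> Ob (decreasing_coslice I deg i)"
    then have f: "f \<in> lower i" unfolding Ob_decreasing_coslice .
    show "omega_true (Cod I f) \<cdot> b f \<in> Hom C w (FOb (fcomp Omega (codomain_functor I)) f)"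
      unfolding fcomp_codomain_functor(1)[OF f]
      using Comp_in_Hom[OF b[OF f] omega_true(1)[OF r[OF f]]] .
  next
    fix z assume "z \<in> Arr (decreasing_coslice I deg i)"
    then obtain f h g where z: "z = (f, h, g)" and f: "f \<in> lower i" and g: "g \<in> lower i"
      and h: "h \<in> Hom I (Cod I f) (Cod I g)"
      unfolding Arr_decreasing_coslice by blast
    note hD = HomD[OF h]
    have rh: "rep (Dom I h)" "rep (Cod I h)" using r[OF f] r[OF g] hD by auto
    have oh: "omega_arr h \<in> Hom C (omega_ob (Cod I f)) (omega_ob (Cod I g))"
      using omega_arr(1)[OF hD(1) rh] hD by simp
    have "omega_arr h \<cdot> (omega_true (Cod I f) \<cdot> b f) = omega_true (Cod I g) \<cdot> b g"
      using Comp_assoc[OF b[OF f] omega_true(1)[OF r[OF f]] oh] omega_arr_true[OF hD(1) rh] hD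
        terminal_unique[OF terminal b[OF f] b[OF g]] by simp
    then show "FArr (fcomp Omega (codomain_functor I)) z \<cdot>
        (omega_true (Cod I (Dom (decreasing_coslice I deg i) z)) \<cdot> b (Dom (decreasing_coslice I deg i) z)) =
        omega_true (Cod I (Cod (decreasing_coslice I deg i) z)) \<cdot> b (Cod (decreasing_coslice I deg i) z)"
      using fcomp_codomain_functor(2)[OF hD(1)] by (simp add: z decreasing_coslice_sel)
  }
qed (rule w)

text \<open>Degree 0 requires no separate base case: \<open>lower i\<close> is empty there, so the
  limit \<open>M\<close> is terminal and the step applies as it stands.\<close>

lemma all_rep: "i \<in> Ob I \<Longrightarrow> rep i"
proof (induction "deg i" arbitrary: i rule: less_induct)
  case less
  note i = \<open>i \<in> Ob I\<close>
  have low: "\<And>j. j \<in> Ob I \<Longrightarrow> deg j < deg i \<Longrightarrow> rep j" using less.hyps by blast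
  obtain M l where L: "is_limit (decreasing_coslice I deg i) C (fcomp Omega (codomain_functor I)) M l"
    using matching_limit[OF i matching_diagram_functor[OF low]] by blast
  have "is_cone (decreasing_coslice I deg i) C (fcomp Omega (codomain_functor I)) u
      (\<lambda>f. omega_true (Cod I f) \<cdot> Ident C u)"
    by (rule omega_cone[OF u_Ob _ low]) (rule Ident_in_Hom[OF u_Ob])
  then obtain s where s: "s \<in> Hom C u M"
      "\<And>f. f \<in> lower i \<Longrightarrow> l f \<cdot> s = omega_true (Cod I f) \<cdot> Ident C u"
    using L unfolding is_limit_def Ob_decreasing_coslice by blast
  have s': "l f \<cdot> s = omega_true (Cod I f)" if f: "f \<in> lower i" for f
    using s(2)[OF f] comp_id[OF omega_true(1)[OF low[of "Cod I f"]]] I.Cod_in_Ob[of f] f by simp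
  define c where "c = char_map C t s"
  have c: "c \<in> Hom C M Om" unfolding c_def using char_map_hom[OF s(1) point_mono[OF s(1)]] .
  obtain e where "is_equaliser C e (proj1 C Om M) (internal_meet C t \<cdot> prod_arr C (Ident C Om) c)"
    using ex_equaliser[OF proj_hom(1)[OF Om_Ob Hom_Ob(1)[OF c]] meet_prod_arr_hom(1)[OF c]] by blast
  from equaliser_represents[OF i low L s(1) s' this[unfolded c_def]]
  show ?case unfolding rep_def by blast
qed

section \<open>The classifier\<close>

definition One :: "('i, 'a, 'o, 'm) fnctr" where
  "One = \<lparr>FOb = (\<lambda>i\<in>Ob I. u), FArr = (\<lambda>f\<in>Arr I. Ident C u)\<rparr>"

definition tru :: "('i, 'a, 'o, 'm) nattrans" where
  "tru = \<lparr>NSrc = One, NTgt = Omega, NAt = (\<lambda>i\<in>Ob I. omega_true i)\<rparr>"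

lemma One_at: "i \<in> Ob I \<Longrightarrow> FOb One i = u" "f \<in> Arr I \<Longrightarrow> FArr One f = Ident C u"
  by (simp_all add: One_def)

lemma Omega_at: "i \<in> Ob I \<Longrightarrow> FOb Omega i = omega_ob i" "f \<in> Arr I \<Longrightarrow> FArr Omega f = omega_arr f"
  by (simp_all add: Omega_def)

lemma tru_at: "NSrc tru = One" "NTgt tru = Omega" "i \<in> Ob I \<Longrightarrow> NAt tru i = omega_true i"
  by (simp_all add: tru_def)

lemma ext_functor_One: "ext_functor I C One"
proof -
  note id = Ident_in_Hom[OF u_Ob]
  show ?thesis
    unfolding ext_functor_def is_functor_def
    using u_Ob id comp_id[OF id] I.Dom_in_Ob I.Cod_in_Ob I.Ident_Arr I.Comp_Arr by (simp add: One_def)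
qed

lemma rep_Dom: "f \<in> Arr I \<Longrightarrow> rep (Dom I f)" and rep_Cod: "f \<in> Arr I \<Longrightarrow> rep (Cod I f)"
  using all_rep I.Dom_in_Ob I.Cod_in_Ob by auto

lemma ext_functor_Omega: "ext_functor I C Omega"
proof -
  have "omega_ob i \<in> Ob C" if "i \<in> Ob I" for i using representsD(1)[OF rep_represents[OF all_rep[OF that]]] .
  moreover have "omega_arr f \<in> Hom C (omega_ob (Dom I f)) (omega_ob (Cod I f))" if "f \<in> Arr I" for f
    using omega_arr(1)[OF that rep_Dom[OF that] rep_Cod[OF that]] .
  moreover have "omega_arr (g \<cdot>\<^bsub>I\<^esub> f) = omega_arr g \<cdot> omega_arr f"
    if "f \<in> Arr I" "g \<in> Arr I" "Cod I f = Dom I g" for f g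
    using omega_arr_comp[OF that rep_Dom[OF that(1)] rep_Cod[OF that(1)] rep_Cod[OF that(2)]] .
  ultimately show ?thesis
    unfolding ext_functor_def is_functor_def
    using omega_arr_ident all_rep I.Dom_in_Ob I.Cod_in_Ob I.Ident_Arr I.Comp_Arr by (simp add: Omega_def)
qed

lemma tru_hom: "tru \<in> Hom (functor_category I C) One Omega"
  unfolding tru_def
proof (rule functor_homI[OF ext_functor_One ext_functor_Omega])
  show "omega_true i \<in> Hom C (FOb One i) (FOb Omega i)" if "i \<in> Ob I" for i
    using omega_true(1)[OF all_rep[OF that]] that by (simp add: One_at Omega_at)
  show "Dom I f \<in> Ob I \<and> Cod I f \<in> Ob I" if "f \<in> Arr I" for f
    using I.Dom_in_Ob I.Cod_in_Ob that by simp
  fix f assume f: "f \<in> Arr I"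
  show "omega_true (Cod I f) \<cdot> FArr One f = FArr Omega f \<cdot> omega_true (Dom I f)"
    using omega_arr_true[OF f rep_Dom[OF f] rep_Cod[OF f]] comp_id[OF omega_true(1)[OF rep_Cod[OF f]]]
    by (simp add: One_at Omega_at f)
qed

lemma category_I: "category I" and category_C: "category C"
  by unfold_locales

lemma hom_OneI:
  assumes X: "ext_functor I C X"
  shows "\<lparr>NSrc = X, NTgt = One, NAt = (\<lambda>i\<in>Ob I. bang (FOb X i))\<rparr> \<in> Hom (functor_category I C) X One"
proof (rule functor_homI[OF X ext_functor_One])
  have F: "is_functor I C X" using X by (simp add: ext_functor_def)
  show b: "bang (FOb X i) \<in> Hom C (FOb X i) (FOb One i)" if "i \<in> Ob I" for i
    using bang_hom[OF functorD(1)[OF F that]] that by (simp add: One_at)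
  show ob: "Dom I f \<in> Ob I \<and> Cod I f \<in> Ob I" if "f \<in> Arr I" for f
    using I.Dom_in_Ob I.Cod_in_Ob that by simp
  fix f assume f: "f \<in> Arr I"
  note Of = functorD(2)[OF ext_functor_One[unfolded ext_functor_def, THEN conjunct1] f]
  have "bang (FOb X (Cod I f)) \<cdot> FArr X f \<in> Hom C (FOb X (Dom I f)) u"
    "FArr One f \<cdot> bang (FOb X (Dom I f)) \<in> Hom C (FOb X (Dom I f)) u"
    using Comp_in_Hom[OF functorD(2)[OF F f] b] Comp_in_Hom[OF b Of] ob[OF f] by (auto simp: One_at)
  then show "bang (FOb X (Cod I f)) \<cdot> FArr X f = FArr One f \<cdot> bang (FOb X (Dom I f))"
    using terminal_unique[OF terminal] by blast
qed

lemma terminal_One: "is_terminal (functor_category I C) One"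
  unfolding is_terminal_def
proof (intro conjI ballI)
  show "One \<in> Ob (functor_category I C)" using ext_functor_One by (simp add: functor_category_sel)
  fix X assume "X \<in> Ob (functor_category I C)"
  then have X: "ext_functor I C X" by (simp add: functor_category_sel)
  show "\<exists>!f. f \<in> Hom (functor_category I C) X One"
  proof (rule ex1I, rule hom_OneI[OF X])
    fix f assume f: "f \<in> Hom (functor_category I C) X One"
    show "f = \<lparr>NSrc = X, NTgt = One, NAt = (\<lambda>i\<in>Ob I. bang (FOb X i))\<rparr>"
      by (rule functor_hom_eqI[OF f hom_OneI[OF X]])
        (use functor_homD(1)[OF f] One_at(1) in \<open>auto intro!: bang_eq\<close>)
  qed
qed

text \<open>\<open>omega_true i\<close> is the pullback of \<open>t\<close> along evaluation at the identity.\<close>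

lemma pullback_omega_true_iff:
  assumes i: "i \<in> Ob I" and c: "c \<in> Hom C x (omega_ob i)"
  shows "is_pullback C m q c (omega_true i) \<longleftrightarrow> is_pullback C m q (ev i (Ident I i) \<cdot> c) t"
proof -
  note r = all_rep[OF i]
  have ei: "ev i (Ident I i) \<in> Hom C (omega_ob i) Om" using ev_hom[OF r] out_ident[OF i] by blast
  note ec = Comp_in_Hom[OF c ei] and tr = omega_true(1)[OF r]
  have iff: "c \<cdot> a = omega_true i \<cdot> b \<longleftrightarrow> (ev i (Ident I i) \<cdot> c) \<cdot> a = t \<cdot> b"
    if a: "a \<in> Hom C y x" and b: "b \<in> Hom C y u" for a b y
    using ev_ident_true_iff[OF i r Comp_in_Hom[OF a c]] Comp_assoc[OF a c ei] true_comp[OF b] bang_eq[OF b]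
    by simp
  show ?thesis
  proof
    assume "is_pullback C m q c (omega_true i)"
    from pullback_cong[OF this c ec tr true_hom iff] show "is_pullback C m q (ev i (Ident I i) \<cdot> c) t" .
  next
    assume "is_pullback C m q (ev i (Ident I i) \<cdot> c) t"
    from pullback_cong[OF this ec c true_hom tr iff[symmetric]] show "is_pullback C m q c (omega_true i)" .
  qed
qed

section \<open>Existence and uniqueness of classifying arrows\<close>

text \<open>At identities, the pullback taken pointwise shows that evaluating \<open>c\<close> gives
  the characteristic map of the component of \<open>m\<close>; naturality of \<open>c\<close>
  carries this to every \<open>f\<close>. As \<open>c\<close> is determined by its evaluations,
  uniqueness follows.\<close>

lemma classifying_arrow_ev:
  assumes m: "is_mono (functor_category I C) m" "m \<in> Hom (functor_category I C) A X"
    and c: "c \<in> Hom (functor_category I C) X Omega"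
    and pb: "is_pullback (functor_category I C) m q c tru" and f: "f \<in> Arr I"
  shows "ev (Dom I f) f \<cdot> NAt c (Dom I f) = char_map C t (NAt m (Cod I f)) \<cdot> FArr X f"
proof -
  note mD = functor_homD[OF m(2)] and cD = functor_homD[OF c]
  have ev_id: "ev j (Ident I j) \<cdot> NAt c j = char_map C t (NAt m j)" if j: "j \<in> Ob I" for j
  proof -
    have cj: "NAt c j \<in> Hom C (FOb X j) (omega_ob j)" using cD(1)[OF j] j by (simp add: Omega_at)
    have ei: "ev j (Ident I j) \<cdot> NAt c j \<in> Hom C (FOb X j) Om"
      using Comp_in_Hom[OF cj ev_hom[OF all_rep[OF j]]] out_ident[OF j] by blast
    have "is_pullback C (NAt m j) (NAt q j) (ev j (Ident I j) \<cdot> NAt c j) t"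
      using pullback_pointwise[OF category_I pb j] pullback_omega_true_iff[OF j cj] tru_at(3)[OF j] by simp
    note true_iff = pullback_true_iff[OF this ei, unfolded HomD(2)[OF mD(1)[OF j]]]
    note mj = mD(1)[OF j] mono_pointwise[OF category_I m(1) j]
    show ?thesis
      by (rule char_map_unique[OF mj ei char_map_hom[OF mj] true_iff char_map_true[OF mj]])
  qed
  note ob = I.Dom_in_Ob[OF f] I.Cod_in_Ob[OF f]
  have c1: "NAt c (Dom I f) \<in> Hom C (FOb X (Dom I f)) (omega_ob (Dom I f))"
    and c2: "NAt c (Cod I f) \<in> Hom C (FOb X (Cod I f)) (omega_ob (Cod I f))"
    using cD(1)[OF ob(1)] cD(1)[OF ob(2)] ob by (auto simp: Omega_at)
  note of = omega_arr(1)[OF f rep_Dom[OF f] rep_Cod[OF f]]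
  have ei: "ev (Cod I f) (Ident I (Cod I f)) \<in> Hom C (omega_ob (Cod I f)) Om"
    using ev_hom[OF rep_Cod[OF f]] out_ident[OF ob(2)] by blast
  have "ev (Dom I f) f \<cdot> NAt c (Dom I f) = ev (Cod I f) (Ident I (Cod I f)) \<cdot> (omega_arr f \<cdot> NAt c (Dom I f))"
    using ev_ident_comp[OF f rep_Dom[OF f] rep_Cod[OF f]] Comp_assoc[OF c1 of ei] by simp
  also have "omega_arr f \<cdot> NAt c (Dom I f) = NAt c (Cod I f) \<cdot> FArr X f"
    using cD(2)[OF f] f by (simp add: Omega_at)
  also have "ev (Cod I f) (Ident I (Cod I f)) \<cdot> (NAt c (Cod I f) \<cdot> FArr X f) =
      char_map C t (NAt m (Cod I f)) \<cdot> FArr X f"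
    using Comp_assoc[OF functorD(2)[OF mD(4) f] c2 ei] ev_id[OF ob(2)] by simp
  finally show ?thesis .
qed

text \<open>The family attached to an element of \<open>FOb X i\<close> asks, for each
  \<open>f\<close> out of \<open>i\<close>, whether \<open>FArr X f\<close> moves the element into
  the subobject at \<open>Cod I f\<close>. Representability turns these families into the components
  of \<open>c\<close>.\<close>

lemma ex_classifying_arrow:
  assumes m: "is_mono (functor_category I C) m" "m \<in> Hom (functor_category I C) A X"
  shows "\<exists>c q. c \<in> Hom (functor_category I C) X Omega \<and> is_pullback (functor_category I C) m q c tru"
proof -
  note mD = functor_homD[OF m(2)]
  have AX: "ext_functor I C A" "ext_functor I C X" using m(2) by (auto simp: functor_hom_iff)
  define chi where "chi j = char_map C t (NAt m j)" for j
  have mono: "is_mono C (NAt m j)" if "j \<in> Ob I" for j using mono_pointwise[OF category_I m(1) that] .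
  have chi: "chi j \<in> Hom C (FOb X j) Om" if "j \<in> Ob I" for j
    unfolding chi_def using char_map_hom[OF mD(1)[OF that] mono[OF that]] .
  have chi_true: "chi j \<cdot> k = truth y \<longleftrightarrow> (\<exists>h \<in> Hom C y (FOb A j). NAt m j \<cdot> h = k)"
    if "j \<in> Ob I" "k \<in> Hom C y (FOb X j)" for j k y
    unfolding chi_def using char_map_true[OF mD(1)[OF that(1)] mono[OF that(1)] that(2)] .
  have Xf: "FArr X f \<in> Hom C (FOb X (Dom I f)) (FOb X (Cod I f))" if "f \<in> Arr I" for f
    using functorD(2)[OF mD(4) that] .
  have chiX: "chi (Cod I f) \<cdot> FArr X f \<in> Hom C (FOb X (Dom I f)) Om" if "f \<in> Arr I" for f
    using Comp_in_Hom[OF Xf[OF that] chi[OF I.Cod_in_Ob[OF that]]] .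
  have Xgf: "FArr X (g \<cdot>\<^bsub>I\<^esub> f) = FArr X g \<cdot> FArr X f" if "f \<in> Arr I" "g \<in> out (Cod I f)" for f g
    using functorD(4)[OF mD(4)] that by simp
  have fam: "cosieve_family i (FOb X i) (\<lambda>f. chi (Cod I f) \<cdot> FArr X f)" for i
    unfolding cosieve_family_def
  proof (intro conjI ballI)
    fix f assume f: "f \<in> out i"
    then show "chi (Cod I f) \<cdot> FArr X f \<in> Hom C (FOb X i) Om" using chiX by auto
    fix g assume g: "g \<in> out (Cod I f)"
    have fA: "f \<in> Arr I" and gA: "g \<in> Arr I" and gD: "Dom I g = Cod I f" using f g by auto
    note ob = I.Cod_in_Ob[OF fA] I.Cod_in_Ob[OF gA]
    have Xf': "FArr X f \<in> Hom C (FOb X i) (FOb X (Cod I f))" using Xf[OF fA] f by simp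
    have Xg': "FArr X g \<in> Hom C (FOb X (Cod I f)) (FOb X (Cod I g))" using Xf[OF gA] gD by simp
    have Ag': "FArr A g \<in> Hom C (FOb A (Cod I f)) (FOb A (Cod I g))" using functorD(2)[OF mD(3) gA] gD by simp
    \<comment> \<open>Monotonicity: an element that lies in \<open>A\<close> after \<open>f\<close>
      is carried by \<open>FArr A g\<close> to a witness after \<open>g\<close>, by naturality of
      \<open>m\<close>.\<close>
    have "(chi (Cod I g) \<cdot> (FArr X g \<cdot> FArr X f)) \<cdot> k = truth y"
      if k: "k \<in> Hom C y (FOb X i)" and tr: "(chi (Cod I f) \<cdot> FArr X f) \<cdot> k = truth y" for y k
    proof -
      note Xfk = Comp_in_Hom[OF k Xf']
      obtain h where h: "h \<in> Hom C y (FOb A (Cod I f))" "NAt m (Cod I f) \<cdot> h = FArr X f \<cdot> k"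
        using tr chi_true[OF ob(1) Xfk] Comp_assoc[OF k Xf' chi[OF ob(1)]] by auto
      have "NAt m (Cod I g) \<cdot> (FArr A g \<cdot> h) = (FArr X g \<cdot> NAt m (Cod I f)) \<cdot> h"
        using Comp_assoc[OF h(1) Ag' mD(1)[OF ob(2)]] mD(2)[OF gA] gD by simp
      also have "\<dots> = FArr X g \<cdot> (FArr X f \<cdot> k)"
        using Comp_assoc[OF h(1) mD(1)[OF ob(1)] Xg'] h(2) by simp
      finally have "chi (Cod I g) \<cdot> (FArr X g \<cdot> (FArr X f \<cdot> k)) = truth y"
        using chi_true[OF ob(2) Comp_in_Hom[OF Xfk Xg']] Comp_in_Hom[OF h(1) Ag'] by blast
      then show ?thesis
        using Comp_assoc[OF k Xf' Xg'] Comp_assoc[OF k Comp_in_Hom[OF Xf' Xg'] chi[OF ob(2)]] by simp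
    qed
    then show "leq (FOb X i) (chi (Cod I f) \<cdot> FArr X f) (chi (Cod I (g \<cdot>\<^bsub>I\<^esub> f)) \<cdot> FArr X (g \<cdot>\<^bsub>I\<^esub> f))"
      unfolding leq_def using Xgf[OF fA g] out_comp[OF f g] by simp
  qed
  have "\<forall>i \<in> Ob I. \<exists>h. h \<in> Hom C (FOb X i) (omega_ob i) \<and>
      (\<forall>f \<in> out i. ev i f \<cdot> h = chi (Cod I f) \<cdot> FArr X f)"
  proof
    fix i assume i: "i \<in> Ob I"
    from ex1_implies_ex[OF represents_lift[OF rep_represents[OF all_rep[OF i]] functorD(1)[OF mD(4) i] fam]]
    show "\<exists>h. h \<in> Hom C (FOb X i) (omega_ob i) \<and> (\<forall>f \<in> out i. ev i f \<cdot> h = chi (Cod I f) \<cdot> FArr X f)" .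
  qed
  from bchoice[OF this] obtain d where d_all: "\<forall>i \<in> Ob I. d i \<in> Hom C (FOb X i) (omega_ob i) \<and>
      (\<forall>f \<in> out i. ev i f \<cdot> d i = chi (Cod I f) \<cdot> FArr X f)" ..
  have d: "\<And>i. i \<in> Ob I \<Longrightarrow> d i \<in> Hom C (FOb X i) (omega_ob i)"
    "\<And>i f. i \<in> Ob I \<Longrightarrow> f \<in> out i \<Longrightarrow> ev i f \<cdot> d i = chi (Cod I f) \<cdot> FArr X f"
    using d_all by blast+
  define c where "c = \<lparr>NSrc = X, NTgt = Omega, NAt = (\<lambda>i\<in>Ob I. d i)\<rparr>"
  have c: "c \<in> Hom (functor_category I C) X Omega"
    unfolding c_def
  proof (rule functor_homI[OF AX(2) ext_functor_Omega])
    show "d i \<in> Hom C (FOb X i) (FOb Omega i)" if "i \<in> Ob I" for i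
      using d(1)[OF that] that by (simp add: Omega_at)
    show "Dom I f \<in> Ob I \<and> Cod I f \<in> Ob I" if "f \<in> Arr I" for f
      using I.Dom_in_Ob I.Cod_in_Ob that by simp
    fix g assume g: "g \<in> Arr I"
    note ob = I.Dom_in_Ob[OF g] I.Cod_in_Ob[OF g] and r = rep_Dom[OF g] rep_Cod[OF g]
    note og = omega_arr(1)[OF g r]
    \<comment> \<open>Both composites induce the family that tests membership after \<open>X\<close>
      has acted along \<open>f \<cdot> g\<close>.\<close>
    have "d (Cod I g) \<cdot> FArr X g = omega_arr g \<cdot> d (Dom I g)"
    proof (rule represents_unique[OF rep_represents[OF r(2)] Comp_in_Hom[OF Xf[OF g] d(1)[OF ob(2)]]
          Comp_in_Hom[OF d(1)[OF ob(1)] og]])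
      fix f assume f: "f \<in> out (Cod I g)"
      have fg: "f \<cdot>\<^bsub>I\<^esub> g \<in> out (Dom I g)" "Cod I (f \<cdot>\<^bsub>I\<^esub> g) = Cod I f" using out_comp[of g "Dom I g" f] g f by auto
      have Xf': "FArr X f \<in> Hom C (FOb X (Cod I g)) (FOb X (Cod I f))" using Xf[of f] f by simp
      have cf: "chi (Cod I f) \<in> Hom C (FOb X (Cod I f)) Om" using chi I.Cod_in_Ob f by simp
      have "ev (Cod I g) f \<cdot> (d (Cod I g) \<cdot> FArr X g) = chi (Cod I f) \<cdot> (FArr X f \<cdot> FArr X g)"
        using Comp_assoc[OF Xf[OF g] d(1)[OF ob(2)] ev_hom[OF r(2) f]] d(2)[OF ob(2) f]
          Comp_assoc[OF Xf[OF g] Xf' cf] by simp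
      also have "\<dots> = ev (Cod I g) f \<cdot> (omega_arr g \<cdot> d (Dom I g))"
        using Comp_assoc[OF d(1)[OF ob(1)] og ev_hom[OF r(2) f]] omega_arr(2)[OF g r f]
          d(2)[OF ob(1) fg(1)] fg(2) Xgf[OF g f] by simp
      finally show "ev (Cod I g) f \<cdot> (d (Cod I g) \<cdot> FArr X g) = ev (Cod I g) f \<cdot> (omega_arr g \<cdot> d (Dom I g))" .
    qed
    then show "d (Cod I g) \<cdot> FArr X g = FArr Omega g \<cdot> d (Dom I g)" using g by (simp add: Omega_at)
  qed
  have c_at: "NAt c i = d i" if "i \<in> Ob I" for i using that by (simp add: c_def)
  define q where "q = \<lparr>NSrc = A, NTgt = One, NAt = (\<lambda>i\<in>Ob I. bang (FOb A i))\<rparr>"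
  have q: "q \<in> Hom (functor_category I C) A One" unfolding q_def using hom_OneI[OF AX(1)] .
  \<comment> \<open>Evaluation at the identity turns the square over \<open>omega_true i\<close>
    into that of the characteristic map \<open>chi i\<close>.\<close>
  have "is_pullback (functor_category I C) m q c tru"
  proof (rule functor_pullbackI[OF category_I category_C m(2) q c tru_hom])
    fix i assume i: "i \<in> Ob I"
    have "FArr X (Ident I i) = Ident C (FOb X i)" using functorD(3)[OF mD(4) i] .
    then have "ev i (Ident I i) \<cdot> d i = chi i"
      using d(2)[OF i conjunct1[OF out_ident[OF i]]] out_ident[OF i] comp_id[OF chi[OF i]] by simp
    moreover have "is_pullback C (NAt m i) (bang (FOb A i)) (chi i) t"
      by (rule pullback_trueI[OF mD(1)[OF i] mono[OF i] chi[OF i] chi_true[OF i]])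
    ultimately show "is_pullback C (NAt m i) (NAt q i) (NAt c i) (NAt tru i)"
      using pullback_omega_true_iff[OF i d(1)[OF i]] i by (simp add: c_at tru_at q_def)
  qed
  with c show ?thesis by blast
qed

lemma subobject_classifier_Omega: "is_subobject_classifier (functor_category I C) One Omega tru"
  unfolding is_subobject_classifier_def
proof (intro conjI allI impI)
  let ?F = "functor_category I C"
  show "is_terminal ?F One" by (rule terminal_One)
  show "tru \<in> Hom ?F One Omega" by (rule tru_hom)
  fix m assume m: "is_mono ?F m"
  define A X where "A = NSrc m" and "X = NTgt m"
  have mH: "m \<in> Hom ?F A X"
    unfolding A_def X_def by (rule functor_arr_hom) (use m in \<open>simp add: is_mono_def\<close>)
  have iff: "is_char_map ?F tru m c \<longleftrightarrow> c \<in> Hom ?F X Omega \<and> (\<exists>q. is_pullback ?F m q c tru)" for c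
    using HomD(3)[OF mH] HomD(3)[OF tru_hom] by (simp add: is_char_map_def)
  have unique: "c = d" if c: "c \<in> Hom ?F X Omega" "is_pullback ?F m q c tru"
    and d: "d \<in> Hom ?F X Omega" "is_pullback ?F m r d tru" for c d q r
  proof (rule functor_hom_eqI[OF c(1) d(1)])
    fix i assume i: "i \<in> Ob I"
    have at: "NAt c i \<in> Hom C (FOb X i) (omega_ob i)" "NAt d i \<in> Hom C (FOb X i) (omega_ob i)"
      using functor_homD(1)[OF c(1) i] functor_homD(1)[OF d(1) i] i by (auto simp: Omega_at)
    show "NAt c i = NAt d i"
    proof (rule represents_unique[OF rep_represents[OF all_rep[OF i]] at])
      fix f assume f: "f \<in> out i"
      then show "ev i f \<cdot> NAt c i = ev i f \<cdot> NAt d i"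
        using classifying_arrow_ev[OF m mH c, of f] classifying_arrow_ev[OF m mH d, of f] by auto
    qed
  qed
  show "\<exists>!c. is_char_map ?F tru m c"
    unfolding iff using ex_classifying_arrow[OF m mH] unique by blast
qed

section \<open>Matching objects and the equaliser description\<close>

lemma matching_ob_One_terminal:
  assumes i: "i \<in> Ob I"
  shows "is_functor (decreasing_coslice I deg i) C (fcomp One (codomain_functor I))"
    and "is_terminal C (matching_ob I deg C i One)"
    and "f \<in> lower i \<Longrightarrow> matching_proj I deg C i One f \<in> Hom C (matching_ob I deg C i One) u"
proof -
  let ?J = "decreasing_coslice I deg i" and ?D = "fcomp One (codomain_functor I)"
  note id = Ident_in_Hom[OF u_Ob]
  have D_ob: "FOb ?D f = u" if "f \<in> lower i" for f
    using that I.Cod_in_Ob by (simp add: fcomp_def codomain_functor_def One_def)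
  have D_arr: "FArr ?D (f, h, g) = Ident C u" if "h \<in> Arr I" for f h g
    using that by (simp add: fcomp_def codomain_functor_def One_def)
  show fn: "is_functor ?J C ?D"
    unfolding is_functor_def Ob_decreasing_coslice Arr_decreasing_coslice decreasing_coslice_sel
  proof (intro conjI ballI impI)
    show "FOb ?D f \<in> Ob C" if "f \<in> lower i" for f using D_ob[OF that] u_Ob by simp
    show "FArr ?D ((\<lambda>f. (f, Ident I (Cod I f), f)) f) = Ident C (FOb ?D f)" if "f \<in> lower i" for f
      using D_ob[OF that] D_arr[of "Ident I (Cod I f)"] I.Ident_Arr[of "Cod I f"] I.Cod_in_Ob that by simp
  next
    fix z assume "z \<in> {(f, h, g). f \<in> lower i \<and> g \<in> lower i \<and> h \<in> Hom I (Cod I f) (Cod I g) \<and> h \<cdot>\<^bsub>I\<^esub> f = g}"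
    then obtain f h g where z: "z = (f, h, g)" "f \<in> lower i" "g \<in> lower i" "h \<in> Hom I (Cod I f) (Cod I g)"
      by blast
    show "FArr ?D z \<in> Hom C (FOb ?D ((\<lambda>(f, h, g). f) z)) (FOb ?D ((\<lambda>(f, h, g). g) z))"
      using D_ob[OF z(2)] D_ob[OF z(3)] D_arr[OF HomD(1)[OF z(4)]] id by (simp add: z(1))
    fix z' assume "z' \<in> {(f, h, g). f \<in> lower i \<and> g \<in> lower i \<and> h \<in> Hom I (Cod I f) (Cod I g) \<and> h \<cdot>\<^bsub>I\<^esub> f = g}"
      and zz': "(case z of (f, h, g) \<Rightarrow> g) = (case z' of (f, h, g) \<Rightarrow> f)"
    then obtain h' g' where z': "z' = (g, h', g')" "h' \<in> Hom I (Cod I g) (Cod I g')"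
      using z(1) by auto
    show "FArr ?D ((\<lambda>(f', h', g') (f, h, g). (f, h' \<cdot>\<^bsub>I\<^esub> h, g')) z' z) = FArr ?D z' \<cdot> FArr ?D z"
      using D_arr[OF HomD(1)[OF z(4)]] D_arr[OF HomD(1)[OF z'(2)]]
        D_arr[OF HomD(1)[OF I.Comp_in_Hom[OF z(4) z'(2)]]] comp_id[OF id] by (simp add: z(1) z'(1))
  qed
  define v where "v = matching_ob I deg C i One"
  define l where "l = matching_proj I deg C i One"
  have L: "is_limit ?J C ?D v l" unfolding v_def l_def using matching_limit[OF i fn] .
  then have cone: "is_cone ?J C ?D v l" by (simp add: is_limit_def)
  then show "f \<in> lower i \<Longrightarrow> matching_proj I deg C i One f \<in> Hom C (matching_ob I deg C i One) u"
    using D_ob[of f] unfolding is_cone_def Ob_decreasing_coslice v_def l_def by auto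
  then have l: "l f \<in> Hom C v u" if "f \<in> lower i" for f
    using cone D_ob that unfolding is_cone_def Ob_decreasing_coslice by auto
  show "is_terminal C (matching_ob I deg C i One)"
    unfolding is_terminal_def v_def[symmetric]
  proof (intro conjI ballI)
    show "v \<in> Ob C" using cone by (simp add: is_cone_def)
    fix w assume w: "w \<in> Ob C"
    have "is_cone ?J C ?D w (\<lambda>_. bang w)"
      unfolding is_cone_def
    proof (intro conjI ballI)
      fix z assume "z \<in> Arr ?J"
      then show "FArr ?D z \<cdot> bang w = bang w"
        unfolding Arr_decreasing_coslice using D_arr id_comp[OF bang_hom[OF w]] by (auto simp: Hom_def)
    qed (use w bang_hom[OF w] D_ob in \<open>auto simp: Ob_decreasing_coslice\<close>)
    then have ex: "\<exists>!h. h \<in> Hom C w v \<and> (\<forall>j \<in> Ob ?J. l j \<cdot> h = bang w)"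
      using L unfolding is_limit_def by blast
    \<comment> \<open>All legs end in the terminal object, so every \<open>h\<close> into
      \<open>v\<close> satisfies the cone condition.\<close>
    have "l j \<cdot> h = bang w" if "h \<in> Hom C w v" "j \<in> Ob ?J" for h j
      by (rule bang_eq) (use Comp_in_Hom[OF that(1) l] that(2) in \<open>simp add: Ob_decreasing_coslice\<close>)
    then have "h \<in> Hom C w v \<and> (\<forall>j \<in> Ob ?J. l j \<cdot> h = bang w) \<longleftrightarrow> h \<in> Hom C w v" for h by blast
    then show "\<exists>!h. h \<in> Hom C w v" using ex by presburger
  qed
qed

text \<open>Shows that the point occurring in the theorem is the point of constant truths, as
  \<open>equaliser_represents\<close> demands of \<open>s\<close>.\<close>

lemma matching_point_tru:
  assumes i: "i \<in> Ob I"
  shows "matching_point I deg C u i tru \<in> Hom C u (matching_ob I deg C i Omega)"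
    and "f \<in> lower i \<Longrightarrow> matching_proj I deg C i Omega f \<cdot> matching_point I deg C u i tru =
      omega_true (Cod I f)"
proof -
  let ?J = "decreasing_coslice I deg i"
  define v l where "v = matching_ob I deg C i One" and "l = matching_proj I deg C i One"
  define M k where "M = matching_ob I deg C i Omega" and "k = matching_proj I deg C i Omega"
  have L: "is_limit ?J C (fcomp Omega (codomain_functor I)) M k"
    unfolding M_def k_def using matching_limit[OF i matching_diagram_functor] all_rep by blast
  then have cone: "is_cone ?J C (fcomp Omega (codomain_functor I)) M k" by (simp add: is_limit_def)
  have v: "is_terminal C v" and l: "\<And>f. f \<in> lower i \<Longrightarrow> l f \<in> Hom C v u"
    unfolding v_def l_def using matching_ob_One_terminal[OF i] by auto
  have kH: "k f \<in> Hom C M (omega_ob (Cod I f))" if "f \<in> lower i" for f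
    using cone fcomp_codomain_functor(1)[OF that] that unfolding is_cone_def Ob_decreasing_coslice by auto
  have "is_cone ?J C (fcomp Omega (codomain_functor I)) v (\<lambda>f. omega_true (Cod I f) \<cdot> l f)"
    by (rule omega_cone) (use v l all_rep in \<open>auto simp: is_terminal_def\<close>)
  then have ex: "\<exists>!h. h \<in> Hom C v M \<and> (\<forall>f \<in> Ob ?J. k f \<cdot> h = omega_true (Cod I f) \<cdot> l f)"
    using L unfolding is_limit_def by blast
  have nat: "NAt tru (Cod I f) = omega_true (Cod I f)" if "f \<in> Ob ?J" for f
    using that tru_at(3) I.Cod_in_Ob unfolding Ob_decreasing_coslice by simp
  have "matching_arr I deg C i tru =
      (THE h. h \<in> Hom C v M \<and> (\<forall>f \<in> Ob ?J. k f \<cdot> h = omega_true (Cod I f) \<cdot> l f))"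
    unfolding matching_arr_def tru_at v_def M_def k_def l_def using nat by simp
  then have a: "matching_arr I deg C i tru \<in> Hom C v M"
    "\<And>f. f \<in> lower i \<Longrightarrow> k f \<cdot> matching_arr I deg C i tru = omega_true (Cod I f) \<cdot> l f"
    using theI'[OF ex] unfolding Ob_decreasing_coslice by auto
  have b: "unique_arrow C u v \<in> Hom C u v" using terminal_arrow[OF v u_Ob] .
  have p: "matching_point I deg C u i tru = matching_arr I deg C i tru \<cdot> unique_arrow C u v"
    by (simp add: matching_point_def tru_at v_def)
  show "matching_point I deg C u i tru \<in> Hom C u (matching_ob I deg C i Omega)"
    unfolding p M_def[symmetric] using Comp_in_Hom[OF b a(1)] .
  show "matching_proj I deg C i Omega f \<cdot> matching_point I deg C u i tru = omega_true (Cod I f)"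
    if f: "f \<in> lower i"
  proof -
    have "rep (Cod I f)" using rep_Cod f by simp
    note tr = omega_true(1)[OF this]
    have "l f \<cdot> unique_arrow C u v = Ident C u"
      using terminal_unique[OF terminal Comp_in_Hom[OF b l[OF f]] Ident_in_Hom[OF u_Ob]] .
    then show ?thesis
      unfolding p k_def[symmetric]
      using Comp_assoc[OF b a(1) kH[OF f]] a(2)[OF f] Comp_assoc[OF b l[OF f] tr] comp_id[OF tr] by simp
  qed
qed

text \<open>The equaliser and the chosen \<open>omega_ob i\<close> represent the same families, so
  the comparison \<open>h\<close> is an isomorphism and \<open>e \<cdot> h\<close> is the inclusion
  sought.\<close>

lemma Omega_equaliser:
  fixes i
  defines "M \<equiv> matching_ob I deg C i Omega" and "s \<equiv> matching_point I deg C u i tru"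
  assumes i: "i \<in> Ob I"
  shows "\<exists>e \<in> Hom C (omega_ob i) (prod_ob C Om M).
    is_equaliser C e (proj1 C Om M) (internal_meet C t \<cdot> prod_arr C (Ident C Om) (char_map C t s)) \<and>
    proj1 C Om M \<cdot> (e \<cdot> omega_true i) = t \<cdot> bang u \<and>
    proj2 C Om M \<cdot> (e \<cdot> omega_true i) = s \<cdot> bang u"
proof -
  note r = all_rep[OF i]
  note R = rep_represents[OF r]
  have L: "is_limit (decreasing_coslice I deg i) C (fcomp Omega (codomain_functor I)) M
      (matching_proj I deg C i Omega)"
    unfolding M_def using matching_limit[OF i matching_diagram_functor] all_rep by blast
  have s: "s \<in> Hom C u M" "\<And>f. f \<in> lower i \<Longrightarrow> matching_proj I deg C i Omega f \<cdot> s = omega_true (Cod I f)"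
    unfolding s_def M_def using matching_point_tru[OF i] by auto
  note c = char_map_hom[OF s(1) point_mono[OF s(1)]]
  note pr = proj_hom[OF Om_Ob Hom_Ob(1)[OF c]]
  obtain e where e: "is_equaliser C e (proj1 C Om M)
      (internal_meet C t \<cdot> prod_arr C (Ident C Om) (char_map C t s))"
    using ex_equaliser[OF pr(1) meet_prod_arr_hom(1)[OF c]] by blast
  define v where "v = (\<lambda>f. if f \<in> lower i then ev (Cod I f) (Ident I (Cod I f)) \<cdot>
    (matching_proj I deg C i Omega f \<cdot> (proj2 C Om M \<cdot> e)) else proj1 C Om M \<cdot> e)"
  have V: "represents i (Dom C e) v"
    unfolding v_def by (rule equaliser_represents[OF i all_rep L s e])
  obtain h where h: "h \<in> Hom C (omega_ob i) (Dom C e)" "\<And>f. f \<in> out i \<Longrightarrow> v f \<cdot> h = ev i f"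
    using represents_lift[OF V representsD[OF R]] by blast
  obtain k where k: "k \<in> Hom C (Dom C e) (omega_ob i)" "\<And>f. f \<in> out i \<Longrightarrow> ev i f \<cdot> k = v f"
    using represents_lift[OF R representsD[OF V]] by blast
  note vH = cosieve_familyD(1)[OF representsD(2)[OF V]]
  have hk: "h \<cdot> k = Ident C (Dom C e)"
    by (rule represents_unique[OF V Comp_in_Hom[OF k(1) h(1)] Ident_in_Hom[OF representsD(1)[OF V]]])
      (metis Comp_assoc[OF k(1) h(1) vH] h(2) k(2) comp_id[OF vH])
  have kh: "k \<cdot> h = Ident C (omega_ob i)"
    by (rule represents_unique[OF R Comp_in_Hom[OF h(1) k(1)] Ident_in_Hom[OF representsD(1)[OF R]]])
      (metis Comp_assoc[OF h(1) k(1) ev_hom[OF r]] h(2) k(2) comp_id[OF ev_hom[OF r]])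
  note eq = equaliser_iso[OF e h(1) k(1) hk kh]
  have eH: "e \<in> Hom C (Dom C e) (prod_ob C Om M)"
    using e HomD[OF pr(1)] unfolding is_equaliser_def Hom_def by auto
  note eh = Comp_in_Hom[OF h(1) eH] and tr = omega_true(1)[OF r]
  note ehtr = Comp_in_Hom[OF tr eh]
  have id: "Ident I i \<in> out i" "Ident I i \<notin> lower i" using out_ident[OF i] by auto
  \<comment> \<open>The identity is not decreasing, so there the universal family of the equaliser
    is the first projection.\<close>
  have "v (Ident I i) = proj1 C Om M \<cdot> e" using id(2) by (simp only: v_def if_False)
  then have "proj1 C Om M \<cdot> (e \<cdot> h) = ev i (Ident I i)"
    using h(2)[OF id(1)] Comp_assoc[OF h(1) eH pr(1)] by simp
  then have p1: "proj1 C Om M \<cdot> ((e \<cdot> h) \<cdot> omega_true i) = truth u"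
    using Comp_assoc[OF tr eh pr(1)] omega_true(2)[OF r id(1)] truth_terminal by simp
  \<comment> \<open>The second component is forced: the first is true, so the equaliser equation
    makes the characteristic map of \<open>s\<close> true at the second, which is therefore constant
    at \<open>s\<close>.\<close>
  have "proj1 C Om M \<cdot> ((e \<cdot> h) \<cdot> omega_true i) =
      (internal_meet C t \<cdot> prod_arr C (Ident C Om) (char_map C t s)) \<cdot> ((e \<cdot> h) \<cdot> omega_true i)"
    using eq Comp_assoc[OF tr eh pr(1)] Comp_assoc[OF tr eh meet_prod_arr_hom(1)[OF c]]
    by (simp add: is_equaliser_def)
  then have le: "leq u (proj1 C Om M \<cdot> ((e \<cdot> h) \<cdot> omega_true i))
      (char_map C t s \<cdot> (proj2 C Om M \<cdot> ((e \<cdot> h) \<cdot> omega_true i)))"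
    using meet_equation_iff[OF c ehtr] by simp
  note p2H = Comp_in_Hom[OF ehtr pr(2)]
  have "char_map C t s \<cdot> (proj2 C Om M \<cdot> ((e \<cdot> h) \<cdot> omega_true i)) = truth u"
    using leqD[OF le Ident_in_Hom[OF u_Ob]] p1 comp_id[OF truth_hom[OF u_Ob]]
      comp_id[OF Comp_in_Hom[OF p2H c]] by simp
  then have "proj2 C Om M \<cdot> ((e \<cdot> h) \<cdot> omega_true i) = s \<cdot> bang u"
    using point_char_map_true[OF s(1) p2H] by simp
  then show ?thesis using eq eh p1 unfolding truth_def by blast
qed

end

theorem corollary5p3:
  fixes I :: "('i, 'a) cat" and deg :: "'i \<Rightarrow> nat" and E :: "('o, 'm) cat"
    and one_E Omega_E :: 'o and true_E :: 'm
  assumes "generalised_inverse_category I deg"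
    and "category E"
    and "\<And>i. i \<in> Ob I \<Longrightarrow> has_limits_of_shape (decreasing_coslice I deg i) E"
    and "(\<forall>n. connected_groupoid (degree_groupoid I deg n)) \<or> (\<exists>z. is_initial E z)"
    and "has_finite_limits E"
    and "is_subobject_classifier E one_E Omega_E true_E"
  shows "\<exists>one Omega tr.
    is_subobject_classifier (functor_category I E) one Omega tr \<and>
    (\<forall>i \<in> Ob I.
      let M\<Omega> = matching_ob I deg E i Omega;
          Mtrue = matching_point I deg E one_E i tr;
          \<chi> = char_map E true_E Mtrue;
          bang = unique_arrow E (FOb one i) one_E
      in is_terminal E (FOb one i) \<and>
         is_terminal E (matching_ob I deg E i one) \<and>
         (\<exists>e \<in> Hom E (FOb Omega i) (prod_ob E Omega_E M\<Omega>).
            is_equaliser E e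
              (proj1 E Omega_E M\<Omega>)
              (internal_meet E true_E \<cdot>\<^bsub>E\<^esub> prod_arr E (Ident E Omega_E) \<chi>) \<and>
            proj1 E Omega_E M\<Omega> \<cdot>\<^bsub>E\<^esub> (e \<cdot>\<^bsub>E\<^esub> NAt tr i) = true_E \<cdot>\<^bsub>E\<^esub> bang \<and>
            proj2 E Omega_E M\<Omega> \<cdot>\<^bsub>E\<^esub> (e \<cdot>\<^bsub>E\<^esub> NAt tr i) = Mtrue \<cdot>\<^bsub>E\<^esub> bang))"
proof -
  interpret I: category I using assms(1) by (simp add: generalised_inverse_category_def)
  interpret E: category E by fact
  interpret P: classified_inverse E one_E Omega_E true_E I deg
    by unfold_locales (fact assms)+
  \<comment> \<open>The terminal functor chosen has the value \<open>one_E\<close> at every object,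
    so \<open>bang\<close> in the statement becomes the endomorphism
    \<open>unique_arrow E one_E one_E\<close>.\<close>
  show ?thesis
    using P.subobject_classifier_Omega P.terminal P.matching_ob_One_terminal(2) P.Omega_equaliser
    by (intro exI[of _ P.One] exI[of _ P.Omega] exI[of _ P.tru])
      (simp add: Let_def P.One_at P.Omega_at P.tru_at)
qed

end
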